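(* Let $(X,\mu,S)$ be a finitely generated multiplicative system. Then $$L^2(X)=\mathcal{H}_{\mathrm{pr.rat}}\oplus\mathcal{H}_{\mathrm{aper}}$$ (orthogonal direct sum).
   Context: $\mathbb{N}=\{1,2,\dots\}$, $\mathbb{P}$ is the set of primes. Every probability space $(X,\mu)$ is assumed regular: $X$ is a compact metric space with its Borel $\sigma$-algebra. A multiplicative system $(X,\mu,S)$ consists of a probability space $(X,\mu)$ and a sequence $S=(S_n)_{n\in\mathbb{N}}$ of commuting invertible measure-preserving transformations of $(X,\mu)$ with $S_{nm}=S_n\circ S_m$ for all $n,m\in\mathbb{N}$. It is finitely generated if $\{S_p:p\in\mathbb{P}\}$ is finite. For $F\in L^2(X)$, $S_nF=F\circ S_n$. For a Dirichlet character $\chi$ let $\mathcal{H}_\chi=\{F\in L^2(X):\sum_{p\in\mathbb{P}}\frac{\|S_pF-\chi(p)F\|_2^2}{p}<\infty\}$ (the finitely many primes with $\chi(p)=0$ do not affect this condition). Define the closed subspaces $$\mathcal{H}_{\mathrm{pr.rat}}=\overline{\mathrm{span}\Big(\bigcup_\chi\mathcal{H}_\chi\Big)},$$ the union being over all Dirichlet characters $\chi$, and $$\mathcal{H}_{\mathrm{aper}}=\Big\{F\in L^2(X):\lim_{N\to\infty}\Big\|\frac1N\sum_{n=1}^N S_{qn+r}F\Big\|_2=0\text{ for all }r,q\in\mathbb{N}\Big\}.$$ *)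

theory Defs
  imports
    "HOL-Probability.Probability"
    "HOL-Library.Function_Algebras"
    "HOL-Computational_Algebra.Primes"
begin

text \<open>
  The compact metric space is the carrier \<open>space M\<close>, a compact subset of a metric space type.
  Equations between transformations hold everywhere on the carrier, and the values of the maps
  outside of it are irrelevant. Since the index set is \<open>{1, 2, \<dots>}\<close>, nothing is assumed about
  \<open>S 0\<close>.
\<close>

locale multiplicative_system = prob_space M
  for M :: "'a::metric_space measure" +
  fixes S :: "nat \<Rightarrow> 'a \<Rightarrow> 'a"
  assumes compact_space: "compact (space M)"
    and sets_eq_borel: "sets M = sets (restrict_space borel (space M))"
    and measurable: "n \<ge> 1 \<Longrightarrow> S n \<in> measurable M M"
    and measure_preserving: "n \<ge> 1 \<Longrightarrow> distr M M (S n) = M"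
    and bij: "n \<ge> 1 \<Longrightarrow> bij_betw (S n) (space M) (space M)"
    and measurable_inverse: "n \<ge> 1 \<Longrightarrow> the_inv_into (space M) (S n) \<in> measurable M M"
    and commute: "n \<ge> 1 \<Longrightarrow> m \<ge> 1 \<Longrightarrow> x \<in> space M \<Longrightarrow> S n (S m x) = S m (S n x)"
    and multiplicative: "n \<ge> 1 \<Longrightarrow> m \<ge> 1 \<Longrightarrow> x \<in> space M \<Longrightarrow> S (n * m) x = S n (S m x)"

locale finitely_generated_multiplicative_system = multiplicative_system +
  assumes finitely_generated: "finite {restrict (S p) (space M) | p. prime p}"

text \<open>
  Elements of \<open>L\<^sup>2\<close> are represented by functions, not by classes modulo almost everywhere equality.
  All subspaces below are closed under almost everywhere equality, as \<open>L2_norm\<close> only is a seminorm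
  on functions. Functions carry the pointwise operations of Function Algebras, and the following
  scalar multiplication makes them a complex vector space.
\<close>

definition cscale :: "complex \<Rightarrow> ('a \<Rightarrow> complex) \<Rightarrow> 'a \<Rightarrow> complex" where
  "cscale c F = (\<lambda>x. c * F x)"

global_interpretation cfun: vector_space cscale
  by unfold_locales (auto simp: cscale_def fun_eq_iff algebra_simps)

definition L2 :: "'a measure \<Rightarrow> ('a \<Rightarrow> complex) set" where
  "L2 M = {F \<in> borel_measurable M. integrable M (\<lambda>x. (cmod (F x))\<^sup>2)}"

definition L2_norm :: "'a measure \<Rightarrow> ('a \<Rightarrow> complex) \<Rightarrow> real" where
  "L2_norm M F = sqrt (LINT x|M. (cmod (F x))\<^sup>2)"

definition L2_inner :: "'a measure \<Rightarrow> ('a \<Rightarrow> complex) \<Rightarrow> ('a \<Rightarrow> complex) \<Rightarrow> complex" where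
  "L2_inner M F G = (LINT x|M. F x * cnj (G x))"

definition L2_closure :: "'a measure \<Rightarrow> ('a \<Rightarrow> complex) set \<Rightarrow> ('a \<Rightarrow> complex) set" where
  "L2_closure M A = {F \<in> L2 M. \<forall>\<epsilon>>0. \<exists>G\<in>A. L2_norm M (F - G) < \<epsilon>}"

definition closed_L2_subspace :: "'a measure \<Rightarrow> ('a \<Rightarrow> complex) set \<Rightarrow> bool" where
  "closed_L2_subspace M A \<longleftrightarrow> A \<subseteq> L2 M \<and> cfun.subspace A \<and> L2_closure M A = A"

text \<open>
  Orthogonality forces the two summands to intersect only in functions vanishing almost everywhere,
  so the decomposition is unique as a decomposition of \<open>L\<^sup>2\<close> classes.
\<close>

definition L2_orthogonal_direct_sum ::
    "'a measure \<Rightarrow> ('a \<Rightarrow> complex) set \<Rightarrow> ('a \<Rightarrow> complex) set \<Rightarrow> bool" where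
  "L2_orthogonal_direct_sum M A B \<longleftrightarrow>
     closed_L2_subspace M A \<and> closed_L2_subspace M B \<and>
     (\<forall>F\<in>A. \<forall>G\<in>B. L2_inner M F G = 0) \<and>
     L2 M = {F + G | F G. F \<in> A \<and> G \<in> B}"

definition dirichlet_character :: "nat \<Rightarrow> (nat \<Rightarrow> complex) \<Rightarrow> bool" where
  "dirichlet_character q chi \<longleftrightarrow>
     q \<ge> 1 \<and>
     (\<forall>m n. chi (m * n) = chi m * chi n) \<and>
     (\<forall>n. chi (n + q) = chi n) \<and>
     (\<forall>n. chi n \<noteq> 0 \<longleftrightarrow> coprime n q)"

definition H_char ::
    "'a measure \<Rightarrow> (nat \<Rightarrow> 'a \<Rightarrow> 'a) \<Rightarrow> (nat \<Rightarrow> complex) \<Rightarrow> ('a \<Rightarrow> complex) set" where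
  "H_char M S chi =
     {F \<in> L2 M. (\<lambda>p. (L2_norm M ((F \<circ> S p) - cscale (chi p) F))\<^sup>2 / real p) summable_on {p. prime p}}"

definition H_pr_rat :: "'a measure \<Rightarrow> (nat \<Rightarrow> 'a \<Rightarrow> 'a) \<Rightarrow> ('a \<Rightarrow> complex) set" where
  "H_pr_rat M S =
     L2_closure M (cfun.span (\<Union>chi\<in>{chi. \<exists>q. dirichlet_character q chi}. H_char M S chi))"

definition H_aper :: "'a measure \<Rightarrow> (nat \<Rightarrow> 'a \<Rightarrow> 'a) \<Rightarrow> ('a \<Rightarrow> complex) set" where
  "H_aper M S =
     {F \<in> L2 M. \<forall>r\<ge>1. \<forall>q\<ge>1.
        (\<lambda>N. L2_norm M (cscale (1 / of_nat N) (\<Sum>n=1..N. (F \<circ> S (q * n + r))))) \<longlonglongrightarrow> 0}"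

end

theory Submission
  imports Defs "HOL-Number_Theory.Number_Theory" "HOL-Computational_Algebra.Squarefree"
begin

text \<open>
  Twisting \<open>S\<close> by Dirichlet characters reduces the claim that the orthogonal complement of
  \<open>H_pr_rat\<close> lies in \<open>H_aper\<close> to a mean value theorem: if \<open>T\<close> is attained by \<open>U p\<close> on a set of
  primes with divergent reciprocal sum, then the averages \<open>A(x)\<close> of \<open>U n F\<close> over \<open>n \<le> x\<close> tend to
  \<open>0\<close> for \<open>F = T G - G\<close>.

  By the Turan--Kubilius inequality \<open>A(x)\<close> is close to the average of \<open>U d A(x/d)\<close> over the \<open>d\<close> in a
  suitable finite set. If the norm of \<open>A(x)\<close> is almost maximal, strict convexity forces
  \<open>U d A(x/d)\<close> to be close to \<open>A(x)\<close> for most primes \<open>d\<close> and most products \<open>d\<close> of two primes, and by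
  Selberg's formula these \<open>d\<close> meet all short intervals of some long window. Only finitely
  many operators \<open>U d\<close> occur, so \<open>t \<mapsto> A(x/t)\<close>, which varies slowly, stays near a finite set and is
  almost constant on the window. The Turan--Kubilius inequality for the primes with \<open>U p = T\<close> then
  shows that some \<open>A(x')\<close> of almost maximal norm is almost fixed by \<open>T\<close>, which is impossible for
  averages of \<open>T G - G\<close> unless they are small.
\<close>


section \<open>Sums over integers up to a real number and the Moebius function\<close>

text \<open>The model obstacle is \<open>S p F\<close> equal to \<open>F\<close> times an imaginary
  power of \<open>p\<close>: the averages then rotate slowly without shrinking, although no
  Dirichlet character explains them. Finitely many operators \<open>U d\<close> cannot produce such
  a rotation, but this is visible only if suitable \<open>d\<close> occur in every short logarithmic
  interval. Selberg's formula bounds primes and products of two primes from below only jointly,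
  hence both kinds of \<open>d\<close>. At one scale the reciprocals of these \<open>d\<close> have
  a bounded sum, no larger in order than the Turan--Kubilius error; over \<open>S\<close> separated
  scales an obstructing set needs a reciprocal sum of order \<open>S\<close>, whereas the error is
  only of order \<open>sqrt S\<close>.

  Finite generation also simplifies \<open>H_char\<close>: the distance from \<open>S p F\<close> to
  \<open>chi p * F\<close> takes finitely many values, so membership means that it is 0 at all
  primes outside a set with summable reciprocals. This yields the orthogonality of the two spaces:
  most terms of a suitable progression \<open>Q * k + 1\<close> have no prime factor in that
  set.\<close>

definition nats_le :: "real \<Rightarrow> nat set" where
  "nats_le x = {n. 0 < n \<and> real n \<le> x}"

lemma nats_le_altdef: "nats_le x = {1..nat \<lfloor>x\<rfloor>}"
  by (auto simp: nats_le_def le_nat_floor) linarith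

lemma finite_nats_le [simp, intro]: "finite (nats_le x)"
  by (simp add: nats_le_altdef)

lemma mem_nats_le: "n \<in> nats_le x \<longleftrightarrow> 0 < n \<and> real n \<le> x"
  by (simp add: nats_le_def)

lemma le_of_mult_le:
  assumes "real m * real n \<le> x"
  shows "0 < n \<Longrightarrow> real m \<le> x" "0 < m \<Longrightarrow> real n \<le> x"
proof -
  assume "0 < n"
  then have "real m * 1 \<le> real m * real n" by (intro mult_left_mono) auto
  with assms show "real m \<le> x" by simp
next
  assume "0 < m"
  then have "1 * real n \<le> real m * real n" by (intro mult_right_mono) auto
  with assms show "real n \<le> x" by simp
qed

lemma card_nats_le: "card (nats_le x) = nat \<lfloor>x\<rfloor>"
  by (simp add: nats_le_altdef)

lemma card_nats_le_bounds:
  assumes "x \<ge> 0"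
  shows "real (card (nats_le x)) \<le> x" "real (card (nats_le x)) > x - 1"
  using assms by (auto simp: card_nats_le)

lemma nats_le_less_1: "x < 1 \<Longrightarrow> nats_le x = {}"
  by (auto simp: nats_le_def)

lemma nats_le_mono: "x \<le> y \<Longrightarrow> nats_le x \<subseteq> nats_le y"
  by (auto simp: nats_le_def)

text \<open>Both sides run over the pairs of positive \<open>d\<close>, \<open>m\<close> with
  \<open>d * m \<le> x\<close>, grouped on the left by \<open>k = d * m\<close>. Sums of Dirichlet
  convolutions are evaluated this way.\<close>

lemma sum_divisors_swap:
  fixes f :: "nat \<Rightarrow> nat \<Rightarrow> 'b::comm_monoid_add"
  shows "(\<Sum>k\<in>nats_le x. \<Sum>d | d dvd k. f d (k div d)) = (\<Sum>d\<in>nats_le x. \<Sum>m\<in>nats_le (x / real d). f d m)"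
proof -
  have "(\<Sum>k\<in>nats_le x. \<Sum>d | d dvd k. f d (k div d))
      = (\<Sum>(k,d)\<in>Sigma (nats_le x) (\<lambda>k. {d. d dvd k}). f d (k div d))"
    by (rule sum.Sigma) (auto simp: mem_nats_le)
  also have "\<dots> = (\<Sum>(d,m)\<in>Sigma (nats_le x) (\<lambda>d. nats_le (x / real d)). f d m)"
  proof (rule sum.reindex_bij_witness[where i = "\<lambda>(d,m). (d * m, d)" and j = "\<lambda>(k,d). (d, k div d)"], goal_cases)
    case (2 a)
    then obtain k d where a: "a = (k, d)" "0 < k" "real k \<le> x" "d dvd k"
      by (auto simp: mem_nats_le)
    then obtain m where m: "k = d * m" by (elim dvdE)
    with a have "d > 0" "m > 0" by auto
    moreover have "real d \<le> real k" using a by (auto dest: dvd_imp_le)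
    with a have "real d \<le> x" by simp
    ultimately show ?case using a m by (auto simp: mem_nats_le field_simps)
  next
    case (4 b)
    then show ?case by (auto simp: mem_nats_le field_simps intro: le_of_mult_le)
  qed (auto simp: mem_nats_le)
  also have "\<dots> = (\<Sum>d\<in>nats_le x. \<Sum>m\<in>nats_le (x / real d). f d m)"
    by (rule sum.Sigma[symmetric]) auto
  finally show ?thesis .
qed

lemma sum_nats_le_swap:
  fixes f :: "nat \<Rightarrow> nat \<Rightarrow> 'b::comm_monoid_add"
  shows "(\<Sum>d\<in>nats_le x. \<Sum>m\<in>nats_le (x / real d). f d m) = (\<Sum>m\<in>nats_le x. \<Sum>d\<in>nats_le (x / real m). f d m)"
proof -
  have "(\<Sum>d\<in>nats_le x. \<Sum>m\<in>nats_le (x / real d). f d m)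
      = (\<Sum>(d,m)\<in>Sigma (nats_le x) (\<lambda>d. nats_le (x / real d)). f d m)"
    by (rule sum.Sigma) auto
  also have "\<dots> = (\<Sum>(m,d)\<in>Sigma (nats_le x) (\<lambda>m. nats_le (x / real m)). f d m)"
    by (rule sum.reindex_bij_witness[where i = "\<lambda>(m,d). (d,m)" and j = "\<lambda>(d,m). (m,d)"])
       (auto simp: mem_nats_le field_simps intro: le_of_mult_le)
  also have "\<dots> = (\<Sum>m\<in>nats_le x. \<Sum>d\<in>nats_le (x / real m). f d m)"
    by (rule sum.Sigma[symmetric]) auto
  finally show ?thesis .
qed

section \<open>The Moebius function and its pairing with the logarithm\<close>

definition moebius_mu :: "nat \<Rightarrow> real" where
  "moebius_mu n = (if squarefree n then (-1) ^ card (prime_factors n) else 0)"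

lemma abs_moebius_mu_le_1: "\<bar>moebius_mu n\<bar> \<le> 1"
  by (simp add: moebius_mu_def)

lemma moebius_mu_prime_mult:
  assumes "prime p" "\<not> p dvd d" "d > 0"
  shows "moebius_mu (p * d) = - moebius_mu d"
proof -
  have cop: "coprime p d" using assms by (simp add: prime_imp_coprime)
  have sf: "squarefree (p * d) \<longleftrightarrow> squarefree d"
    using cop assms squarefree_multD[of p d] squarefree_mult_coprime[of p d] squarefree_prime[of p] by blast
  have pf: "prime_factors (p * d) = insert p (prime_factors d)"
    using assms by (subst prime_factors_product) (auto simp: prime_prime_factors)
  have "p \<notin> prime_factors d" using assms by (auto simp: prime_factors_dvd)
  then show ?thesis unfolding moebius_mu_def sf pf by simp
qed

text \<open>Fix a prime \<open>p\<close> of \<open>n\<close>. Only squarefree divisors count, and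
  they fall into pairs \<open>d\<close>, \<open>p * d\<close> with \<open>p\<close> not dividing
  \<open>d\<close>, whose values cancel.\<close>

lemma sum_moebius_mu_divisors:
  assumes "n > 0"
  shows "(\<Sum>d | d dvd n. moebius_mu d) = (if n = 1 then 1 else 0)"
proof (cases "n = 1")
  case True
  then show ?thesis by (simp add: moebius_mu_def)
next
  case False
  then obtain p where p: "prime p" "p dvd n" using prime_factor_nat by blast
  define D where "D = {d. d dvd n \<and> squarefree d}"
  define D0 where "D0 = {d\<in>D. \<not> p dvd d}"
  have fin: "finite D" using assms by (auto simp: D_def)
  have 1: "(\<Sum>d | d dvd n. moebius_mu d) = (\<Sum>d\<in>D. moebius_mu d)"
    using assms by (intro sum.mono_neutral_right) (auto simp: D_def moebius_mu_def)
  have D: "D = D0 \<union> (\<lambda>d. p * d) ` D0"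
  proof (intro equalityI subsetI)
    fix d assume d: "d \<in> D"
    show "d \<in> D0 \<union> (\<lambda>d. p * d) ` D0"
    proof (cases "p dvd d")
      case True
      then obtain e where e: "d = p * e" by (elim dvdE)
      have "\<not> p dvd e"
      proof
        assume "p dvd e"
        then have "p\<^sup>2 dvd d" using e by (simp add: power2_eq_square)
        with d p show False by (auto simp: D_def squarefree_def)
      qed
      moreover have "e \<in> D" using d e
        by (auto simp: D_def dest: squarefree_multD intro: dvd_trans[of e d n])
      ultimately show ?thesis using e by (auto simp: D0_def)
    qed (use d in \<open>auto simp: D0_def\<close>)
  next
    fix d assume "d \<in> D0 \<union> (\<lambda>d. p * d) ` D0"
    moreover have "p * e \<in> D" if "e \<in> D0" for e
    proof -
      have "coprime p e" using that p by (auto simp: D0_def prime_imp_coprime)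
      then show ?thesis using that p by (auto simp: D0_def D_def divides_mult squarefree_mult_coprime squarefree_prime)
    qed
    ultimately show "d \<in> D" by (auto simp: D0_def)
  qed
  have inj: "inj_on (\<lambda>d. p * d) D0" using p by (auto simp: inj_on_def)
  have "(\<Sum>d\<in>D. moebius_mu d) = (\<Sum>d\<in>D0. moebius_mu d) + (\<Sum>d\<in>D0. moebius_mu (p * d))"
  proof -
    have "finite D0" "D0 \<inter> (\<lambda>d. p * d) ` D0 = {}" using fin by (auto simp: D0_def)
    then show ?thesis unfolding D by (simp add: sum.union_disjoint sum.reindex[OF inj])
  qed
  also have "(\<Sum>d\<in>D0. moebius_mu (p * d)) = (\<Sum>d\<in>D0. - moebius_mu d)"
    using p assms by (intro sum.cong refl moebius_mu_prime_mult) (auto simp: D0_def D_def intro!: Nat.gr0I)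
  finally show ?thesis using 1 False by (simp add: sum_negf)
qed

lemma sum_divisors_ln_eq:
  "n > 0 \<Longrightarrow> (\<Sum>d | d dvd n. mangoldt d) = ln (real n)"
  using mangoldt_sum[of n, where ?'a = real] by simp

text \<open>The sum of \<open>moebius_mu d * mangoldt e\<close> over \<open>d * e\<close> dividing
  \<open>n\<close> is computed twice. Summing over \<open>e\<close> first produces
  \<open>ln (n / d)\<close>; summing over \<open>d\<close> first leaves only
  \<open>e = n\<close>.\<close>

lemma sum_moebius_mu_ln:
  assumes "n > 0"
  shows "(\<Sum>d | d dvd n. moebius_mu d * ln (real d)) = - mangoldt n"
proof -
  have fin: "finite {d. d dvd n}" using assms by simp
  have *: "(\<Sum>d | d dvd n. \<Sum>e | e dvd n div d. moebius_mu d * mangoldt e)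
      = (\<Sum>e | e dvd n. \<Sum>d | d dvd n div e. moebius_mu d * mangoldt e)"
  proof -
    have "(\<Sum>d | d dvd n. \<Sum>e | e dvd n div d. moebius_mu d * mangoldt e)
        = (\<Sum>(d,e)\<in>Sigma {d. d dvd n} (\<lambda>d. {e. e dvd n div d}). moebius_mu d * mangoldt e)"
      using assms by (intro sum.Sigma) (auto elim!: dvdE)
    also have "\<dots> = (\<Sum>(e,d)\<in>Sigma {e. e dvd n} (\<lambda>e. {d. d dvd n div e}). moebius_mu d * mangoldt e)"
      using assms by (intro sum.reindex_bij_witness[where i = "\<lambda>(d,e). (e,d)" and j = "\<lambda>(d,e). (e,d)"])
        (auto elim!: dvdE simp: mult_ac)
    also have "\<dots> = (\<Sum>e | e dvd n. \<Sum>d | d dvd n div e. moebius_mu d * mangoldt e)"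
      using assms by (intro sum.Sigma[symmetric]) (auto elim!: dvdE)
    finally show ?thesis .
  qed
  have "(\<Sum>d | d dvd n. \<Sum>e | e dvd n div d. moebius_mu d * mangoldt e)
      = (\<Sum>d | d dvd n. moebius_mu d * (ln (real n) - ln (real d)))"
  proof (intro sum.cong refl)
    fix d assume "d \<in> {d. d dvd n}"
    then obtain e where e: "n = d * e" by (auto elim: dvdE)
    with assms have "d > 0" "e > 0" by auto
    then show "(\<Sum>e | e dvd n div d. moebius_mu d * mangoldt e) = moebius_mu d * (ln (real n) - ln (real d))"
      using e by (simp add: sum_distrib_left[symmetric] sum_divisors_ln_eq ln_mult)
  qed
  also have "\<dots> = (\<Sum>d | d dvd n. moebius_mu d) * ln (real n) - (\<Sum>d | d dvd n. moebius_mu d * ln (real d))"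
    by (simp add: algebra_simps sum_subtractf sum_distrib_left)
  \<comment> \<open>For \<open>n = 1\<close> the logarithm vanishes, for larger \<open>n\<close> the
    Moebius sum does.\<close>
  also have "(\<Sum>d | d dvd n. moebius_mu d) * ln (real n) = 0"
    using assms by (simp add: sum_moebius_mu_divisors)
  finally have 1: "(\<Sum>d | d dvd n. \<Sum>e | e dvd n div d. moebius_mu d * mangoldt e) =
      - (\<Sum>d | d dvd n. moebius_mu d * ln (real d))" by simp
  have "(\<Sum>e | e dvd n. \<Sum>d | d dvd n div e. moebius_mu d * mangoldt e) = (\<Sum>e | e dvd n. if e = n then mangoldt e else 0)"
  proof (intro sum.cong refl)
    fix e assume "e \<in> {e. e dvd n}"
    then obtain d where e: "n = e * d" by (auto elim: dvdE)
    with assms have "d > 0" "e > 0" by auto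
    then show "(\<Sum>d | d dvd n div e. moebius_mu d * mangoldt e) = (if e = n then mangoldt e else 0)"
      using e by (simp add: sum_distrib_right[symmetric] sum_moebius_mu_divisors)
  qed
  also have "\<dots> = mangoldt n" using fin by (simp add: sum.delta)
  finally show ?thesis using * 1 by simp
qed

section \<open>The estimates of Chebyshev, Mertens and Selberg\<close>

definition psi :: "real \<Rightarrow> real" where "psi x = (\<Sum>n\<in>nats_le x. mangoldt n)"

text \<open>The logarithm of the factorial of the integer part of \<open>x\<close>. Its expansions
  in \<open>psi\<close> and \<open>mangoldt\<close> are the source of the estimates for
  primes.\<close>

definition ln_sum :: "real \<Rightarrow> real" where "ln_sum x = (\<Sum>n\<in>nats_le x. ln (real n))"

lemma psi_nonneg: "0 \<le> psi x"
  by (simp add: psi_def sum_nonneg mangoldt_nonneg)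

lemma psi_eq_0: "x < 2 \<Longrightarrow> psi x = 0"
  unfolding psi_def
proof (intro sum.neutral ballI)
  fix n assume "x < 2" "n \<in> nats_le x"
  then have "n = 1" by (auto simp: mem_nats_le)
  then show "mangoldt n = (0::real)" by simp
qed

lemma ln_sum_eq_psi: "ln_sum x = (\<Sum>d\<in>nats_le x. psi (x / real d))"
proof -
  have "ln_sum x = (\<Sum>k\<in>nats_le x. \<Sum>d | d dvd k. mangoldt d)"
    unfolding ln_sum_def by (intro sum.cong refl) (simp add: sum_divisors_ln_eq mem_nats_le)
  also have "\<dots> = (\<Sum>d\<in>nats_le x. \<Sum>m\<in>nats_le (x / real d). mangoldt d)"
    using sum_divisors_swap[of "\<lambda>d m. mangoldt d" x] .
  also have "\<dots> = (\<Sum>d\<in>nats_le x. psi (x / real d))"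
    unfolding psi_def using sum_nats_le_swap[of "\<lambda>d m. mangoldt d" x] .
  finally show ?thesis .
qed

lemma ln_sum_eq_mangoldt: "ln_sum x = (\<Sum>d\<in>nats_le x. mangoldt d * real (card (nats_le (x / real d))))"
proof -
  have "ln_sum x = (\<Sum>d\<in>nats_le x. \<Sum>m\<in>nats_le (x / real d). mangoldt d)"
    unfolding ln_sum_eq_psi psi_def using sum_nats_le_swap[of "\<lambda>d m. mangoldt d" x, symmetric] .
  then show ?thesis by (simp add: mult.commute)
qed

text \<open>In the induction step both bounds reduce to
  \<open>1 / (n + 1) \<le> ln (1 + 1 / n) \<le> 1 / n\<close>.\<close>

lemma ln_fact_bounds:
  assumes "n \<ge> 1"
  shows "real n * ln n - n + 1 \<le> (\<Sum>k=1..n. ln (real k))"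
    and "(\<Sum>k=1..n. ln (real k)) \<le> real n * ln n - n + 1 + ln n"
  using assms
proof (induction n rule: nat_induct_at_least)
  case (Suc n)
  have n: "real n \<ge> 1" using Suc.hyps by simp
  have "ln (1 + 1 / real n) \<le> 1 / real n" using n by (intro ln_add_one_self_le_self) auto
  moreover have eq: "ln (1 + 1 / real n) = ln (real n + 1) - ln (real n)"
    using n by (subst ln_divide_pos[symmetric]) (auto simp: field_simps)
  ultimately have "ln (real n + 1) - ln (real n) \<le> 1 / real n" by simp
  then have 1: "real n * (ln (real n + 1) - ln (real n)) \<le> 1"
    using n by (simp add: pos_le_divide_eq mult.commute)
  have "ln (1 - 1 / (real n + 1)) \<le> - 1 / (real n + 1)"
    using ln_le_minus_one[of "1 - 1 / (real n + 1)"] n by (simp add: field_simps)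
  moreover have "ln (1 - 1 / (real n + 1)) = ln (real n) - ln (real n + 1)"
    using n by (subst ln_divide_pos[symmetric]) (auto simp: field_simps)
  ultimately have "1 / (real n + 1) \<le> ln (real n + 1) - ln (real n)" by linarith
  then have 2: "(real n + 1) * (ln (real n + 1) - ln (real n)) \<ge> 1"
    using n by (simp add: pos_divide_le_eq mult.commute)
  {
    case 1
    then show ?case using Suc.IH(1) 1 \<open>real n * (ln (real n + 1) - ln (real n)) \<le> 1\<close>
      by (simp add: algebra_simps)
  next
    case 2
    then show ?case using Suc.IH(2) \<open>(real n + 1) * (ln (real n + 1) - ln (real n)) \<ge> 1\<close>
      by (simp add: algebra_simps)
  }
qed auto

text \<open>Rounding \<open>x\<close> down to an integer changes \<open>x * ln x - x\<close>, whose
  derivative is \<open>ln x\<close>, by at most \<open>ln x\<close>.\<close>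

lemma ln_sum_bounds:
  assumes "x \<ge> 1"
  shows "\<bar>ln_sum x - (x * ln x - x)\<bar> \<le> 2 + ln x"
proof -
  define n where "n = nat \<lfloor>x\<rfloor>"
  have n: "n \<ge> 1" "real n \<le> x" "x < real n + 1"
    using assms by (auto simp: n_def le_nat_floor)
  have T: "ln_sum x = (\<Sum>k=1..n. ln (real k))" by (simp add: ln_sum_def nats_le_altdef n_def)
  have mono: "real n * ln n - n \<le> x * ln x - x"
  proof -
    have "ln (real n / x) \<le> real n / x - 1" using n by (intro ln_le_minus_one) auto
    then have "x * (ln (real n) - ln x) \<le> real n - x"
      using n by (simp add: ln_divide_pos field_simps)
    moreover have "real n * ln n \<le> x * ln n" using n by (intro mult_right_mono) auto
    ultimately show ?thesis by (simp add: algebra_simps)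
  qed
  have up: "x * ln x - x \<le> real n * ln n - n + ln x"
  proof -
    have "ln (x / real n) \<le> x / real n - 1" using n by (intro ln_le_minus_one) auto
    then have "real n * (ln x - ln (real n)) \<le> x - real n"
      using n by (simp add: ln_divide_pos field_simps)
    moreover have "(x - real n) * ln x \<le> 1 * ln x" using n by (intro mult_right_mono) auto
    ultimately show ?thesis by (simp add: algebra_simps)
  qed
  have "ln (real n) \<le> ln x" "ln x \<ge> 0" using n by auto
  then show ?thesis using ln_fact_bounds[OF n(1)] mono up unfolding T by linarith
qed

text \<open>Chebyshev's device: in \<open>ln_sum x - 2 * ln_sum (x/2)\<close> the weight of
  \<open>mangoldt d\<close> is the integer part of \<open>x / d\<close> minus twice that of
  \<open>x / 2 / d\<close>. It is never negative and equals 1 for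
  \<open>x / 2 < d \<le> x\<close>.\<close>

lemma psi_diff_half:
  assumes "x \<ge> 2"
  shows "psi x - psi (x / 2) \<le> 7 * x"
proof -
  let ?c = "\<lambda>y. real (card (nats_le y))"
  have half: "ln_sum (x/2) = (\<Sum>d\<in>nats_le x. mangoldt d * ?c (x / 2 / real d))"
    unfolding ln_sum_eq_mangoldt
  proof (rule sum.mono_neutral_left)
    show "\<forall>d\<in>nats_le x - nats_le (x / 2). mangoldt d * ?c (x / 2 / real d) = 0"
    proof
      fix d assume d: "d \<in> nats_le x - nats_le (x / 2)"
      then have "x / 2 / real d < 1" by (auto simp: mem_nats_le field_simps)
      then show "mangoldt d * ?c (x / 2 / real d) = 0" by (simp add: nats_le_less_1)
    qed
  qed (use assms in \<open>auto simp: mem_nats_le\<close>)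
  have "psi x - psi (x / 2) = (\<Sum>d\<in>nats_le x - nats_le (x/2). mangoldt d)"
    unfolding psi_def using assms by (subst sum_diff) (auto simp: mem_nats_le)
  also have "\<dots> \<le> (\<Sum>d\<in>nats_le x - nats_le (x/2). mangoldt d * (?c (x / real d) - 2 * ?c (x / 2 / real d)))"
  proof (rule sum_mono)
    fix d assume d: "d \<in> nats_le x - nats_le (x / 2)"
    then have "x / 2 / real d < 1" "x / real d \<ge> 1" by (auto simp: mem_nats_le field_simps)
    then have "?c (x / real d) - 2 * ?c (x / 2 / real d) \<ge> 1"
      by (simp add: nats_le_less_1 card_nats_le le_nat_floor)
    then show "mangoldt d \<le> mangoldt d * (?c (x / real d) - 2 * ?c (x / 2 / real d))"
      using mult_left_mono[OF _ mangoldt_nonneg] by fastforce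
  qed
  also have "\<dots> \<le> (\<Sum>d\<in>nats_le x. mangoldt d * (?c (x / real d) - 2 * ?c (x / 2 / real d)))"
  proof (rule sum_mono2)
    fix d assume "d \<in> nats_le x - (nats_le x - nats_le (x/2))"
    define y where "y = x / 2 / real d"
    have "y \<ge> 0" using assms by (simp add: y_def)
    moreover have "2 * \<lfloor>y\<rfloor> \<le> \<lfloor>2 * y\<rfloor>" by linarith
    ultimately have "2 * ?c y \<le> ?c (2 * y)" by (simp add: card_nats_le)
    then show "0 \<le> mangoldt d * (?c (x / real d) - 2 * ?c (x / 2 / real d))"
      by (intro mult_nonneg_nonneg mangoldt_nonneg) (simp add: y_def)
  qed auto
  also have "\<dots> = ln_sum x - 2 * ln_sum (x/2)"
    unfolding half unfolding ln_sum_eq_mangoldt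
    by (simp add: sum_subtractf sum_distrib_left algebra_simps)
  finally have 1: "psi x - psi (x / 2) \<le> ln_sum x - 2 * ln_sum (x/2)" .
  have ln2: "ln (x/2) = ln x - ln 2" using assms by (simp add: ln_divide_pos)
  have "x / 2 * ln (x / 2) = (x * ln x - x * ln 2) / 2"
    by (simp add: ln2 algebra_simps diff_divide_distrib)
  moreover have "0 \<le> ln (2::real)" by simp
  ultimately have "ln_sum (x/2) \<ge> (x * ln x - x * ln 2) / 2 - x / 2 - 2 - ln x"
    using ln_sum_bounds[of "x/2"] ln2 assms by linarith
  then have "2 * ln_sum (x/2) \<ge> x * ln x - x * ln 2 - x - 4 - 2 * ln x"
    by (simp add: field_simps)
  moreover have "ln_sum x - (x * ln x - x) \<le> 2 + ln x"
    using ln_sum_bounds[of x] assms by simp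
  ultimately have "ln_sum x - 2 * ln_sum (x/2) \<le> x * ln 2 + 6 + 3 * ln x"
    by linarith
  moreover have "ln (2::real) \<le> 1" using ln_le_minus_one[of 2] by simp
  moreover have "ln x \<le> x - 1" using assms by (intro ln_le_minus_one) auto
  moreover have "x * ln 2 \<le> x * 1" using assms \<open>ln 2 \<le> 1\<close> by (intro mult_left_mono) auto
  ultimately show ?thesis using 1 assms by linarith
qed

text \<open>Repeated halving sums a geometric series with first term \<open>7 * x\<close>; the
  induction is on the number of halvings that bring \<open>x\<close> below 1.\<close>

lemma psi_le:
  assumes "x \<ge> 0"
  shows "psi x \<le> 14 * x"
proof -
  have "psi x \<le> 14 * x" if "0 \<le> x" "x < 2 ^ n" for n x
    using that
  proof (induction n arbitrary: x)
    case 0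
    then show ?case by (simp add: psi_eq_0)
  next
    case (Suc n)
    show ?case
    proof (cases "x < 2")
      case True
      then show ?thesis using Suc.prems by (simp add: psi_eq_0)
    next
      case False
      have "psi (x/2) \<le> 14 * (x/2)" using Suc.prems by (intro Suc.IH) auto
      then show ?thesis using psi_diff_half[of x] False by simp
    qed
  qed
  moreover obtain n where "x < 2 ^ n" using real_arch_pow[of 2 x] by auto
  ultimately show ?thesis using assms by blast
qed

section \<open>Mertens's estimate and the harmonic sum\<close>

definition mertens_sum :: "real \<Rightarrow> real" where "mertens_sum x = (\<Sum>n\<in>nats_le x. mangoldt n / real n)"

text \<open>Dropping the integer parts in \<open>ln_sum_eq_mangoldt\<close> replaces
  \<open>ln_sum x\<close> by \<open>x * mertens_sum x\<close>. The error is at most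
  \<open>psi x\<close>, which is linear in \<open>x\<close> and hence bounded after division by
  \<open>x\<close>.\<close>

lemma mertens_sum_bounds:
  assumes "x \<ge> 1"
  shows "\<bar>mertens_sum x - ln x\<bar> \<le> 16"
proof -
  let ?c = "\<lambda>y. real (card (nats_le y))"
  have eq: "x * mertens_sum x - ln_sum x = (\<Sum>d\<in>nats_le x. mangoldt d * (x / real d - ?c (x / real d)))"
    unfolding mertens_sum_def ln_sum_eq_mangoldt
    by (simp add: sum_distrib_left sum_subtractf[symmetric] algebra_simps)
  have c: "x / real d - ?c (x / real d) \<in> {0..1}" for d
    using card_nats_le_bounds[of "x / real d"] assms by auto
  have "0 \<le> x * mertens_sum x - ln_sum x" unfolding eq
    using c by (intro sum_nonneg mult_nonneg_nonneg mangoldt_nonneg) auto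
  moreover have "x * mertens_sum x - ln_sum x \<le> psi x" unfolding eq psi_def
    using c mult_left_mono[OF _ mangoldt_nonneg, of _ 1] by (intro sum_mono) fastforce
  moreover have "psi x \<le> 14 * x" using assms by (intro psi_le) auto
  moreover have "ln x \<le> x - 1" "ln x \<ge> 0" using assms by (auto intro!: ln_le_minus_one)
  ultimately have "\<bar>x * mertens_sum x - x * ln x\<bar> \<le> 16 * x"
    using ln_sum_bounds[OF assms] assms by linarith
  then have "x * \<bar>mertens_sum x - ln x\<bar> \<le> x * 16"
    using assms by (simp add: abs_mult right_diff_distrib[symmetric] abs_of_nonneg)
  then show ?thesis using assms by simp
qed

lemma harm_bounds:
  assumes "x \<ge> 1"
  shows "\<bar>(\<Sum>n\<in>nats_le x. 1 / real n) - ln x - euler_mascheroni\<bar> \<le> 3 / x"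
proof -
  define N where "N = nat \<lfloor>x\<rfloor>"
  have N: "N \<ge> 1" "real N \<le> x" "x < real N + 1"
    using assms by (auto simp: N_def le_nat_floor)
  have S: "(\<Sum>n\<in>nats_le x. 1 / real n) = harm N"
    by (simp add: harm_def nats_le_altdef N_def inverse_eq_divide)
  obtain n where n: "N = Suc n" using N by (cases N) auto
  define e where "e = (euler_mascheroni :: real)"
  have "e \<ge> harm N - ln (real N + 1) + 1 / (2 * (real N + 1))"
    using euler_mascheroni_lower[of n] by (simp add: n e_def algebra_simps)
  moreover have "e \<le> harm N - ln (real N + 1) + 1 / (2 * real N)"
    using euler_mascheroni_upper[of n] by (simp add: n e_def algebra_simps)
  moreover have "ln (real N + 1) - ln x \<le> 1 / real N"
  proof -
    have "ln (real N + 1) - ln x \<le> ln (real N + 1) - ln (real N)" using N by simp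
    also have "\<dots> = ln (1 + 1 / real N)"
      using N by (subst ln_divide_pos[symmetric]) (auto simp: field_simps)
    also have "\<dots> \<le> 1 / real N" using N by (intro ln_add_one_self_le_self) auto
    finally show ?thesis .
  qed
  moreover have "ln (real N + 1) - ln x \<ge> 0" using N by simp
  moreover have "1 / (2 * (real N + 1)) \<ge> 0" by simp
  moreover have "1 / (2 * real N) = 1 / real N / 2" by simp
  ultimately have "\<bar>harm N - ln x - e\<bar> \<le> 3 / 2 * (1 / real N)" by linarith
  also have "\<dots> \<le> 3 / 2 * (2 / x)" using N by (intro mult_left_mono) (auto simp: field_simps)
  finally show ?thesis by (simp add: S e_def)
qed

text \<open>Collect the terms with \<open>d * m = k\<close>. The weight
  \<open>ln (x / d) = ln x - ln d\<close> gives \<open>F (x / k)\<close> the coefficient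
  \<open>ln x\<close> for \<open>k = 1\<close> only and, by \<open>sum_moebius_mu_ln\<close>, the
  further coefficient \<open>mangoldt k\<close> for all \<open>k\<close>.\<close>

lemma tatuzawa_iseki:
  assumes "x \<ge> 1"
  shows "(\<Sum>d\<in>nats_le x. moebius_mu d * (ln (x / real d) * (\<Sum>m\<in>nats_le (x / real d). F (x / real d / real m))))
    = F x * ln x + (\<Sum>k\<in>nats_le x. F (x / real k) * mangoldt k)"
proof -
  let ?f = "\<lambda>d m. moebius_mu d * ln (x / real d) * F (x / (real d * real m))"
  have "(\<Sum>d\<in>nats_le x. moebius_mu d * (ln (x / real d) * (\<Sum>m\<in>nats_le (x / real d). F (x / real d / real m))))
      = (\<Sum>d\<in>nats_le x. \<Sum>m\<in>nats_le (x / real d). ?f d m)"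
    by (simp add: sum_distrib_left mult.assoc)
  also have "\<dots> = (\<Sum>k\<in>nats_le x. \<Sum>d | d dvd k. ?f d (k div d))"
    by (rule sum_divisors_swap[symmetric])
  also have "\<dots> = (\<Sum>k\<in>nats_le x. F (x / real k) * ((if k = 1 then ln x else 0) + mangoldt k))"
  proof (intro sum.cong refl)
    fix k assume k: "k \<in> nats_le x"
    then have k0: "k > 0" by (simp add: mem_nats_le)
    have "(\<Sum>d | d dvd k. ?f d (k div d)) = (\<Sum>d | d dvd k. F (x / real k) * (moebius_mu d * ln x - moebius_mu d * ln (real d)))"
    proof (intro sum.cong refl)
      fix d assume "d \<in> {d. d dvd k}"
      then obtain e where e: "k = d * e" by (auto elim: dvdE)
      with k0 have "d > 0" "e > 0" by auto
      then show "?f d (k div d) = F (x / real k) * (moebius_mu d * ln x - moebius_mu d * ln (real d))"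
        using e assms by (simp add: ln_divide_pos algebra_simps)
    qed
    also have "\<dots> = F (x / real k) * ((\<Sum>d | d dvd k. moebius_mu d) * ln x - (\<Sum>d | d dvd k. moebius_mu d * ln (real d)))"
      by (simp add: sum_distrib_left sum_distrib_right sum_subtractf right_diff_distrib)
    also have "\<dots> = F (x / real k) * ((if k = 1 then ln x else 0) + mangoldt k)"
      using k0 by (simp add: sum_moebius_mu_divisors sum_moebius_mu_ln)
    finally show "(\<Sum>d | d dvd k. ?f d (k div d)) = F (x / real k) * ((if k = 1 then ln x else 0) + mangoldt k)" .
  qed
  also have "\<dots> = (\<Sum>k\<in>nats_le x. if k = 1 then F x * ln x else 0) + (\<Sum>k\<in>nats_le x. F (x / real k) * mangoldt k)"
    unfolding sum.distrib[symmetric] by (intro sum.cong refl) (auto simp: algebra_simps)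
  also have "(\<Sum>k\<in>nats_le x. if k = 1 then F x * ln x else 0) = F x * ln x"
    using assms by (simp add: mem_nats_le)
  finally show ?thesis .
qed

text \<open>Telescoping with \<open>1 / sqrt d \<le> 2 * (sqrt d - sqrt (d - 1))\<close>.\<close>

lemma sum_inverse_sqrt_le:
  assumes "x \<ge> 0"
  shows "(\<Sum>d\<in>nats_le x. 1 / sqrt (real d)) \<le> 2 * sqrt x"
proof -
  have *: "(\<Sum>d=1..n. 1 / sqrt (real d)) \<le> 2 * sqrt (real n)" for n
  proof (induction n)
    case (Suc n)
    define a b where "a = sqrt (real n)" and "b = sqrt (real (Suc n))"
    have b: "b > 0" "a \<ge> 0" by (auto simp: a_def b_def)
    have "b * b = a * a + 1" by (simp add: a_def b_def)
    moreover have "0 \<le> (b - a) * (b - a)" by simp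
    ultimately have "1 \<le> 2 * b * (b - a)" by (simp add: algebra_simps)
    then have "1 / b \<le> 2 * (b - a)" using b by (simp add: field_simps)
    then show ?case using Suc.IH by (simp add: a_def b_def)
  qed simp
  have "(\<Sum>d\<in>nats_le x. 1 / sqrt (real d)) \<le> 2 * sqrt (real (nat \<lfloor>x\<rfloor>))"
    unfolding nats_le_altdef by (rule *)
  also have "\<dots> \<le> 2 * sqrt x" using assms by simp
  finally show ?thesis .
qed

text \<open>The left side bounds one term of the Moebius sum in Selberg's formula, with
  \<open>y = x / d\<close>. A power of \<open>y\<close> with exponent below 1 is good enough, as its
  sum over \<open>d\<close> is linear in \<open>x\<close>.\<close>

lemma ln_times_le_sqrt:
  assumes "(y::real) \<ge> 1"
  shows "ln y * (7 + ln y) \<le> 44 * sqrt y"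
proof -
  define s where "s = sqrt (sqrt y)"
  have s: "s \<ge> 1" "s * s = sqrt y" "s * s * (s * s) = y"
    using assms by (auto simp: s_def)
  have "ln y = ln (s ^ 4)" by (simp only: s(3)[symmetric] power4_eq_xxxx mult.assoc)
  also have "\<dots> = 4 * ln s" using s(1) by (simp add: ln_realpow)
  finally have "ln y = 4 * ln s" .
  moreover have "ln s \<le> s - 1" using s by (intro ln_le_minus_one) auto
  ultimately have l: "ln y \<le> 4 * s" by simp
  have "ln y * (7 + ln y) \<le> (4 * s) * (7 + 4 * s)"
    using l s assms by (intro mult_mono) auto
  also have "\<dots> = 28 * s + 16 * (s * s)" by (simp add: algebra_simps)
  also have "\<dots> \<le> 28 * (s * s) + 16 * (s * s)" using mult_left_mono[of 1 s s] s(1) by simp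
  finally show ?thesis using s by simp
qed

text \<open>The sum of \<open>mangoldt k * mangoldt m\<close> over \<open>k * m \<le> x\<close>,
  which counts products of two primes with logarithmic weights.\<close>

definition selberg_sum :: "real \<Rightarrow> real" where
  "selberg_sum x = (\<Sum>k\<in>nats_le x. psi (x / real k) * mangoldt k)"

text \<open>The identity \<open>tatuzawa_iseki\<close> is applied to an error term of
  \<open>psi\<close> whose sums over \<open>y / m\<close> are merely logarithmic, so its left side
  is linear in \<open>x\<close>. On the right, Mertens's estimate completes the main term
  \<open>2 * x * ln x\<close>. The constant is 88 + 16 + 28 + 2.\<close>

lemma selberg_formula:
  assumes "x \<ge> 1"
  shows "\<bar>psi x * ln x + selberg_sum x - 2 * x * ln x\<bar> \<le> 134 * x"
proof -
  define g where "g = (euler_mascheroni :: real)"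
  have g: "0 < g" "g \<le> 1" using euler_mascheroni_pos euler_mascheroni_less_13_over_22 by (auto simp: g_def)
  \<comment> \<open>chosen so that the main terms of the sum of \<open>F (y / m)\<close> over \<open>m \<le> y\<close> cancel\<close>
  define F where "F = (\<lambda>y. psi y - y + g + 1)"
  have S: "\<bar>\<Sum>m\<in>nats_le y. F (y / real m)\<bar> \<le> 7 + ln y" if y: "y \<ge> 1" for y
  proof -
    define c where "c = real (card (nats_le y))"
    define H where "H = (\<Sum>n\<in>nats_le y. 1 / real n)"
    have "(\<Sum>m\<in>nats_le y. F (y / real m)) = ln_sum y - y * H + (g + 1) * c"
      unfolding ln_sum_eq_psi c_def F_def H_def
      by (simp add: sum.distrib sum_subtractf sum_distrib_left algebra_simps)
    moreover have "\<bar>ln_sum y - (y * ln y - y)\<bar> \<le> 2 + ln y" using y by (rule ln_sum_bounds)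
    moreover have "\<bar>y * H - y * ln y - y * g\<bar> \<le> 3"
    proof -
      have "y * \<bar>H - ln y - g\<bar> \<le> y * (3 / y)"
        using harm_bounds[OF y] y unfolding H_def g_def by (intro mult_left_mono) auto
      then have "\<bar>y * (H - ln y - g)\<bar> \<le> 3" using y by (simp add: abs_mult)
      then show ?thesis by (simp add: algebra_simps)
    qed
    moreover have "\<bar>(g + 1) * c - (g + 1) * y\<bar> \<le> 2"
    proof -
      have "\<bar>c - y\<bar> \<le> 1" using card_nats_le_bounds[of y] y by (auto simp: c_def)
      then have "(g + 1) * \<bar>c - y\<bar> \<le> 2 * 1" using g by (intro mult_mono) auto
      then show ?thesis using g by (simp add: abs_mult right_diff_distrib[symmetric])
    qed
    ultimately show ?thesis by (simp add: algebra_simps)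
  qed
  have "\<bar>F x * ln x + (\<Sum>k\<in>nats_le x. F (x / real k) * mangoldt k)\<bar> \<le> 88 * x"
  proof -
    have "\<bar>F x * ln x + (\<Sum>k\<in>nats_le x. F (x / real k) * mangoldt k)\<bar>
        \<le> (\<Sum>d\<in>nats_le x. \<bar>moebius_mu d * (ln (x / real d) * (\<Sum>m\<in>nats_le (x / real d). F (x / real d / real m)))\<bar>)"
      unfolding tatuzawa_iseki[OF assms, symmetric] by (rule sum_abs)
    also have "\<dots> \<le> (\<Sum>d\<in>nats_le x. 44 * sqrt x * (1 / sqrt (real d)))"
    proof (rule sum_mono)
      fix d assume d: "d \<in> nats_le x"
      define y where "y = x / real d"
      have y: "y \<ge> 1" using d by (auto simp: y_def mem_nats_le field_simps)
      have "\<bar>moebius_mu d * (ln y * (\<Sum>m\<in>nats_le y. F (y / real m)))\<bar> \<le> 1 * (ln y * (7 + ln y))"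
        unfolding abs_mult using y S[OF y] abs_moebius_mu_le_1[of d]
        by (intro mult_mono) auto
      also have "\<dots> \<le> 44 * sqrt y" using ln_times_le_sqrt[OF y] by simp
      finally show "\<bar>moebius_mu d * (ln (x / real d) * (\<Sum>m\<in>nats_le (x / real d). F (x / real d / real m)))\<bar>
          \<le> 44 * sqrt x * (1 / sqrt (real d))" by (simp add: y_def real_sqrt_divide)
    qed
    also have "\<dots> \<le> 44 * sqrt x * (2 * sqrt x)"
      unfolding sum_distrib_left[symmetric] using assms by (intro mult_left_mono sum_inverse_sqrt_le) auto
    also have "\<dots> = 88 * x" using assms by simp
    finally show ?thesis .
  qed
  moreover have "(\<Sum>k\<in>nats_le x. F (x / real k) * mangoldt k)
      = selberg_sum x - x * mertens_sum x + (g + 1) * psi x"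
    unfolding F_def selberg_sum_def mertens_sum_def psi_def[of x]
    by (simp add: sum.distrib sum_subtractf sum_distrib_left algebra_simps)
  moreover have "\<bar>x * mertens_sum x - x * ln x\<bar> \<le> 16 * x"
  proof -
    have "x * \<bar>mertens_sum x - ln x\<bar> \<le> x * 16"
      using mertens_sum_bounds[OF assms] assms by (intro mult_left_mono) auto
    then show ?thesis using assms by (simp add: abs_mult right_diff_distrib[symmetric])
  qed
  moreover have "0 \<le> (g + 1) * psi x" using g psi_nonneg by simp
  moreover have "(g + 1) * psi x \<le> 2 * (14 * x)"
    using g psi_nonneg assms by (intro mult_mono psi_le) auto
  moreover have "0 \<le> (g + 1) * ln x" using g assms by simp
  moreover have "(g + 1) * ln x \<le> 2 * x"
    using g assms ln_le_minus_one[of x] by (intro mult_mono) auto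
  ultimately show ?thesis by (simp add: F_def algebra_simps)
qed

text \<open>For each prime the powers from the square on form a geometric series bounded by a
  multiple of \<open>p powr (-3/2)\<close>. Hence proper prime powers are negligible in far short
  intervals.\<close>

lemma sum_proper_prime_powers_bounded:
  obtains t where "t \<ge> 0" "\<And>A. finite A \<Longrightarrow> (\<Sum>n\<in>A. (if prime n then 0 else mangoldt n / real n)) \<le> t"
proof -
  define f where "f = (\<lambda>n::nat. if prime n then 0 else mangoldt n / real n)"
  define t where "t = (\<Sum>n. 4 * real n powr (-3/2))"
  have sm: "summable (\<lambda>n. 4 * real n powr (-3/2))" by (intro summable_mult) (simp add: summable_real_powr_iff)
  have geo: "(\<Sum>a=2..N. ln (real p) / real (p ^ a)) \<le> 4 * real p powr (-3/2)" if p: "p \<ge> 2" for p N :: nat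
  proof -
    define r where "r = 1 / real p"
    have r: "0 < r" "r \<le> 1 / 2" using p by (auto simp: r_def field_simps)
    have "(\<Sum>a=2..N. r ^ a) \<le> (\<Sum>a\<in>{2..<Suc (Suc (Suc N))}. r ^ a)"
      using r by (intro sum_mono2) auto
    also have "\<dots> = (\<Sum>a<Suc N. r ^ (a + 2))"
      by (subst sum.atLeastLessThan_shift_0) (simp add: atLeast0LessThan add.commute)
    also have "\<dots> = r\<^sup>2 * (\<Sum>a<Suc N. r ^ a)"
      unfolding sum_distrib_left by (simp add: power_add power2_eq_square mult_ac)
    also have "(\<Sum>a<Suc N. r ^ a) = (1 - r ^ Suc N) / (1 - r)" using r by (subst sum_gp_strict) auto
    also have "r\<^sup>2 * \<dots> \<le> r\<^sup>2 * (1 / (1 / 2))"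
      using r by (intro mult_left_mono frac_le) auto
    finally have 1: "(\<Sum>a=2..N. r ^ a) \<le> 2 * r\<^sup>2" by simp
    have "ln (sqrt (real p)) \<le> sqrt (real p) - 1" using p by (intro ln_le_minus_one) auto
    then have l: "ln (real p) \<le> 2 * sqrt (real p)" using p by (simp add: ln_sqrt)
    have "(\<Sum>a=2..N. ln (real p) / real (p ^ a)) = ln (real p) * (\<Sum>a=2..N. r ^ a)"
      by (simp add: sum_distrib_left r_def power_divide)
    also have "\<dots> \<le> (2 * sqrt (real p)) * (2 * r\<^sup>2)"
      using 1 l p r by (intro mult_mono) (auto intro!: sum_nonneg)
    also have "\<dots> = 4 * real p powr (-3/2)"
    proof -
      have "real p powr (-3/2) = real p powr (1/2 + - 2)" by simp
      also have "\<dots> = sqrt (real p) * r\<^sup>2"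
        using p by (subst powr_add) (simp add: powr_half_sqrt powr_minus powr_numeral r_def field_simps)
      finally show ?thesis by simp
    qed
    finally show ?thesis .
  qed
  have "(\<Sum>n\<in>A. f n) \<le> t" if A: "finite A" for A
  proof -
    define B where "B = {n\<in>A. primepow n \<and> \<not> prime n}"
    have "\<forall>n\<in>B. \<exists>p a. prime p \<and> a \<ge> 2 \<and> n = p ^ a"
    proof
      fix n assume n: "n \<in> B"
      then have pp: "primepow n" "\<not> prime n" by (auto simp: B_def)
      then obtain p k where pk: "prime p" "k > 0" "n = p ^ k"
        by (auto simp: primepow_def)
      with pp have "k \<noteq> 1" by auto
      with pk show "\<exists>p a. prime p \<and> a \<ge> 2 \<and> n = p ^ a" by (intro exI[of _ p] exI[of _ k]) auto
    qed
    then obtain P a where Pa: "\<And>n. n \<in> B \<Longrightarrow> prime (P n) \<and> a n \<ge> (2::nat) \<and> n = P n ^ a n"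
      by metis
    obtain N where N: "\<And>n. n \<in> B \<Longrightarrow> P n \<le> N \<and> a n \<le> N"
    proof -
      have "finite B" using A by (simp add: B_def)
      then have "finite (P ` B \<union> a ` B)" by simp
      then obtain N where "\<forall>k\<in>P ` B \<union> a ` B. k \<le> N" using finite_nat_set_iff_bounded_le by blast
      then show ?thesis using that by blast
    qed
    have "(\<Sum>n\<in>A. f n) = (\<Sum>n\<in>B. f n)"
      using A by (intro sum.mono_neutral_right) (auto simp: B_def f_def mangoldt_def)
    also have "\<dots> = (\<Sum>n\<in>B. (\<lambda>(p,a). ln (real p) / real (p ^ a)) (P n, a n))"
    proof (intro sum.cong refl)
      fix n assume n: "n \<in> B"
      then have "mangoldt n = ln (real (P n))" using Pa[OF n] mangoldt_primepow'[of "P n" "a n", where ?'a = real] by auto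
      then show "f n = (\<lambda>(p,a). ln (real p) / real (p ^ a)) (P n, a n)"
        using n Pa[OF n] by (simp add: f_def B_def)
    qed
    also have "\<dots> = (\<Sum>(p,a)\<in>(\<lambda>n. (P n, a n)) ` B. ln (real p) / real (p ^ a))"
      by (rule sum.reindex_cong[symmetric, OF _ refl refl]) (auto simp: inj_on_def, metis Pa)
    also have "\<dots> \<le> (\<Sum>(p,a)\<in>{2..N} \<times> {2..N}. ln (real p) / real (p ^ a))"
    proof (rule sum_mono2)
      have "2 \<le> P n" if "n \<in> B" for n using Pa[OF that] prime_ge_2_nat by blast
      then show "(\<lambda>n. (P n, a n)) ` B \<subseteq> {2..N} \<times> {2..N}" using Pa N by auto
    qed auto
    also have "\<dots> = (\<Sum>p=2..N. \<Sum>a=2..N. ln (real p) / real (p ^ a))"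
      by (simp add: sum.cartesian_product)
    also have "\<dots> \<le> (\<Sum>p=2..N. 4 * real p powr (-3/2))"
      by (intro sum_mono geo) auto
    also have "\<dots> \<le> t" unfolding t_def using sm by (intro sum_le_suminf) auto
    finally show ?thesis .
  qed
  moreover have "t \<ge> 0" unfolding t_def using sm by (intro suminf_nonneg) auto
  ultimately show ?thesis using that unfolding f_def by blast
qed

section \<open>Primes and products of two primes in short intervals\<close>

text \<open>Logarithms are the natural scale: the arguments \<open>x / d\<close> of the averages
  become shifts, and a short interval is one of fixed length in \<open>ln\<close>.\<close>

definition log_primes :: "real \<Rightarrow> real \<Rightarrow> nat set" where
  "log_primes a b = {p. prime p \<and> a < ln (real p) \<and> ln (real p) \<le> b}"

definition log_almost_primes :: "real \<Rightarrow> real \<Rightarrow> nat set" where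
  "log_almost_primes a b = log_primes a b \<union> {p * q | p q. p \<in> log_primes a b \<and> q \<in> log_primes a b}"

lemma ln_le_iff_le_exp: "n > 0 \<Longrightarrow> ln (real n) \<le> b \<longleftrightarrow> real n \<le> exp b"
  by (metis exp_le_cancel_iff exp_ln of_nat_0_less_iff)

lemma less_ln_iff_exp_less: "n > 0 \<Longrightarrow> b < ln (real n) \<longleftrightarrow> exp b < real n"
  by (metis exp_less_cancel_iff exp_ln of_nat_0_less_iff)

lemma finite_log_primes [simp, intro]: "finite (log_primes a b)"
proof (rule finite_subset)
  show "log_primes a b \<subseteq> nats_le (exp b)"
    by (auto simp: log_primes_def mem_nats_le ln_le_iff_le_exp prime_gt_0_nat)
qed simp

lemma finite_log_almost_primes [simp, intro]: "finite (log_almost_primes a b)"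
proof -
  have "{p * q | p q. p \<in> log_primes a b \<and> q \<in> log_primes a b}
      = (\<lambda>(p,q). p * q) ` (log_primes a b \<times> log_primes a b)" by auto
  then show ?thesis by (simp add: log_almost_primes_def)
qed

lemma log_almost_primes_pos: "n \<in> log_almost_primes a b \<Longrightarrow> 0 < n"
  by (auto simp: log_almost_primes_def log_primes_def prime_gt_0_nat)

lemma prime_pair_product_unique:
  fixes p q :: nat
  assumes "prime p" "prime q" "prime r" "prime s" "p * q = r * s"
  shows "(p = r \<and> q = s) \<or> (p = s \<and> q = r)"
proof -
  have "p dvd r * s" using assms(5) by (metis dvd_triv_left)
  then have "p = r \<or> p = s" using assms by (simp add: prime_dvd_mult_iff primes_dvd_imp_eq)
      (metis primes_dvd_imp_eq)
  moreover have "p > 0" using assms by (simp add: prime_gt_0_nat)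
  ultimately show ?thesis using assms(5) by auto
qed

text \<open>A product of two primes determines them up to order, so multiplication is injective on
  the pairs with \<open>p \<le> q\<close> and on those with \<open>q \<le> p\<close>.\<close>

lemma card_prime_pairs_le:
  assumes "finite A" "\<And>p q. (p, q) \<in> A \<Longrightarrow> prime p \<and> prime q"
  shows "card A \<le> 2 * card ((\<lambda>(p, q). p * q :: nat) ` A)"
proof -
  have le: "card B \<le> card ((\<lambda>(p, q). p * q) ` A)"
    if B: "B \<subseteq> A" "\<And>p q. (p, q) \<in> B \<Longrightarrow> (q, p) \<in> B \<Longrightarrow> p = q" for B
  proof -
    have "inj_on (\<lambda>(p, q). p * q) B"
    proof (rule inj_onI, clarify)
      fix p q r s assume *: "(p, q) \<in> B" "(r, s) \<in> B" "p * q = r * s"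
      then have "prime p" "prime q" "prime r" "prime s" using B(1) assms(2) by blast+
      from prime_pair_product_unique[OF this *(3)] show "p = r \<and> q = s" using B(2) * by auto
    qed
    then have "card B = card ((\<lambda>(p, q). p * q) ` B)" by (simp add: card_image)
    also have "\<dots> \<le> card ((\<lambda>(p, q). p * q) ` A)" using assms(1) B(1) by (intro card_mono) auto
    finally show ?thesis .
  qed
  define A1 A2 where "A1 = {(p,q)\<in>A. p \<le> q}" and "A2 = {(p,q)\<in>A. q \<le> p}"
  have "A = A1 \<union> A2" by (auto simp: A1_def A2_def)
  then have "card A \<le> card A1 + card A2" by (simp only: card_Un_le)
  moreover have "card A1 \<le> card ((\<lambda>(p, q). p * q) ` A)" by (rule le) (auto simp: A1_def)
  moreover have "card A2 \<le> card ((\<lambda>(p, q). p * q) ` A)" by (rule le) (auto simp: A2_def)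
  ultimately show ?thesis by linarith
qed

definition mult_region :: "real \<Rightarrow> (nat \<times> nat) set" where
  "mult_region x = Sigma (nats_le x) (\<lambda>k. nats_le (x / real k))"

lemma mem_mult_region: "(k, m) \<in> mult_region x \<longleftrightarrow> 0 < k \<and> 0 < m \<and> real k * real m \<le> x"
  by (auto simp: mult_region_def mem_nats_le field_simps intro: le_of_mult_le)

lemma selberg_sum_eq: "selberg_sum x = (\<Sum>(k,m)\<in>mult_region x. mangoldt k * mangoldt m)"
proof -
  have "selberg_sum x = (\<Sum>k\<in>nats_le x. \<Sum>m\<in>nats_le (x / real k). mangoldt k * mangoldt m)"
    by (simp add: selberg_sum_def psi_def sum_distrib_left mult.commute)
  also have "\<dots> = (\<Sum>(k,m)\<in>mult_region x. mangoldt k * mangoldt m)"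
    unfolding mult_region_def by (rule sum.Sigma) auto
  finally show ?thesis .
qed

text \<open>Selberg's formula at \<open>exp (v + h)\<close> minus that at \<open>x = exp v\<close>
  has a main term of at least \<open>2 * h * x * v\<close>, against errors of order
  \<open>x\<close>. Prime powers and products with a factor up to \<open>exp (\<theta> * V)\<close>
  use up only a fixed part of it, so the remaining primes and pairs of primes are numerous.\<close>

lemma almost_primes_in_short_intervals:
  assumes "0 < h" "h \<le> 1"
  obtains \<theta> c V0 where "0 < \<theta>" "\<theta> < 1" "0 < c" "1 \<le> V0"
    "\<And>V v. V0 \<le> V \<Longrightarrow> V \<le> v \<Longrightarrow> v \<le> 2 * V \<Longrightarrow>
      c / V \<le> (\<Sum>n\<in>{n\<in>log_almost_primes (\<theta> * V) (3 * V). v < ln (real n) \<and> ln (real n) \<le> v + h}. 1 / real n)"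
proof -
  define f where "f = (\<lambda>n::nat. if prime n then 0 else mangoldt n / real n)"
  obtain t where t: "t \<ge> 0" "\<And>A. finite A \<Longrightarrow> (\<Sum>n\<in>A. f n) \<le> t"
    unfolding f_def using sum_proper_prime_powers_bounded by metis
  have f_nonneg: "f n \<ge> 0" for n by (simp add: f_def mangoldt_nonneg)
  have "summable f" using t f_nonneg by (intro summableI_nonneg_bounded[of f t]) auto
  \<comment> \<open>The bound \<open>h / 12\<close> becomes \<open>h * x / 4\<close> in
    \<open>psi_cell\<close>, since the terms \<open>f n * n\<close> are at most
    \<open>f n * y\<close> with \<open>y \<le> 3 * x\<close>.\<close>
  then obtain n0 where n0: "\<And>m n. m \<ge> n0 \<Longrightarrow> norm (sum f {m..<n}) < h / 12"
    unfolding summable_Cauchy using assms(1) by (meson divide_pos_pos zero_less_numeral)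
  \<comment> \<open>Products with a small factor cost \<open>84 * x * \<theta> * V\<close>, and
    \<open>84 / 400 < 1 / 4\<close>. The next constant \<open>K\<close> collects the errors of order
    \<open>x\<close>, which the choice of \<open>V0\<close> keeps below
    \<open>h * x * v / 4\<close>.\<close>
  define \<theta> where "\<theta> = h / 400"
  define K where "K = 846 + 84 * (16 + t)"
  define V0 where "V0 = max (max 1 (real n0)) (4 * K / h)"
  have \<theta>: "0 < \<theta>" "\<theta> < 1" using assms by (auto simp: \<theta>_def)
  have K: "K > 0" using t by (auto simp: K_def)
  have V0: "V0 \<ge> 1" "V0 \<ge> real n0" "V0 \<ge> 4 * K / h" by (auto simp: V0_def)
  have main: "h / 81 / V \<le> (\<Sum>n\<in>{n\<in>log_almost_primes (\<theta> * V) (3 * V). v < ln (real n) \<and> ln (real n) \<le> v + h}. 1 / real n)"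
    if V: "V0 \<le> V" "V \<le> v" "v \<le> 2 * V" for V v
  proof -
    define x y where "x = exp v" and "y = exp (v + h)"
    define P where "P = {p. prime p \<and> v < ln (real p) \<and> ln (real p) \<le> v + h}"
    define Q where "Q = {(p,q). prime p \<and> prime q \<and> \<theta> * V < ln (real p) \<and> \<theta> * V < ln (real q) \<and>
                        v < ln (real (p * q)) \<and> ln (real (p * q)) \<le> v + h}"
    define X where "X = {n\<in>log_almost_primes (\<theta> * V) (3 * V). v < ln (real n) \<and> ln (real n) \<le> v + h}"
    define bad where "bad = (\<lambda>k::nat. ln (real k) \<le> \<theta> * V \<or> \<not> prime k)"
    have V1: "V \<ge> 1" "v \<ge> 1" using V V0 by auto
    have lnx: "ln x = v" "ln y = v + h" by (auto simp: x_def y_def)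
    have x1: "x \<ge> 1" "x > 0" using V1 by (auto simp: x_def)
    have xy: "x \<le> y" using assms by (auto simp: x_def y_def)
    have y_eq: "y = exp h * x" by (simp add: y_def x_def exp_add mult.commute)
    have "exp h \<le> exp 1" using assms by simp
    also have "\<dots> \<le> (3::real)" by (rule exp_le)
    finally have y3: "y \<le> 3 * x" using x1 by (simp add: y_eq)
    have yh: "y - x \<ge> h * x"
      using exp_ge_add_one_self[of h] x1 mult_right_mono[of "1 + h" "exp h" x] by (simp add: y_eq algebra_simps)
    have y1: "y \<ge> 1" "y > 0" using x1 xy by auto
    have mem_cell: "0 < n \<Longrightarrow> n \<in> nats_le y - nats_le x \<longleftrightarrow> v < ln (real n) \<and> ln (real n) \<le> v + h" for n
      by (auto simp: mem_nats_le x_def y_def ln_le_iff_le_exp less_ln_iff_exp_less)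
    have finP: "finite P"
      by (rule finite_subset[of _ "nats_le y"])
         (auto simp: P_def mem_nats_le y_def ln_le_iff_le_exp prime_gt_0_nat)
    have mem_reg: "0 < p \<Longrightarrow> 0 < q \<Longrightarrow> (p, q) \<in> mult_region y - mult_region x \<longleftrightarrow>
        v < ln (real (p * q)) \<and> ln (real (p * q)) \<le> v + h" for p q
      using ln_le_iff_le_exp[of "p * q"] less_ln_iff_exp_less[of "p * q"]
      by (auto simp: mem_mult_region x_def y_def)
    have fin_reg: "finite (mult_region y)" by (simp add: mult_region_def)
    have QR: "Q \<subseteq> mult_region y - mult_region x"
    proof clarify
      fix p q assume "(p, q) \<in> Q"
      then show "(p, q) \<in> mult_region y - mult_region x"
        using mem_reg[of p q] by (auto simp: Q_def prime_gt_0_nat)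
    qed
    have finQ: "finite Q" using QR fin_reg by (meson finite_Diff finite_subset)
    have psi_cell: "psi y - psi x \<le> (\<Sum>p\<in>P. ln (real p)) + h * x / 4"
    proof -
      have "psi y - psi x = (\<Sum>n\<in>nats_le y - nats_le x. mangoldt n)"
        unfolding psi_def using xy by (subst sum_diff) (auto simp: mem_nats_le)
      also have "\<dots> = (\<Sum>n\<in>nats_le y - nats_le x. (if prime n then ln (real n) else 0) + f n * real n)"
        by (intro sum.cong) (auto simp: f_def mem_nats_le)
      also have "\<dots> \<le> (\<Sum>n\<in>nats_le y - nats_le x. if prime n then ln (real n) else 0) +
                     (\<Sum>n\<in>nats_le y - nats_le x. f n * y)"
        unfolding sum.distrib using f_nonneg
        by (intro add_mono order.refl sum_mono mult_left_mono) (auto simp: mem_nats_le)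
      also have "(\<Sum>n\<in>nats_le y - nats_le x. if prime n then ln (real n) else 0) = (\<Sum>p\<in>P. ln (real p))"
      proof -
        have "n \<in> P \<longleftrightarrow> n \<in> nats_le y - nats_le x \<and> prime n" for n
          using mem_cell[of n] prime_gt_0_nat[of n] by (auto simp: P_def)
        then have "P = {n\<in>nats_le y - nats_le x. prime n}" by blast
        then show ?thesis
          using sum.inter_filter[of "nats_le y - nats_le x" "\<lambda>n. ln (real n)" prime] by simp
      qed
      also have "(\<Sum>n\<in>nats_le y - nats_le x. f n * y) \<le> h / 12 * y"
      proof -
        have "nats_le y - nats_le x \<subseteq> {n0..<Suc (nat \<lfloor>y\<rfloor>)}"
        proof
          fix n assume n: "n \<in> nats_le y - nats_le x"
          then have "n \<le> nat \<lfloor>y\<rfloor>" by (auto simp: nats_le_altdef)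
          moreover have "real n > x" using n by (auto simp: mem_nats_le)
          moreover have "x > real n0"
            using V V0 exp_ge_add_one_self[of v] unfolding x_def by linarith
          ultimately show "n \<in> {n0..<Suc (nat \<lfloor>y\<rfloor>)}" by auto
        qed
        then have "(\<Sum>n\<in>nats_le y - nats_le x. f n) \<le> sum f {n0..<Suc (nat \<lfloor>y\<rfloor>)}"
          using f_nonneg by (intro sum_mono2) auto
        also have "\<dots> \<le> h / 12" using n0[of n0 "Suc (nat \<lfloor>y\<rfloor>)"] by simp
        finally show ?thesis using y1 by (simp add: sum_distrib_right[symmetric] mult_right_mono)
      qed
      also have "h / 12 * y \<le> h / 12 * (3 * x)" using y3 assms by (intro mult_left_mono) auto
      finally show ?thesis by simp
    qed
    \<comment> \<open>Summing over \<open>m\<close> first with Chebyshev's bound leaves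
      \<open>mangoldt k / k\<close> over the bad \<open>k\<close>: Mertens's estimate handles the
      small ones, the bound \<open>t\<close> the non-primes.\<close>
    have badsum: "(\<Sum>(k,m)\<in>{(k,m)\<in>mult_region y. bad k}. mangoldt k * mangoldt m) \<le> 42 * x * (\<theta> * V + 16 + t)"
    proof -
      have "{(k,m)\<in>mult_region y. bad k} = Sigma {k\<in>nats_le y. bad k} (\<lambda>k. nats_le (y / real k))"
        by (auto simp: mult_region_def)
      then have "(\<Sum>(k,m)\<in>{(k,m)\<in>mult_region y. bad k}. mangoldt k * mangoldt m)
        = (\<Sum>k\<in>{k\<in>nats_le y. bad k}. \<Sum>m\<in>nats_le (y / real k). mangoldt k * mangoldt m)"
        by (simp add: sum.Sigma)
      also have "\<dots> = (\<Sum>k\<in>{k\<in>nats_le y. bad k}. mangoldt k * psi (y / real k))"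
        by (simp add: psi_def sum_distrib_left)
      also have "\<dots> \<le> (\<Sum>k\<in>{k\<in>nats_le y. bad k}. mangoldt k * (14 * (y / real k)))"
        using y1 by (intro sum_mono mult_left_mono psi_le mangoldt_nonneg) auto
      also have "\<dots> = 14 * y * (\<Sum>k\<in>{k\<in>nats_le y. bad k}. mangoldt k / real k)"
        by (simp add: sum_distrib_left mult_ac)
      also have "(\<Sum>k\<in>{k\<in>nats_le y. bad k}. mangoldt k / real k)
          \<le> (\<Sum>k\<in>nats_le (exp (\<theta> * V)) \<union> nats_le y. (if k \<in> nats_le (exp (\<theta> * V)) then mangoldt k / real k else 0) + f k)"
      proof -
        have "(\<Sum>k\<in>{k\<in>nats_le y. bad k}. mangoldt k / real k) \<le>
          (\<Sum>k\<in>{k\<in>nats_le y. bad k}. (if k \<in> nats_le (exp (\<theta> * V)) then mangoldt k / real k else 0) + f k)"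
        proof (rule sum_mono)
          fix k assume k: "k \<in> {k\<in>nats_le y. bad k}"
          then have "k \<in> nats_le (exp (\<theta> * V)) \<or> \<not> prime k"
            by (auto simp: bad_def mem_nats_le ln_le_iff_le_exp)
          then show "mangoldt k / real k \<le> (if k \<in> nats_le (exp (\<theta> * V)) then mangoldt k / real k else 0) + f k"
            using f_nonneg[of k] by (auto simp: f_def)
        qed
        also have "\<dots> \<le> (\<Sum>k\<in>nats_le (exp (\<theta> * V)) \<union> nats_le y. (if k \<in> nats_le (exp (\<theta> * V)) then mangoldt k / real k else 0) + f k)"
          using f_nonneg by (intro sum_mono2) (auto intro!: add_nonneg_nonneg mangoldt_nonneg divide_nonneg_nonneg)
        finally show ?thesis .
      qed
      also have "\<dots> = mertens_sum (exp (\<theta> * V)) + (\<Sum>k\<in>nats_le (exp (\<theta> * V)) \<union> nats_le y. f k)"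
      proof -
        have "(\<Sum>k\<in>nats_le (exp (\<theta> * V)) \<union> nats_le y. if k \<in> nats_le (exp (\<theta> * V)) then mangoldt k / real k else 0)
          = mertens_sum (exp (\<theta> * V))"
          unfolding mertens_sum_def by (rule sum.mono_neutral_cong_right) auto
        then show ?thesis by (simp add: sum.distrib)
      qed
      also have "\<dots> \<le> (\<theta> * V + 16) + t"
      proof (rule add_mono)
        have "exp (\<theta> * V) \<ge> 1" using \<theta> V1 by simp
        from mertens_sum_bounds[OF this] show "mertens_sum (exp (\<theta> * V)) \<le> \<theta> * V + 16" by simp
      qed (use t(2) in auto)
      finally have "(\<Sum>(k,m)\<in>{(k,m)\<in>mult_region y. bad k}. mangoldt k * mangoldt m) \<le> 14 * y * (\<theta> * V + 16 + t)"
        using y1 by (simp add: mult_left_mono)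
      also have "\<dots> \<le> 14 * (3 * x) * (\<theta> * V + 16 + t)"
        using y3 \<theta> V1 t by (intro mult_right_mono mult_left_mono) auto
      finally show ?thesis by simp
    qed
    \<comment> \<open>A pair outside \<open>Q\<close> is bad in one of its two coordinates, so
      \<open>badsum\<close> enters twice by symmetry.\<close>
    have sel_cell: "selberg_sum y - selberg_sum x \<le> (\<Sum>(p,q)\<in>Q. ln (real p) * ln (real q)) + 84 * x * (\<theta> * V + 16 + t)"
    proof -
      let ?g = "\<lambda>(k,m). mangoldt k * mangoldt m :: real"
      have g0: "?g z \<ge> 0" for z by (auto simp: mangoldt_nonneg split: prod.split)
      let ?B1 = "{(k,m)\<in>mult_region y. bad k}" and ?B2 = "{(k,m)\<in>mult_region y. bad m}"
      have "selberg_sum y - selberg_sum x = (\<Sum>z\<in>mult_region y - mult_region x. ?g z)"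
        unfolding selberg_sum_eq using xy fin_reg by (subst sum_diff) (auto simp: mem_mult_region)
      also have "\<dots> \<le> (\<Sum>z\<in>Q \<union> (?B1 \<union> ?B2). ?g z)"
      proof (rule sum_mono2)
        show "finite (Q \<union> (?B1 \<union> ?B2))" using finQ by (auto intro: finite_subset[OF _ fin_reg])
        show "mult_region y - mult_region x \<subseteq> Q \<union> (?B1 \<union> ?B2)"
        proof
          fix z assume z: "z \<in> mult_region y - mult_region x"
          obtain k m where km: "z = (k, m)" by (cases z)
          with z have "0 < k" "0 < m" by (auto simp: mem_mult_region)
          with z km mem_reg[of k m] show "z \<in> Q \<union> (?B1 \<union> ?B2)" by (auto simp: Q_def bad_def)
        qed
      qed (use g0 in auto)
      also have "\<dots> \<le> (\<Sum>z\<in>Q. ?g z) + ((\<Sum>z\<in>?B1. ?g z) + (\<Sum>z\<in>?B2. ?g z))"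
      proof -
        have fB: "finite ?B1" "finite ?B2" by (auto intro: finite_subset[OF _ fin_reg])
        have "(\<Sum>z\<in>A \<union> B. ?g z) \<le> (\<Sum>z\<in>A. ?g z) + (\<Sum>z\<in>B. ?g z)" if "finite A" "finite B" for A B
          using sum.union_inter[OF that, of ?g] sum_nonneg[of "A \<inter> B" ?g] g0 by auto
        from this[OF finQ finite_UnI[OF fB]] this[OF fB] show ?thesis by linarith
      qed
      also have "(\<Sum>z\<in>?B2. ?g z) = (\<Sum>z\<in>?B1. ?g z)"
        by (rule sum.reindex_bij_witness[where i = "\<lambda>(k,m). (m,k)" and j = "\<lambda>(k,m). (m,k)"])
           (auto simp: mem_mult_region mult.commute)
      also have "(\<Sum>z\<in>Q. ?g z) = (\<Sum>(p,q)\<in>Q. ln (real p) * ln (real q))"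
        by (intro sum.cong refl) (auto simp: Q_def)
      finally show ?thesis using badsum by (simp add: algebra_simps)
    qed
    have lower: "h * x * v \<le> v * (\<Sum>p\<in>P. ln (real p)) + (\<Sum>(p,q)\<in>Q. ln (real p) * ln (real q))"
    proof -
      define a b where "a = (\<Sum>p\<in>P. ln (real p))" and "b = (\<Sum>(p,q)\<in>Q. ln (real p) * ln (real q))"
      have "psi y * (v + h) + selberg_sum y \<ge> 2 * y * (v + h) - 134 * y"
        using selberg_formula[OF y1(1)] lnx by simp
      moreover have "psi x * v + selberg_sum x \<le> 2 * x * v + 134 * x"
        using selberg_formula[OF x1(1)] lnx by simp
      moreover have "psi y * h \<le> 14 * y * 1"
        using assms psi_le[of y] y1 by (intro mult_mono) auto
      moreover have "y * h \<ge> 0" using y1 assms by simp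
      ultimately have 1: "(psi y - psi x) * v + (selberg_sum y - selberg_sum x) \<ge> 2 * ((y - x) * v) - 148 * y - 134 * x"
        by (simp add: algebra_simps)
      have "(y - x) * v \<ge> h * x * v" using yh V1 by (intro mult_right_mono) auto
      with 1 have "(psi y - psi x) * v + (selberg_sum y - selberg_sum x) \<ge> 2 * (h * x * v) - 846 * x"
        using y3 x1 by linarith
      moreover have "(psi y - psi x) * v \<le> (a + h * x / 4) * v"
        using psi_cell V1 unfolding a_def by (intro mult_right_mono) auto
      ultimately have 2: "v * a + b \<ge> 2 * (h * x * v) - (h * x * v) / 4 - 846 * x - 84 * x * (\<theta> * V + 16 + t)"
        using sel_cell unfolding a_def b_def by (simp add: algebra_simps)
      have "84 * x * (\<theta> * V) \<le> (h * x * v) / 4"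
      proof -
        have "84 * \<theta> * V \<le> h / 4 * v" unfolding \<theta>_def using V V1 assms
            mult_left_mono[of V v "h * 84 / 400"] mult_nonneg_nonneg[of h v] by simp
        then have "x * (84 * \<theta> * V) \<le> x * (h / 4 * v)" using x1 by (intro mult_left_mono) auto
        then show ?thesis by (simp add: mult_ac)
      qed
      moreover have "K * x \<le> (h * x * v) / 4"
      proof -
        have "4 * K \<le> h * V0" using V0(3) assms by (simp add: pos_divide_le_eq mult.commute)
        also have "\<dots> \<le> h * v" using V assms by (intro mult_left_mono) auto
        finally have "x * (4 * K) \<le> x * (h * v)" using x1 by (intro mult_left_mono) auto
        then show ?thesis by (simp add: mult_ac)
      qed
      moreover have "0 \<le> h * x * v" using assms x1 V1 by simp
      ultimately show ?thesis using 2 unfolding a_def b_def K_def by (simp add: algebra_simps)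
    qed
    have v3: "v + h \<le> 3 * V" using V V1 assms by simp
    have finX: "finite X" by (simp add: X_def)
    have "P \<subseteq> X"
    proof
      fix p assume p: "p \<in> P"
      have "\<theta> * V \<le> 1 * V" using \<theta> V1 by (intro mult_right_mono) auto
      then have "\<theta> * V \<le> v" using V by simp
      with p v3 show "p \<in> X" by (auto simp: P_def X_def log_almost_primes_def log_primes_def)
    qed
    then have cP: "card P \<le> card X" using finX by (rule card_mono[rotated])
    have Qln: "ln (real p) \<le> 3 * V \<and> ln (real q) \<le> 3 * V \<and> 0 \<le> ln (real p) \<and> 0 \<le> ln (real q)" if "(p,q) \<in> Q" for p q
    proof -
      have pq: "prime p" "prime q" using that by (auto simp: Q_def)
      then have g: "p \<ge> 1" "q \<ge> 1" by (auto dest: prime_ge_1_nat)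
      then have "ln (real (p * q)) = ln (real p) + ln (real q)" by (simp add: ln_mult)
      moreover have "ln (real (p * q)) \<le> 3 * V" using that v3 by (auto simp: Q_def)
      moreover have "0 \<le> ln (real p)" "0 \<le> ln (real q)" using g by auto
      ultimately show ?thesis by linarith
    qed
    have "(\<lambda>(p, q). p * q) ` Q \<subseteq> X"
    proof clarify
      fix p q assume pq: "(p,q) \<in> Q"
      then have "p \<in> log_primes (\<theta> * V) (3 * V)" "q \<in> log_primes (\<theta> * V) (3 * V)"
        using Qln[OF pq] by (auto simp: Q_def log_primes_def)
      then have "p * q \<in> log_almost_primes (\<theta> * V) (3 * V)" by (auto simp: log_almost_primes_def)
      then show "p * q \<in> X" using pq by (auto simp: X_def Q_def)
    qed
    then have "card ((\<lambda>(p, q). p * q) ` Q) \<le> card X" using finX by (rule card_mono[rotated])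
    moreover have "card Q \<le> 2 * card ((\<lambda>(p, q). p * q) ` Q)"
      by (rule card_prime_pairs_le[OF finQ]) (auto simp: Q_def)
    ultimately have cQ: "card Q \<le> 2 * card X" by simp
    \<comment> \<open>From weights to cardinalities: every term on the right of \<open>lower\<close>
      is at most \<open>9 * V * V\<close>, and \<open>card X\<close> bounds \<open>card P\<close>
      once and the ordered pairs in \<open>Q\<close> twice, whence the factor 27.\<close>
    have "v * (\<Sum>p\<in>P. ln (real p)) \<le> 3 * V * (real (card P) * (3 * V))"
    proof (rule mult_mono)
      show "(\<Sum>p\<in>P. ln (real p)) \<le> real (card P) * (3 * V)"
        using v3 by (intro sum_bounded_above) (auto simp: P_def)
      show "0 \<le> (\<Sum>p\<in>P. ln (real p))" by (intro sum_nonneg) (auto simp: P_def dest: prime_ge_1_nat)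
    qed (use V V1 in auto)
    moreover have "(\<Sum>(p,q)\<in>Q. ln (real p) * ln (real q)) \<le> real (card Q) * (3 * V * (3 * V))"
    proof (rule sum_bounded_above)
      fix z assume z: "z \<in> Q"
      obtain p q where "z = (p, q)" by (cases z)
      with z Qln[of p q] show "(case z of (p, q) \<Rightarrow> ln (real p) * ln (real q)) \<le> 3 * V * (3 * V)"
        using mult_mono[of "ln (real p)" "3 * V" "ln (real q)" "3 * V"] V1 by simp
    qed
    ultimately have "h * x * v \<le> 9 * V * V * (real (card P) + real (card Q))"
      using lower by (simp add: algebra_simps)
    also have "\<dots> \<le> 9 * V * V * (3 * real (card X))"
      using cP cQ V1 by (intro mult_left_mono) auto
    finally have "h * x * v \<le> 27 * V * V * real (card X)" by simp
    moreover have "h * x * V \<le> h * x * v" using V assms x1 by (intro mult_left_mono) auto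
    ultimately have "V * (h * x) \<le> V * (27 * V * real (card X))" by (simp add: algebra_simps)
    then have hx: "h * x \<le> 27 * V * real (card X)" using V1 by simp
    have "h / 81 / V \<le> real (card X) * (1 / y)"
    proof -
      have "h * y \<le> h * (3 * x)" using y3 assms by (intro mult_left_mono) auto
      also have "\<dots> \<le> 81 * V * real (card X)" using hx by simp
      finally show ?thesis using V1 y1 by (simp add: field_simps)
    qed
    also have "\<dots> \<le> (\<Sum>n\<in>X. 1 / real n)"
    proof (rule sum_bounded_below)
      fix n assume n: "n \<in> X"
      then have "n > 0" by (auto simp: X_def log_almost_primes_pos)
      moreover have "real n \<le> y" using n \<open>n > 0\<close> by (auto simp: X_def y_def ln_le_iff_le_exp)
      ultimately show "1 / y \<le> 1 / real n" by (intro divide_left_mono) (use y1 in auto)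
    qed
    finally show ?thesis unfolding X_def .
  qed
  show ?thesis by (rule that[of \<theta> "h / 81" V0]) (use \<theta> assms V0 main in auto)
qed

section \<open>The Turan--Kubilius inequality\<close>

text \<open>On this set \<open>ln p\<close> exceeds \<open>\<theta> * V\<close>, so Mertens's
  estimate up to \<open>exp (3 * V)\<close> can be divided by \<open>\<theta> * V\<close>. A single
  scale \<open>V\<close> thus carries only a bounded reciprocal sum.\<close>

lemma sum_inverse_log_primes_le:
  assumes "0 < \<theta>" "1 \<le> V"
  shows "(\<Sum>p\<in>log_primes (\<theta> * V) (3 * V). 1 / real p) \<le> 19 / \<theta>"
proof -
  let ?P = "log_primes (\<theta> * V) (3 * V)"
  have "(\<Sum>p\<in>?P. 1 / real p) \<le> (\<Sum>p\<in>?P. 1 / (\<theta> * V) * (mangoldt p / real p))"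
  proof (rule sum_mono)
    fix p assume p: "p \<in> ?P"
    then have "p > 0" "\<theta> * V < ln (real p)" "mangoldt p = ln (real p)"
      by (auto simp: log_primes_def prime_gt_0_nat)
    then show "1 / real p \<le> 1 / (\<theta> * V) * (mangoldt p / real p)"
      using assms by (simp add: field_simps)
  qed
  also have "\<dots> \<le> 1 / (\<theta> * V) * mertens_sum (exp (3 * V))"
    unfolding sum_distrib_left[symmetric] mertens_sum_def
  proof (intro mult_left_mono sum_mono2)
    show "?P \<subseteq> nats_le (exp (3 * V))"
      by (auto simp: log_primes_def mem_nats_le ln_le_iff_le_exp prime_gt_0_nat)
  qed (use assms in \<open>auto simp: mangoldt_nonneg\<close>)
  also have "\<dots> \<le> 1 / (\<theta> * V) * (19 * V)"
  proof (rule mult_left_mono)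
    have "exp (3 * V) \<ge> 1" using assms by simp
    from mertens_sum_bounds[OF this] show "mertens_sum (exp (3 * V)) \<le> 19 * V" using assms by simp
  qed (use assms in auto)
  also have "\<dots> = 19 / \<theta>" using assms by simp
  finally show ?thesis .
qed

section \<open>Mean and variance of the number of divisors in a finite set\<close>

definition recip_sum :: "nat set \<Rightarrow> real" where
  "recip_sum D = (\<Sum>d\<in>D. 1 / real d)"

definition num_divisors_in :: "nat set \<Rightarrow> nat \<Rightarrow> real" where
  "num_divisors_in D n = (\<Sum>d\<in>D. of_bool (d dvd n))"

text \<open>The limiting variance of \<open>num_divisors_in D\<close>: the integers divisible by
  both \<open>d\<close> and \<open>e\<close> have density \<open>1 / lcm d e\<close>, and coprime
  pairs contribute 0.\<close>

definition divisor_variance :: "nat set \<Rightarrow> real" where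
  "divisor_variance D = (\<Sum>d\<in>D. \<Sum>e\<in>D. 1 / real (lcm d e) - 1 / (real d * real e))"

lemma recip_sum_nonneg: "recip_sum D \<ge> 0"
  by (simp add: recip_sum_def sum_nonneg)

lemma sum_multiples_nats_le:
  fixes f :: "nat \<Rightarrow> 'b::comm_monoid_add"
  assumes "d > 0"
  shows "(\<Sum>n\<in>{n\<in>nats_le x. d dvd n}. f n) = (\<Sum>m\<in>nats_le (x / real d). f (d * m))"
  using assms
  by (intro sum.reindex_bij_witness[where i = "\<lambda>m. d * m" and j = "\<lambda>n. n div d"])
     (auto simp: mem_nats_le field_simps elim!: dvdE)

lemma card_multiples_nats_le:
  assumes "d > 0"
  shows "(\<Sum>n\<in>nats_le x. of_bool (d dvd n) :: real) = real (card (nats_le (x / real d)))"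
proof -
  have "(\<Sum>n\<in>nats_le x. of_bool (d dvd n) :: real) = (\<Sum>n\<in>{n\<in>nats_le x. d dvd n}. 1)"
    unfolding of_bool_def by (rule sum.inter_filter[symmetric]) simp
  then show ?thesis using sum_multiples_nats_le[OF assms, of "\<lambda>_. 1::real" x] by simp
qed

lemma turan_kubilius:
  assumes D: "finite D" "\<And>d. d \<in> D \<Longrightarrow> d > 0" and x: "x \<ge> 0"
  shows "(\<Sum>n\<in>nats_le x. (num_divisors_in D n - recip_sum D)\<^sup>2)
    \<le> x * divisor_variance D + 2 * recip_sum D * real (card D)"
proof -
  define L where "L = recip_sum D"
  let ?N = "nats_le x" and ?w = "num_divisors_in D"
  have L: "L \<ge> 0" by (simp add: L_def recip_sum_nonneg)
  have "(\<Sum>n\<in>?N. (?w n)\<^sup>2) = (\<Sum>n\<in>?N. \<Sum>d\<in>D. \<Sum>e\<in>D. of_bool (lcm d e dvd n))"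
    by (simp add: num_divisors_in_def power2_eq_square sum_product of_bool_conj[symmetric])
  also have "\<dots> = (\<Sum>d\<in>D. \<Sum>n\<in>?N. \<Sum>e\<in>D. of_bool (lcm d e dvd n))"
    by (rule sum.swap)
  also have "\<dots> = (\<Sum>d\<in>D. \<Sum>e\<in>D. \<Sum>n\<in>?N. of_bool (lcm d e dvd n))"
    by (intro sum.cong refl sum.swap)
  also have "\<dots> = (\<Sum>d\<in>D. \<Sum>e\<in>D. real (card (nats_le (x / real (lcm d e)))))"
    using D by (intro sum.cong refl card_multiples_nats_le) (simp add: lcm_pos_nat)
  also have "\<dots> \<le> (\<Sum>d\<in>D. \<Sum>e\<in>D. x / real (lcm d e))"
    using x by (intro sum_mono card_nats_le_bounds) auto
  finally have 1: "(\<Sum>n\<in>?N. (?w n)\<^sup>2) \<le> x * (\<Sum>d\<in>D. \<Sum>e\<in>D. 1 / real (lcm d e))"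
    by (simp add: sum_distrib_left)
  have "(\<Sum>n\<in>?N. ?w n) = (\<Sum>d\<in>D. \<Sum>n\<in>?N. of_bool (d dvd n))"
    unfolding num_divisors_in_def by (rule sum.swap)
  also have "\<dots> = (\<Sum>d\<in>D. real (card (nats_le (x / real d))))"
    using D by (intro sum.cong refl card_multiples_nats_le) auto
  also have "\<dots> \<ge> (\<Sum>d\<in>D. x / real d - 1)"
  proof (rule sum_mono)
    fix d
    show "x / real d - 1 \<le> real (card (nats_le (x / real d)))"
      using card_nats_le_bounds(2)[of "x / real d"] x by simp
  qed
  also have "(\<Sum>d\<in>D. x / real d - 1) = x * L - real (card D)"
    by (simp add: sum_subtractf L_def recip_sum_def sum_distrib_left)
  finally have 2: "(\<Sum>n\<in>?N. ?w n) \<ge> x * L - real (card D)" .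
  have "(\<Sum>n\<in>?N. (?w n - L)\<^sup>2) = (\<Sum>n\<in>?N. (?w n)\<^sup>2) - 2 * L * (\<Sum>n\<in>?N. ?w n) + real (card ?N) * L\<^sup>2"
    by (simp add: power2_diff sum.distrib sum_subtractf sum_distrib_left mult_ac)
  also have "\<dots> \<le> x * (\<Sum>d\<in>D. \<Sum>e\<in>D. 1 / real (lcm d e)) - 2 * L * (x * L - real (card D)) + x * L\<^sup>2"
    using 1 mult_left_mono[OF 2, of "2 * L"] L card_nats_le_bounds(1)[OF x]
      mult_right_mono[of "real (card ?N)" x "L\<^sup>2"] by simp
  also have "\<dots> = x * ((\<Sum>d\<in>D. \<Sum>e\<in>D. 1 / real (lcm d e)) - L * L) + 2 * L * real (card D)"
    by (simp add: algebra_simps power2_eq_square)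
  also have "L * L = (\<Sum>d\<in>D. \<Sum>e\<in>D. 1 / (real d * real e))"
    by (simp add: L_def recip_sum_def sum_product)
  finally show ?thesis by (simp add: divisor_variance_def sum_subtractf L_def)
qed

lemma turan_kubilius_L1:
  assumes D: "finite D" "\<And>d. d \<in> D \<Longrightarrow> d > 0" and x: "x > 0"
  shows "(\<Sum>n\<in>nats_le x. \<bar>num_divisors_in D n - recip_sum D\<bar>)
    \<le> x * sqrt (divisor_variance D + 2 * recip_sum D * real (card D) / x)"
proof -
  let ?a = "\<lambda>n. \<bar>num_divisors_in D n - recip_sum D\<bar>" and ?N = "nats_le x"
  have "(\<Sum>n\<in>?N. ?a n)\<^sup>2 \<le> (\<Sum>n\<in>?N. (?a n)\<^sup>2) * (\<Sum>n\<in>?N. 1\<^sup>2)"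
    using Cauchy_Schwarz_ineq_sum[of ?a "\<lambda>_. 1" ?N] by simp
  also have "\<dots> = (\<Sum>n\<in>?N. (num_divisors_in D n - recip_sum D)\<^sup>2) * real (card ?N)" by simp
  also have "\<dots> \<le> (\<Sum>n\<in>?N. (num_divisors_in D n - recip_sum D)\<^sup>2) * x"
    using x by (intro mult_left_mono card_nats_le_bounds sum_nonneg) auto
  also have "\<dots> \<le> (x * divisor_variance D + 2 * recip_sum D * real (card D)) * x"
    using x by (intro mult_right_mono turan_kubilius D) auto
  also have "\<dots> = x\<^sup>2 * (divisor_variance D + 2 * recip_sum D * real (card D) / x)"
    using x by (simp add: power2_eq_square algebra_simps)
  finally have "(\<Sum>n\<in>?N. ?a n) \<le> sqrt (x\<^sup>2 * (divisor_variance D + 2 * recip_sum D * real (card D) / x))"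
    by (rule real_le_rsqrt)
  then show ?thesis using x by (simp add: real_sqrt_mult)
qed

lemma divisor_variance_primes:
  assumes "finite D" "\<And>d. d \<in> D \<Longrightarrow> prime d"
  shows "divisor_variance D \<le> recip_sum D"
  unfolding divisor_variance_def recip_sum_def
proof (rule sum_mono)
  fix d assume d: "d \<in> D"
  have "(\<Sum>e\<in>D. 1 / real (lcm d e) - 1 / (real d * real e)) \<le> (\<Sum>e\<in>D. if e = d then 1 / real d else 0)"
  proof (rule sum_mono)
    fix e assume e: "e \<in> D"
    show "1 / real (lcm d e) - 1 / (real d * real e) \<le> (if e = d then 1 / real d else 0)"
    proof (cases "e = d")
      case False
      then have "coprime d e" using d e assms by (intro primes_coprime) auto
      then show ?thesis using False by (simp add: lcm_coprime)
    qed simp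
  qed
  also have "\<dots> = 1 / real d" using assms d by simp
  finally show "(\<Sum>e\<in>D. 1 / real (lcm d e) - 1 / (real d * real e)) \<le> 1 / real d" .
qed

text \<open>Two members of \<open>D\<close> that are not coprime share a prime \<open>p\<close> of
  one block \<open>s\<close>, and by disjointness of the blocks both have the form
  \<open>p * f\<close> with \<open>f\<close> equal to 1 or a prime of that block. So each block
  contributes at most a constant, and different blocks do not interact.\<close>

lemma divisor_variance_almost_primes:
  assumes D: "D \<subseteq> (\<Union>s<S. log_almost_primes (a s) (b s))"
    and disj: "\<And>s t. s < S \<Longrightarrow> t < S \<Longrightarrow> s \<noteq> t \<Longrightarrow> log_primes (a s) (b s) \<inter> log_primes (a t) (b t) = {}"
    and C: "\<And>s. s < S \<Longrightarrow> recip_sum (log_primes (a s) (b s)) \<le> C" "C \<ge> 0"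
  shows "divisor_variance D \<le> real S * (C * ((1 + C)\<^sup>2 + (1 + C)))"
proof -
  define Q where "Q = (\<lambda>s. log_primes (a s) (b s))"
  define E where "E = (\<lambda>s. insert 1 (Q s))"
  have finD: "finite D" by (rule finite_subset[OF D]) auto
  have finQ: "finite (Q s)" "finite (E s)" for s by (auto simp: Q_def E_def)
  have Qp: "prime p" if "p \<in> Q s" for p s using that by (auto simp: Q_def log_primes_def)
  have in_block: "\<exists>f\<in>E s. d = p * f" if "d \<in> D" "p dvd d" "p \<in> Q s" "s < S" for d p s
  proof -
    have "d \<in> (\<Union>s<S. log_almost_primes (a s) (b s))" using that(1) D by blast
    then obtain t where t: "t < S" "d \<in> log_almost_primes (a t) (b t)" by blast
    from t(2) consider "d \<in> Q t" | q r where "d = q * r" "q \<in> Q t" "r \<in> Q t"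
      by (auto simp: log_almost_primes_def Q_def)
    then show ?thesis
    proof cases
      case 1
      then have "p = d" using that Qp by (metis primes_dvd_imp_eq)
      then show ?thesis by (auto simp: E_def)
    next
      case 2
      then have "p = q \<or> p = r" using that Qp by (metis prime_dvd_mult_iff primes_dvd_imp_eq)
      moreover from this have "s = t" using disj[of s t] that t(1) 2 by (auto simp: Q_def)
      ultimately show ?thesis using 2 by (auto simp: E_def)
    qed
  qed
  have has_prime: "\<exists>s<S. \<exists>p\<in>Q s. p dvd d \<and> p dvd e" if de: "d \<in> D" "e \<in> D" "\<not> coprime d e" for d e
  proof -
    have "gcd d e \<noteq> 1" using de(3) by (simp only: coprime_iff_gcd_eq_1 not_False_eq_True)
    then obtain r where r0: "prime r" "r dvd gcd d e" using prime_factor_nat by blast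
    then have r: "prime r" "r dvd d" "r dvd e" by (auto intro: dvd_trans)
    have "d \<in> (\<Union>s<S. log_almost_primes (a s) (b s))" using de(1) D by blast
    then obtain t where t: "t < S" "d \<in> log_almost_primes (a t) (b t)" by blast
    from t(2) consider "d \<in> Q t" | q q' where "d = q * q'" "q \<in> Q t" "q' \<in> Q t"
      by (auto simp: log_almost_primes_def Q_def)
    then have "r \<in> Q t"
    proof cases
      case 1
      then show ?thesis using r Qp by (metis primes_dvd_imp_eq)
    next
      case 2
      then have "r = q \<or> r = q'" using r Qp by (metis prime_dvd_mult_iff primes_dvd_imp_eq)
      then show ?thesis using 2 by auto
    qed
    then show ?thesis using t r by blast
  qed
  have Dpos: "d > 0" if "d \<in> D" for d using that D log_almost_primes_pos by blast
  let ?g = "\<lambda>s p d e. if p dvd d \<and> p dvd e then 1 / real (lcm d e) else 0"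
  have "divisor_variance D \<le> (\<Sum>d\<in>D. \<Sum>e\<in>D. \<Sum>s<S. \<Sum>p\<in>Q s. ?g s p d e)"
    unfolding divisor_variance_def
  proof (intro sum_mono)
    fix d e assume de: "d \<in> D" "e \<in> D"
    show "1 / real (lcm d e) - 1 / (real d * real e) \<le> (\<Sum>s<S. \<Sum>p\<in>Q s. ?g s p d e)"
    proof (cases "coprime d e")
      case True
      then show ?thesis by (auto simp: lcm_coprime intro!: sum_nonneg)
    next
      case False
      then obtain s p where sp: "s < S" "p \<in> Q s" "p dvd d" "p dvd e" using has_prime de by blast
      have "1 / real (lcm d e) = ?g s p d e" using sp by simp
      also have "\<dots> \<le> (\<Sum>p\<in>Q s. ?g s p d e)"
        using sp finQ by (intro member_le_sum) auto
      also have "\<dots> \<le> (\<Sum>s<S. \<Sum>p\<in>Q s. ?g s p d e)"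
        using sp by (intro member_le_sum[of s "{..<S}" "\<lambda>s. \<Sum>p\<in>Q s. ?g s p d e"]) (auto intro!: sum_nonneg)
      finally have "1 / real (lcm d e) \<le> (\<Sum>s<S. \<Sum>p\<in>Q s. ?g s p d e)" .
      moreover have "0 \<le> 1 / (real d * real e)" by simp
      ultimately show ?thesis by linarith
    qed
  qed
  also have "\<dots> = (\<Sum>s<S. \<Sum>p\<in>Q s. \<Sum>d\<in>D. \<Sum>e\<in>D. ?g s p d e)"
  proof -
    have "(\<Sum>d\<in>D. \<Sum>e\<in>D. \<Sum>s<S. \<Sum>p\<in>Q s. ?g s p d e) = (\<Sum>d\<in>D. \<Sum>s<S. \<Sum>e\<in>D. \<Sum>p\<in>Q s. ?g s p d e)"
      by (rule sum.cong[OF refl], rule sum.swap)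
    also have "\<dots> = (\<Sum>s<S. \<Sum>d\<in>D. \<Sum>e\<in>D. \<Sum>p\<in>Q s. ?g s p d e)"
      by (rule sum.swap)
    also have "\<dots> = (\<Sum>s<S. \<Sum>d\<in>D. \<Sum>p\<in>Q s. \<Sum>e\<in>D. ?g s p d e)"
      by (rule sum.cong[OF refl], rule sum.cong[OF refl], rule sum.swap)
    also have "\<dots> = (\<Sum>s<S. \<Sum>p\<in>Q s. \<Sum>d\<in>D. \<Sum>e\<in>D. ?g s p d e)"
      by (rule sum.cong[OF refl], rule sum.swap)
    finally show ?thesis .
  qed
  also have "\<dots> \<le> (\<Sum>s<S. \<Sum>p\<in>Q s. \<Sum>f\<in>E s. \<Sum>g\<in>E s. 1 / real p * (1 / real (lcm f g)))"
  proof (intro sum_mono)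
    fix s p assume sp: "s \<in> {..<S}" "p \<in> Q s"
    have p0: "p > 0" using Qp sp by (auto intro: prime_gt_0_nat)
    let ?Dp = "{d\<in>D. p dvd d}"
    have "(\<Sum>d\<in>D. \<Sum>e\<in>D. ?g s p d e) = (\<Sum>d\<in>?Dp. \<Sum>e\<in>?Dp. 1 / real (lcm d e))"
    proof -
      have "(\<Sum>e\<in>D. ?g s p d e) = (if p dvd d then \<Sum>e\<in>?Dp. 1 / real (lcm d e) else 0)" for d
        using finD by (simp add: sum.inter_filter)
      then have "(\<Sum>d\<in>D. \<Sum>e\<in>D. ?g s p d e) = (\<Sum>d\<in>D. if p dvd d then \<Sum>e\<in>?Dp. 1 / real (lcm d e) else 0)"
        by (simp only:)
      also have "\<dots> = (\<Sum>d\<in>?Dp. \<Sum>e\<in>?Dp. 1 / real (lcm d e))"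
        by (rule sum.inter_filter[OF finD, symmetric])
      finally show ?thesis .
    qed
    also have "\<dots> \<le> (\<Sum>d\<in>(\<lambda>f. p * f) ` E s. \<Sum>e\<in>(\<lambda>f. p * f) ` E s. 1 / real (lcm d e))"
    proof -
      have sub: "?Dp \<subseteq> (\<lambda>f. p * f) ` E s" using in_block[of _ p s] sp by auto
      have "(\<Sum>d\<in>?Dp. \<Sum>e\<in>?Dp. 1 / real (lcm d e)) \<le> (\<Sum>d\<in>?Dp. \<Sum>e\<in>(\<lambda>f. p * f) ` E s. 1 / real (lcm d e))"
        using finQ sub by (intro sum_mono sum_mono2) auto
      also have "\<dots> \<le> (\<Sum>d\<in>(\<lambda>f. p * f) ` E s. \<Sum>e\<in>(\<lambda>f. p * f) ` E s. 1 / real (lcm d e))"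
        using finQ sub by (intro sum_mono2) (auto intro!: sum_nonneg)
      finally show ?thesis .
    qed
    also have "\<dots> = (\<Sum>f\<in>E s. \<Sum>g\<in>E s. 1 / real p * (1 / real (lcm f g)))"
    proof -
      have inj: "inj_on (\<lambda>f. p * f) (E s)" using p0 by (auto simp: inj_on_def)
      show ?thesis by (simp add: sum.reindex[OF inj] lcm_mult_left)
    qed
    finally show "(\<Sum>d\<in>D. \<Sum>e\<in>D. ?g s p d e) \<le> (\<Sum>f\<in>E s. \<Sum>g\<in>E s. 1 / real p * (1 / real (lcm f g)))" .
  qed
  also have "\<dots> \<le> (\<Sum>s<S. C * ((1 + C)\<^sup>2 + (1 + C)))"
  proof (rule sum_mono)
    fix s assume s: "s \<in> {..<S}"
    define \<sigma> where "\<sigma> = recip_sum (Q s)"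
    have \<sigma>: "0 \<le> \<sigma>" "\<sigma> \<le> C" using C(1)[of s] s by (auto simp: \<sigma>_def Q_def recip_sum_nonneg)
    have "1 \<notin> Q s" using Qp by fastforce
    then have E: "recip_sum (E s) = 1 + \<sigma>" using finQ by (simp add: E_def recip_sum_def \<sigma>_def)
    \<comment> \<open>Distinct elements of \<open>E s\<close> are coprime, so only the diagonal
      deviates from a product of two sums.\<close>
    have "(\<Sum>f\<in>E s. \<Sum>g\<in>E s. 1 / real (lcm f g)) \<le> (\<Sum>f\<in>E s. \<Sum>g\<in>E s. 1 / real f * (1 / real g) + (if g = f then 1 / real f else 0))"
    proof (intro sum_mono)
      fix f g assume fg: "f \<in> E s" "g \<in> E s"
      show "1 / real (lcm f g) \<le> 1 / real f * (1 / real g) + (if g = f then 1 / real f else 0)"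
      proof (cases "g = f")
        case False
        then have "coprime f g" using fg Qp by (auto simp: E_def intro: primes_coprime)
        then show ?thesis using False by (simp add: lcm_coprime)
      qed simp
    qed
    also have "\<dots> = recip_sum (E s) * recip_sum (E s) + recip_sum (E s)"
      using finQ by (simp add: sum.distrib sum_product recip_sum_def)
    also have "\<dots> = (1 + \<sigma>)\<^sup>2 + (1 + \<sigma>)" by (simp add: E power2_eq_square)
    also have "\<dots> \<le> (1 + C)\<^sup>2 + (1 + C)" using \<sigma> by (intro add_mono power_mono) auto
    finally have 1: "(\<Sum>f\<in>E s. \<Sum>g\<in>E s. 1 / real (lcm f g)) \<le> (1 + C)\<^sup>2 + (1 + C)" .
    have "(\<Sum>p\<in>Q s. \<Sum>f\<in>E s. \<Sum>g\<in>E s. 1 / real p * (1 / real (lcm f g)))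
      = \<sigma> * (\<Sum>f\<in>E s. \<Sum>g\<in>E s. 1 / real (lcm f g))"
      unfolding \<sigma>_def recip_sum_def sum_distrib_right[of "\<lambda>p. 1 / real p" "Q s"]
      by (simp only: sum_distrib_left)
    also have "\<dots> \<le> C * ((1 + C)\<^sup>2 + (1 + C))"
      using 1 \<sigma> by (intro mult_mono) (auto intro!: sum_nonneg)
    finally show "(\<Sum>p\<in>Q s. \<Sum>f\<in>E s. \<Sum>g\<in>E s. 1 / real p * (1 / real (lcm f g))) \<le> C * ((1 + C)\<^sup>2 + (1 + C))" .
  qed
  finally show ?thesis by simp
qed

lemma sum_disjoint_family_le:
  fixes f :: "nat \<Rightarrow> real"
  assumes "finite D" "finite I" "\<And>i. i \<in> I \<Longrightarrow> X i \<subseteq> D"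
    and "\<And>i j. i \<in> I \<Longrightarrow> j \<in> I \<Longrightarrow> i \<noteq> j \<Longrightarrow> X i \<inter> X j = {}"
    and "\<And>n. f n \<ge> 0"
  shows "(\<Sum>i\<in>I. \<Sum>n\<in>X i. f n) \<le> (\<Sum>n\<in>D. f n)"
proof -
  have "(\<Sum>i\<in>I. \<Sum>n\<in>X i. f n) = (\<Sum>n\<in>(\<Union>i\<in>I. X i). f n)"
    using assms by (intro sum.UNION_disjoint[symmetric]) (auto intro: finite_subset)
  also have "\<dots> \<le> (\<Sum>n\<in>D. f n)"
    using assms by (intro sum_mono2) auto
  finally show ?thesis .
qed

text \<open>The bound \<open>w\<close> will be \<open>ln q\<close>: then all these numbers are
  coprime to the modulus \<open>q\<close> and act as isometries.\<close>

definition almost_primes_above :: "real \<Rightarrow> nat set" where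
  "almost_primes_above w = {p. prime p \<and> w < ln (real p)} \<union>
     {p * p' | p p'. prime p \<and> w < ln (real p) \<and> prime p' \<and> w < ln (real p')}"

text \<open>The window is the logarithmic interval from \<open>v\<close> to \<open>v + R\<close>,
  cut into cells of length \<open>h\<close> that all have to meet \<open>A\<close>. The extra 1 in
  the exponent leaves room for the last cell, which may reach beyond the window.\<close>

definition has_dense_window :: "real \<Rightarrow> real \<Rightarrow> real \<Rightarrow> nat set \<Rightarrow> bool" where
  "has_dense_window h R Y A \<longleftrightarrow> (\<exists>v\<ge>0. exp (v + R + 1) \<le> Y \<and>
     (\<forall>i. real i * h \<le> R \<longrightarrow> (\<exists>n\<in>A. v + real i * h < ln (real n) \<and> ln (real n) \<le> v + real i * h + h)))"

text \<open>
  The divisors come from \<open>S\<close> scales with disjoint sets of primes. Different scales are independent,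
  so the variance grows only linearly in \<open>S\<close>, and a set that spoils all windows of all scales has
  a reciprocal sum of order \<open>S\<close>.
\<close>

lemma exists_window_of_almost_primes:
  fixes h R w :: real
  assumes h: "0 < h" "h \<le> 1" and R: "R \<ge> 0"
  obtains \<eta> C where "\<eta> > 0" "C \<ge> 0"
    "\<And>S. \<exists>N Y. finite N \<and> Y \<ge> 1 \<and>
       (\<forall>n\<in>N. real n \<le> Y \<and> n \<in> almost_primes_above w) \<and>
       (\<forall>D\<subseteq>N. divisor_variance D \<le> C * real S \<and>
         (recip_sum D < \<eta> * real S \<longrightarrow> has_dense_window h R Y (N - D)))"
proof -
  obtain \<theta> c V0 where
    \<theta>: "0 < \<theta>" "\<theta> < 1" and c: "0 < c" and V0: "1 \<le> V0" and cells:
    "\<And>V v. V0 \<le> V \<Longrightarrow> V \<le> v \<Longrightarrow> v \<le> 2 * V \<Longrightarrow>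
      c / V \<le> (\<Sum>n\<in>{n\<in>log_almost_primes (\<theta> * V) (3 * V). v < ln (real n) \<and> ln (real n) \<le> v + h}. 1 / real n)"
    by (rule almost_primes_in_short_intervals[OF h]) (rule that)
  define M where "M = nat \<lfloor>R / h\<rfloor>"
  define l where "l = (real M + 1) * h"
  \<comment> \<open>The bound \<open>2 * l\<close> lets at least \<open>V s / (2 * l)\<close>
    disjoint windows of length \<open>l\<close> fit between \<open>V s\<close> and
    \<open>2 * V s\<close>; \<open>w / \<theta>\<close> pushes all primes above
    \<open>w\<close>.\<close>
  define V1 where "V1 = max (max V0 (2 * l)) (w / \<theta>)"
  \<comment> \<open>The ratio \<open>3 / \<theta>\<close> makes the ranges from
    \<open>\<theta> * V s\<close> to \<open>3 * V s\<close> of distinct scales disjoint.\<close>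
  define V where "V = (\<lambda>s::nat. V1 * (3 / \<theta>) ^ s)"
  \<comment> \<open>One whole cell has reciprocal sum at least \<open>c / V s\<close> by
    \<open>cells\<close>, and a scale has at least \<open>V s / (2 * l)\<close> windows; the product
    \<open>\<eta>\<close> does not depend on \<open>s\<close>.\<close>
  define \<eta> where "\<eta> = c / (2 * l)"
  define C0 where "C0 = 19 / \<theta>"
  define C where "C = C0 * ((1 + C0)\<^sup>2 + (1 + C0))"
  have l: "l > 0" using h by (simp add: l_def)
  have C0: "C0 \<ge> 0" using \<theta> by (simp add: C0_def)
  have V1: "V1 \<ge> V0" "V1 \<ge> 2 * l" "V1 \<ge> w / \<theta>" "V1 \<ge> 1" using V0 by (auto simp: V1_def)
  have "3 / \<theta> \<ge> 1" using \<theta> by simp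
  then have VV1: "V s \<ge> V1" for s
    using V1 mult_left_mono[of 1 "(3 / \<theta>) ^ s" V1] by (simp add: V_def one_le_power)
  have V_mono: "s \<le> t \<Longrightarrow> V s \<le> V t" for s t
    unfolding V_def using V1 \<open>3 / \<theta> \<ge> 1\<close> by (intro mult_left_mono power_increasing) auto
  have V_sep: "3 * V s \<le> \<theta> * V t" if "s < t" for s t
  proof -
    have "3 * V s = \<theta> * V (Suc s)" using \<theta> by (simp add: V_def)
    also have "\<dots> \<le> \<theta> * V t" using that \<theta> by (intro mult_left_mono V_mono) auto
    finally show ?thesis .
  qed
  have index_le: "i \<le> M \<longleftrightarrow> real i * h \<le> R" for i
  proof -
    have "real i * h \<le> R \<longleftrightarrow> real i \<le> R / h" using h by (simp add: field_simps)
    also have "\<dots> \<longleftrightarrow> i \<le> M" using R h by (auto simp: M_def le_nat_iff le_floor_iff)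
    finally show ?thesis by simp
  qed
  have "\<exists>N Y. finite N \<and> Y \<ge> 1 \<and>
       (\<forall>n\<in>N. real n \<le> Y \<and> n \<in> almost_primes_above w) \<and>
       (\<forall>D\<subseteq>N. divisor_variance D \<le> C * real S \<and>
         (recip_sum D < \<eta> * real S \<longrightarrow> has_dense_window h R Y (N - D)))" for S
  proof -
    define N where "N = (\<Union>s<S. log_almost_primes (\<theta> * V s) (3 * V s))"
    define Y where "Y = exp (6 * V S + R + 1)"
    have finN: "finite N" by (auto simp: N_def)
    have Y1: "Y \<ge> 1" using V1(4) VV1[of S] R by (simp add: Y_def)
    have N_props: "real n \<le> Y \<and> n \<in> almost_primes_above w"
      if n: "n \<in> N" for n
    proof -
      obtain s where s: "s < S" "n \<in> log_almost_primes (\<theta> * V s) (3 * V s)"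
        using n by (auto simp: N_def)
      have P: "prime p \<and> 0 < p \<and> w < ln (real p) \<and> ln (real p) \<le> 3 * V S" if p: "p \<in> log_primes (\<theta> * V s) (3 * V s)" for p
      proof -
        have "w \<le> \<theta> * V1" using V1(3) \<theta> by (simp add: pos_divide_le_eq mult.commute)
        also have "\<dots> \<le> \<theta> * V s" using VV1 \<theta> by (intro mult_left_mono) auto
        also have "\<dots> < ln (real p)" using p by (simp add: log_primes_def)
        finally show ?thesis using p V_mono[of s S] s(1) by (auto simp: log_primes_def prime_gt_0_nat)
      qed
      have V0S: "V S \<ge> 0" using VV1[of S] V1 by simp
      from s(2) consider "n \<in> log_primes (\<theta> * V s) (3 * V s)"
        | p q where "n = p * q" "p \<in> log_primes (\<theta> * V s) (3 * V s)" "q \<in> log_primes (\<theta> * V s) (3 * V s)"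
        by (auto simp: log_almost_primes_def)
      then show ?thesis
      proof cases
        case 1
        have "ln (real n) \<le> 6 * V S + R + 1" using P[OF 1] V0S R by linarith
        then have "real n \<le> Y" using P[OF 1] by (simp add: Y_def ln_le_iff_le_exp)
        with P[OF 1] show ?thesis by (auto simp: almost_primes_above_def)
      next
        case 2
        note p = P[OF 2(2)] and q = P[OF 2(3)]
        have "ln (real n) = ln (real p) + ln (real q)" using 2 p q by (simp add: ln_mult)
        then have "ln (real n) \<le> 6 * V S + R + 1" using p q V0S R by linarith
        moreover have "n > 0" using 2 p q by simp
        ultimately have "real n \<le> Y" by (simp add: Y_def ln_le_iff_le_exp)
        with 2 p q show ?thesis by (auto simp: almost_primes_above_def)
      qed
    qed
    have var: "divisor_variance D \<le> C * real S" if "D \<subseteq> N" for D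
    proof -
      have "divisor_variance D \<le> real S * (C0 * ((1 + C0)\<^sup>2 + (1 + C0)))"
      proof (rule divisor_variance_almost_primes)
        show "D \<subseteq> (\<Union>s<S. log_almost_primes (\<theta> * V s) (3 * V s))" using that by (simp add: N_def)
        fix s t assume "s < S" "t < S" "s \<noteq> t"
        then show "log_primes (\<theta> * V s) (3 * V s) \<inter> log_primes (\<theta> * V t) (3 * V t) = {}"
          using V_sep[of s t] V_sep[of t s] by (cases "s < t") (auto simp: log_primes_def)
      next
        fix s
        show "recip_sum (log_primes (\<theta> * V s) (3 * V s)) \<le> C0"
          unfolding recip_sum_def C0_def using \<theta> V1(4) VV1[of s] by (intro sum_inverse_log_primes_le) auto
      qed (rule C0)
      then show ?thesis by (simp add: C_def mult.commute)
    qed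
    have window: "has_dense_window h R Y (N - D)"
      if D: "D \<subseteq> N" "recip_sum D < \<eta> * real S" for D
    proof (rule ccontr)
      assume neg: "\<not> ?thesis"
      define J where "J = (\<lambda>s. nat \<lfloor>V s / l\<rfloor>)"
      define cell where "cell = (\<lambda>s v. {n\<in>log_almost_primes (\<theta> * V s) (3 * V s). v < ln (real n) \<and> ln (real n) \<le> v + h})"
      have finD: "finite D" using D finN finite_subset by blast
      have Jl: "real j * l + l \<le> V s" if "j < J s" for j s
      proof -
        have "real j + 1 \<le> real (J s)" using that by simp
        also have "\<dots> \<le> V s / l" unfolding J_def using VV1[of s] V1 l by (intro of_nat_floor) auto
        finally have "(real j + 1) * l \<le> V s" using l by (simp add: field_simps)
        then show ?thesis by (simp add: algebra_simps)
      qed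
      \<comment> \<open>If no cell of some window lay inside \<open>D\<close>, this window would be
        dense in \<open>N - D\<close>; hence \<open>D\<close> swallows a whole cell of every
        window.\<close>
      have "\<exists>i\<le>M. cell s (V s + real j * l + real i * h) \<subseteq> D" if s: "s < S" and j: "j < J s" for s j
      proof (rule ccontr)
        assume no: "\<not> (\<exists>i\<le>M. cell s (V s + real j * l + real i * h) \<subseteq> D)"
        define v where "v = V s + real j * l"
        have "v \<ge> 0" using VV1[of s] V1 l by (simp add: v_def)
        moreover have "exp (v + R + 1) \<le> Y"
        proof -
          have "v \<le> 2 * V s" using Jl[OF j] l by (simp add: v_def)
          also have "\<dots> \<le> 6 * V S" using V_mono[of s S] s VV1[of S] V1 by simp
          finally show ?thesis by (simp add: Y_def)
        qed
        moreover have "\<exists>n\<in>N - D. v + real i * h < ln (real n) \<and> ln (real n) \<le> v + real i * h + h"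
          if i: "real i * h \<le> R" for i
        proof -
          have "\<not> cell s (v + real i * h) \<subseteq> D" using no i index_le unfolding v_def by blast
          then show ?thesis using s by (auto simp: cell_def N_def)
        qed
        ultimately show False using neg unfolding has_dense_window_def by blast
      qed
      then obtain i where i: "\<And>s j. s < S \<Longrightarrow> j < J s \<Longrightarrow> i s j \<le> M \<and> cell s (V s + real j * l + real (i s j) * h) \<subseteq> D"
        by metis
      define X where "X = (\<lambda>s j. cell s (V s + real j * l + real (i s j) * h))"
      define Ds where "Ds = (\<lambda>s. {n\<in>D. V s < ln (real n) \<and> ln (real n) \<le> 2 * V s})"
      have ih: "real (i s j) * h + h \<le> l" if "s < S" "j < J s" for s j
      proof -
        have "real (i s j) \<le> real M" using i[OF that] by simp
        then show ?thesis using h mult_right_mono[of "real (i s j)" "real M" h] by (simp add: l_def algebra_simps)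
      qed
      have X_loc: "V s + real j * l < ln (real n) \<and> ln (real n) \<le> V s + real j * l + l"
        if "s < S" "j < J s" "n \<in> X s j" for s j n
      proof -
        have "0 \<le> real (i s j) * h" using h by simp
        moreover have "V s + real j * l + real (i s j) * h < ln (real n)"
          "ln (real n) \<le> V s + real j * l + real (i s j) * h + h"
          using that(3) by (auto simp: X_def cell_def)
        ultimately show ?thesis using ih[OF that(1,2)] by linarith
      qed
      have block: "\<eta> \<le> (\<Sum>n\<in>Ds s. 1 / real n)" if s: "s < S" for s
      proof -
        have "real (J s) \<ge> V s / (2 * l)"
        proof -
          have "V s / l \<ge> 2" using VV1[of s] V1(2) l by (simp add: pos_le_divide_eq)
          moreover have "real (J s) > V s / l - 1"
            unfolding J_def using \<open>V s / l \<ge> 2\<close> by linarith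
          moreover have "x / 2 \<le> y" if "2 \<le> x" "x - 1 < y" for x y :: real using that by linarith
          ultimately have "real (J s) \<ge> (V s / l) / 2" by blast
          then show ?thesis by (simp add: mult.commute)
        qed
        then have "\<eta> \<le> real (J s) * (c / V s)"
          using mult_right_mono[of "V s / (2 * l)" "real (J s)" "c / V s"] c VV1[of s] V1(4) l
          by (simp add: \<eta>_def)
        also have "\<dots> = (\<Sum>j<J s. c / V s)" by simp
        also have "\<dots> \<le> (\<Sum>j<J s. \<Sum>n\<in>X s j. 1 / real n)"
        proof (rule sum_mono)
          fix j assume "j \<in> {..<J s}"
          then have j: "j < J s" by simp
          show "c / V s \<le> (\<Sum>n\<in>X s j. 1 / real n)"
            unfolding X_def cell_def
          proof (rule cells)
            have "0 \<le> real (i s j) * h" "0 \<le> real j * l" using h l by auto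
            then show "V s \<le> V s + real j * l + real (i s j) * h" by linarith
            show "V s + real j * l + real (i s j) * h \<le> 2 * V s"
              using Jl[OF j] ih[OF s j] h by linarith
          qed (use V1 VV1[of s] in auto)
        qed
        also have "\<dots> \<le> (\<Sum>n\<in>Ds s. 1 / real n)"
        proof (rule sum_disjoint_family_le)
          fix j assume "j \<in> {..<J s}"
          then have j: "j < J s" by simp
          show "X s j \<subseteq> Ds s"
          proof
            fix n assume n: "n \<in> X s j"
            have "n \<in> D" using n i[OF s j] by (auto simp: X_def)
            moreover have "0 \<le> real j * l" using l by simp
            moreover from this have "V s < ln (real n)" "ln (real n) \<le> 2 * V s"
              using X_loc[OF s j n] Jl[OF j] by linarith+
            ultimately show "n \<in> Ds s" by (simp add: Ds_def)
          qed
        next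
          fix j k assume "j \<in> {..<J s}" "k \<in> {..<J s}" "j \<noteq> k"
          then have jk: "j < J s" "k < J s" "j \<noteq> k" by auto
          have sep: "real a * l + l \<le> real b * l" if "a < b" for a b :: nat
            using that l mult_right_mono[of "real a + 1" "real b" l] by (simp add: algebra_simps)
          show "X s j \<inter> X s k = {}"
          proof (rule ccontr)
            assume "X s j \<inter> X s k \<noteq> {}"
            then obtain n where n: "n \<in> X s j" "n \<in> X s k" by blast
            have "j < k \<or> k < j" using jk(3) by linarith
            then show False
            proof
              assume "j < k"
              from sep[OF this] X_loc[OF s jk(1) n(1)] X_loc[OF s jk(2) n(2)] show False by linarith
            next
              assume "k < j"
              from sep[OF this] X_loc[OF s jk(1) n(1)] X_loc[OF s jk(2) n(2)] show False by linarith
            qed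
          qed
        qed (use finD in \<open>auto simp: Ds_def\<close>)
        finally show ?thesis .
      qed
      have "\<eta> * real S = (\<Sum>s<S. \<eta>)" by simp
      also have "\<dots> \<le> (\<Sum>s<S. \<Sum>n\<in>Ds s. 1 / real n)" using block by (intro sum_mono) auto
      also have "\<dots> \<le> (\<Sum>n\<in>D. 1 / real n)"
      proof (rule sum_disjoint_family_le)
        fix s t :: nat assume "s \<noteq> t"
        have sep: "2 * V a < V b" if "a < b" for a b
        proof -
          have "\<theta> * V b \<le> 1 * V b" using \<theta> VV1[of b] V1 by (intro mult_right_mono) auto
          then show ?thesis using V_sep[OF that] VV1[of a] V1 by linarith
        qed
        show "Ds s \<inter> Ds t = {}"
          using sep[of s t] sep[of t s] \<open>s \<noteq> t\<close> by (cases "s < t") (auto simp: Ds_def)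
      qed (use finD in \<open>auto simp: Ds_def\<close>)
      finally show False using D(2) by (simp add: recip_sum_def)
    qed
    show ?thesis
    proof (intro exI conjI ballI allI impI)
      show "finite N" by (rule finN)
      show "1 \<le> Y" by (rule Y1)
      fix n assume "n \<in> N"
      then show "real n \<le> Y" "n \<in> almost_primes_above w" using N_props by auto
    next
      fix D assume "D \<subseteq> N"
      then show "divisor_variance D \<le> C * real S" by (rule var)
    next
      fix D assume "D \<subseteq> N" "recip_sum D < \<eta> * real S"
      then show "has_dense_window h R Y (N - D)" by (rule window)
    qed
  qed
  moreover have "\<eta> > 0" "C \<ge> 0" using c l C0 by (auto simp: \<eta>_def C_def)
  ultimately show ?thesis by (intro that[of \<eta> C])
qed

section \<open>Mean values of multiplicative operators\<close>

text \<open>Functions that vanish almost everywhere have norm 0 without being 0, hence a semi-inner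
  product on a subspace. It will be the real part of the complex one, which has the same norm and
  suffices for convexity and projections.\<close>

locale semi_inner =
  fixes V :: "'v::real_vector set" and ip :: "'v \<Rightarrow> 'v \<Rightarrow> real"
  assumes subspace_V: "subspace V"
    and ip_commute: "x \<in> V \<Longrightarrow> y \<in> V \<Longrightarrow> ip x y = ip y x"
    and ip_add_left: "x \<in> V \<Longrightarrow> y \<in> V \<Longrightarrow> z \<in> V \<Longrightarrow> ip (x + y) z = ip x z + ip y z"
    and ip_scale_left: "x \<in> V \<Longrightarrow> y \<in> V \<Longrightarrow> ip (r *\<^sub>R x) y = r * ip x y"
    and ip_nonneg: "x \<in> V \<Longrightarrow> 0 \<le> ip x x"
begin

definition nrm :: "'v \<Rightarrow> real" where "nrm x = sqrt (ip x x)"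

lemma V_add [simp, intro]: "x \<in> V \<Longrightarrow> y \<in> V \<Longrightarrow> x + y \<in> V"
  and V_diff [simp, intro]: "x \<in> V \<Longrightarrow> y \<in> V \<Longrightarrow> x - y \<in> V"
  and V_scale [simp, intro]: "x \<in> V \<Longrightarrow> r *\<^sub>R x \<in> V"
  and V_0 [simp, intro]: "0 \<in> V"
  using subspace_V by (auto intro: subspace_add subspace_diff subspace_scale subspace_0)

lemma V_sum [simp, intro]: "(\<And>i. i \<in> I \<Longrightarrow> f i \<in> V) \<Longrightarrow> (\<Sum>i\<in>I. f i) \<in> V"
  using subspace_V by (intro subspace_sum)

lemma ip_diff_left: "x \<in> V \<Longrightarrow> y \<in> V \<Longrightarrow> z \<in> V \<Longrightarrow> ip (x - y) z = ip x z - ip y z"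
  using ip_add_left[of "x - y" y z] by simp

lemma ip_0_left [simp]: "x \<in> V \<Longrightarrow> ip 0 x = 0"
  using ip_scale_left[of x x 0] by simp

lemma ip_add_right: "x \<in> V \<Longrightarrow> y \<in> V \<Longrightarrow> z \<in> V \<Longrightarrow> ip z (x + y) = ip z x + ip z y"
  by (metis V_add ip_add_left ip_commute)

lemma ip_diff_right: "x \<in> V \<Longrightarrow> y \<in> V \<Longrightarrow> z \<in> V \<Longrightarrow> ip z (x - y) = ip z x - ip z y"
  by (metis V_diff ip_diff_left ip_commute)

lemma ip_scale_right: "x \<in> V \<Longrightarrow> y \<in> V \<Longrightarrow> ip y (r *\<^sub>R x) = r * ip y x"
  by (metis V_scale ip_scale_left ip_commute)

lemma ip_sum_left:
  assumes "finite I" "\<And>i. i \<in> I \<Longrightarrow> f i \<in> V" "z \<in> V"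
  shows "ip (\<Sum>i\<in>I. f i) z = (\<Sum>i\<in>I. ip (f i) z)"
  using assms by (induction I rule: finite_induct) (auto simp: ip_add_left)

lemma nrm_nonneg [simp]: "0 \<le> nrm x" if "x \<in> V"
  using that by (simp add: nrm_def ip_nonneg)

lemma nrm_sq: "x \<in> V \<Longrightarrow> (nrm x)\<^sup>2 = ip x x"
  by (simp add: nrm_def ip_nonneg)

lemma nrm_0 [simp]: "nrm 0 = 0"
  by (simp add: nrm_def)

lemma nrm_scale: "x \<in> V \<Longrightarrow> nrm (r *\<^sub>R x) = \<bar>r\<bar> * nrm x"
  by (simp add: nrm_def ip_scale_left ip_scale_right mult.assoc[symmetric] real_sqrt_mult)

lemma nrm_sq_diff:
  assumes "x \<in> V" "y \<in> V"
  shows "(nrm (x - y))\<^sup>2 = (nrm x)\<^sup>2 - 2 * ip x y + (nrm y)\<^sup>2"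
  using assms ip_commute[of y x] by (simp add: nrm_sq ip_diff_left ip_diff_right)

lemma Cauchy_Schwarz:
  assumes "x \<in> V" "y \<in> V"
  shows "\<bar>ip x y\<bar> \<le> nrm x * nrm y"
proof -
  have q: "0 \<le> (nrm x)\<^sup>2 - 2 * t * ip x y + t\<^sup>2 * (nrm y)\<^sup>2" for t
  proof -
    have "(nrm (x - t *\<^sub>R y))\<^sup>2 = (nrm x)\<^sup>2 - 2 * (t * ip x y) + t\<^sup>2 * (nrm y)\<^sup>2"
      using assms by (simp add: nrm_sq_diff ip_scale_right nrm_scale power_mult_distrib)
    moreover have "0 \<le> (nrm (x - t *\<^sub>R y))\<^sup>2" by simp
    ultimately show ?thesis by simp
  qed
  have "(ip x y)\<^sup>2 \<le> (nrm x * nrm y)\<^sup>2"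
  proof (cases "nrm y = 0")
    case True
    have "ip x y = 0"
    proof (rule ccontr)
      assume n: "ip x y \<noteq> 0"
      \<comment> \<open>With \<open>nrm y = 0\<close> the quadratic in \<open>t\<close> is affine,
        and this \<open>t\<close> gives it the value -1.\<close>
      from q[of "((nrm x)\<^sup>2 + 1) / (2 * ip x y)"] n True show False by simp
    qed
    then show ?thesis by simp
  next
    case False
    then have "0 < (nrm y)\<^sup>2" by simp
    from q[of "ip x y / (nrm y)\<^sup>2"] this False
    have "0 \<le> (nrm x)\<^sup>2 - (ip x y)\<^sup>2 / (nrm y)\<^sup>2"
      by (simp add: power2_eq_square)
    then have "(ip x y)\<^sup>2 / (nrm y)\<^sup>2 \<le> (nrm x)\<^sup>2" by simp
    then show ?thesis using \<open>0 < (nrm y)\<^sup>2\<close> by (simp add: pos_divide_le_eq power_mult_distrib)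
  qed
  then have "\<bar>ip x y\<bar> \<le> \<bar>nrm x * nrm y\<bar>" by (simp add: abs_le_square_iff)
  then show ?thesis using assms by (simp add: abs_mult)
qed

lemma nrm_triangle:
  assumes "x \<in> V" "y \<in> V"
  shows "nrm (x + y) \<le> nrm x + nrm y"
proof (rule power2_le_imp_le)
  have "(nrm (x + y))\<^sup>2 = (nrm x)\<^sup>2 + 2 * ip x y + (nrm y)\<^sup>2"
    using assms ip_commute[of y x] by (simp add: nrm_sq ip_add_left ip_add_right)
  also have "\<dots> \<le> (nrm x)\<^sup>2 + 2 * (nrm x * nrm y) + (nrm y)\<^sup>2"
    using Cauchy_Schwarz[OF assms] by simp
  also have "\<dots> = (nrm x + nrm y)\<^sup>2" by (simp add: power2_sum)
  finally show "(nrm (x + y))\<^sup>2 \<le> (nrm x + nrm y)\<^sup>2" .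
qed (use assms in simp)

lemma nrm_minus_commute: "x \<in> V \<Longrightarrow> y \<in> V \<Longrightarrow> nrm (x - y) = nrm (y - x)"
  using nrm_scale[of "x - y" "-1"] by simp

lemma nrm_triangle_sub:
  assumes "x \<in> V" "y \<in> V" "z \<in> V"
  shows "nrm (x - z) \<le> nrm (x - y) + nrm (y - z)"
  using nrm_triangle[of "x - y" "y - z"] assms by simp

lemma nrm_le_add_diff: "x \<in> V \<Longrightarrow> y \<in> V \<Longrightarrow> nrm x \<le> nrm y + nrm (x - y)"
  using nrm_triangle[of y "x - y"] by simp

lemma nrm_diff_le: "x \<in> V \<Longrightarrow> y \<in> V \<Longrightarrow> nrm (x - y) \<le> nrm x + nrm y"
  using nrm_triangle[of x "(-1) *\<^sub>R y"] nrm_scale[of y "-1"] V_scale[of y "-1"] by simp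

lemma nrm_sum_le:
  assumes "finite I" "\<And>i. i \<in> I \<Longrightarrow> f i \<in> V"
  shows "nrm (\<Sum>i\<in>I. f i) \<le> (\<Sum>i\<in>I. nrm (f i))"
  using assms
proof (induction I rule: finite_induct)
  case (insert i I)
  have "nrm (f i + (\<Sum>i\<in>I. f i)) \<le> nrm (f i) + nrm (\<Sum>i\<in>I. f i)"
    using insert by (intro nrm_triangle) auto
  with insert show ?case by simp
qed simp

end

text \<open>
  The map \<open>U n\<close> models \<open>F \<mapsto> chi(n) S\<^sub>n F\<close> for a Dirichlet character modulo \<open>q\<close>.
\<close>

locale multiplicative_operators = semi_inner V ip
  for V :: "'v::real_vector set" and ip +
  fixes U :: "nat \<Rightarrow> 'v \<Rightarrow> 'v" and q :: nat
  assumes q_pos: "q > 0"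
    and U_linear: "n > 0 \<Longrightarrow> linear (U n)"
    and U_in_V: "n > 0 \<Longrightarrow> x \<in> V \<Longrightarrow> U n x \<in> V"
    and U_mult: "m > 0 \<Longrightarrow> n > 0 \<Longrightarrow> U (m * n) x = U m (U n x)"
    and U_isometry: "n > 0 \<Longrightarrow> coprime n q \<Longrightarrow> x \<in> V \<Longrightarrow> y \<in> V \<Longrightarrow> ip (U n x) (U n y) = ip x y"
    and U_vanish: "n > 0 \<Longrightarrow> \<not> coprime n q \<Longrightarrow> U n x = 0"
    and finite_U: "finite {U p | p. prime p}"
begin

lemma nrm_U_le: "n > 0 \<Longrightarrow> x \<in> V \<Longrightarrow> nrm (U n x) \<le> nrm x"
  by (cases "coprime n q") (auto simp: nrm_def U_isometry U_vanish ip_nonneg)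

lemma nrm_U: "n > 0 \<Longrightarrow> coprime n q \<Longrightarrow> x \<in> V \<Longrightarrow> nrm (U n x) = nrm x"
  by (simp add: nrm_def U_isometry)

lemma U_diff: "n > 0 \<Longrightarrow> U n (x - y) = U n x - U n y"
  using U_linear linear_diff by blast

lemma U_scale: "n > 0 \<Longrightarrow> U n (r *\<^sub>R x) = r *\<^sub>R U n x"
  using U_linear linear_scale by blast

lemma U_sum: "n > 0 \<Longrightarrow> U n (\<Sum>i\<in>I. f i) = (\<Sum>i\<in>I. U n (f i))"
  using U_linear linear_sum by blast

lemma U_commute: "m > 0 \<Longrightarrow> n > 0 \<Longrightarrow> U m (U n x) = U n (U m x)"
  using U_mult[of m n x] U_mult[of n m x] by (simp add: mult.commute)

text \<open>Division by the real number \<open>x\<close> instead of the number of terms makes the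
  sum over the multiples of \<open>d\<close> exactly \<open>x / d\<close> times
  \<open>U d (avg (x / d) F)\<close>.\<close>

definition avg :: "real \<Rightarrow> 'v \<Rightarrow> 'v" where
  "avg x F = (1 / x) *\<^sub>R (\<Sum>n\<in>nats_le x. U n F)"

lemma avg_in_V [simp, intro]: "F \<in> V \<Longrightarrow> avg x F \<in> V"
  unfolding avg_def by (intro V_scale V_sum U_in_V) (auto simp: mem_nats_le)

lemma nrm_sum_U_le:
  assumes "F \<in> V" "finite A" "\<And>n. n \<in> A \<Longrightarrow> n > 0"
  shows "nrm (\<Sum>n\<in>A. c n *\<^sub>R U n F) \<le> (\<Sum>n\<in>A. \<bar>c n\<bar>) * nrm F"
proof -
  have "nrm (\<Sum>n\<in>A. c n *\<^sub>R U n F) \<le> (\<Sum>n\<in>A. nrm (c n *\<^sub>R U n F))"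
    using assms by (intro nrm_sum_le V_scale U_in_V) auto
  also have "\<dots> \<le> (\<Sum>n\<in>A. \<bar>c n\<bar> * nrm F)"
    using assms by (intro sum_mono) (auto simp: nrm_scale U_in_V intro!: mult_left_mono nrm_U_le)
  finally show ?thesis by (simp add: sum_distrib_right)
qed

lemma nrm_avg_le:
  assumes "F \<in> V" "x > 0"
  shows "nrm (avg x F) \<le> nrm F"
proof -
  have "nrm (\<Sum>n\<in>nats_le x. 1 *\<^sub>R U n F) \<le> (\<Sum>n\<in>nats_le x. \<bar>1\<bar>) * nrm F"
    using assms by (intro nrm_sum_U_le) (auto simp: mem_nats_le)
  also have "\<dots> \<le> x * nrm F"
    using assms card_nats_le_bounds(1)[of x] by (simp add: mult_right_mono)
  finally have "nrm (\<Sum>n\<in>nats_le x. U n F) \<le> x * nrm F" by simp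
  moreover have "(\<Sum>n\<in>nats_le x. U n F) \<in> V"
    using assms by (intro V_sum U_in_V) (auto simp: mem_nats_le)
  ultimately show ?thesis using assms by (simp add: avg_def nrm_scale field_simps)
qed

lemma avg_U: "d > 0 \<Longrightarrow> avg x (U d F) = U d (avg x F)"
proof -
  assume d: "d > 0"
  have "(\<Sum>n\<in>nats_le x. U n (U d F)) = (\<Sum>n\<in>nats_le x. U d (U n F))"
    using d by (intro sum.cong refl U_commute) (auto simp: mem_nats_le)
  then show ?thesis using d by (simp add: avg_def U_scale U_sum)
qed

lemma avg_diff: "avg x (F - G) = avg x F - avg x G"
proof -
  have "(\<Sum>n\<in>nats_le x. U n (F - G)) = (\<Sum>n\<in>nats_le x. U n F - U n G)"
    by (intro sum.cong refl) (auto simp: mem_nats_le U_diff)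
  then show ?thesis by (simp add: avg_def sum_subtractf scaleR_diff_right)
qed

lemma sum_U_multiples:
  assumes "x > 0" "d > 0"
  shows "(\<Sum>n\<in>{n\<in>nats_le x. d dvd n}. U n F) = (x / real d) *\<^sub>R U d (avg (x / real d) F)"
proof -
  have "(\<Sum>n\<in>{n\<in>nats_le x. d dvd n}. U n F) = (\<Sum>m\<in>nats_le (x / real d). U (d * m) F)"
    by (rule sum_multiples_nats_le[OF assms(2)])
  also have "\<dots> = (\<Sum>m\<in>nats_le (x / real d). U d (U m F))"
    using assms by (intro sum.cong refl U_mult) (auto simp: mem_nats_le)
  also have "\<dots> = (x / real d) *\<^sub>R U d (avg (x / real d) F)"
    using assms by (simp add: avg_def U_scale U_sum)
  finally show ?thesis .
qed

text \<open>Both vectors are normalized sums of \<open>U n F\<close> over \<open>n \<le> x\<close>,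
  one with the constant weight \<open>recip_sum D\<close>, the other with the weight
  \<open>num_divisors_in D n\<close>. As each \<open>U n\<close> is a contraction, the mean absolute
  difference of the weights bounds the distance.\<close>

lemma avg_turan_kubilius:
  assumes F: "F \<in> V" and D: "finite D" "\<And>d. d \<in> D \<Longrightarrow> d > 0" and x: "x > 0"
  shows "nrm (recip_sum D *\<^sub>R avg x F - (\<Sum>d\<in>D. (1 / real d) *\<^sub>R U d (avg (x / real d) F)))
    \<le> nrm F * sqrt (divisor_variance D + 2 * recip_sum D * real (card D) / x)"
proof -
  let ?N = "nats_le x"
  have "(\<Sum>d\<in>D. (1 / real d) *\<^sub>R U d (avg (x / real d) F)) = (1 / x) *\<^sub>R (\<Sum>d\<in>D. (x / real d) *\<^sub>R U d (avg (x / real d) F))"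
    using x by (simp add: scaleR_sum_right)
  also have "(\<Sum>d\<in>D. (x / real d) *\<^sub>R U d (avg (x / real d) F)) = (\<Sum>d\<in>D. \<Sum>n\<in>{n\<in>?N. d dvd n}. U n F)"
    using D x by (intro sum.cong refl sum_U_multiples[symmetric]) auto
  also have "\<dots> = (\<Sum>d\<in>D. \<Sum>n\<in>?N. (of_bool (d dvd n) :: real) *\<^sub>R U n F)"
  proof (rule sum.cong[OF refl])
    fix d
    have "(of_bool (d dvd n) :: real) *\<^sub>R U n F = (if d dvd n then U n F else 0)" for n by simp
    then show "(\<Sum>n\<in>{n\<in>?N. d dvd n}. U n F) = (\<Sum>n\<in>?N. (of_bool (d dvd n) :: real) *\<^sub>R U n F)"
      by (simp only: sum.inter_filter[OF finite_nats_le])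
  qed
  also have "\<dots> = (\<Sum>n\<in>?N. num_divisors_in D n *\<^sub>R U n F)"
    unfolding num_divisors_in_def scaleR_sum_left by (rule sum.swap)
  finally have eq: "recip_sum D *\<^sub>R avg x F - (\<Sum>d\<in>D. (1 / real d) *\<^sub>R U d (avg (x / real d) F))
      = (1 / x) *\<^sub>R (\<Sum>n\<in>?N. (recip_sum D - num_divisors_in D n) *\<^sub>R U n F)"
    by (simp add: avg_def scaleR_left_diff_distrib sum_subtractf scaleR_sum_right scaleR_diff_right mult.commute)
  have inV: "(\<Sum>n\<in>?N. (recip_sum D - num_divisors_in D n) *\<^sub>R U n F) \<in> V"
    using F by (intro V_sum V_scale U_in_V) (auto simp: mem_nats_le)
  have "nrm (\<Sum>n\<in>?N. (recip_sum D - num_divisors_in D n) *\<^sub>R U n F)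
      \<le> (\<Sum>n\<in>?N. \<bar>recip_sum D - num_divisors_in D n\<bar>) * nrm F"
    using F by (intro nrm_sum_U_le) (auto simp: mem_nats_le)
  also have "(\<Sum>n\<in>?N. \<bar>recip_sum D - num_divisors_in D n\<bar>) = (\<Sum>n\<in>?N. \<bar>num_divisors_in D n - recip_sum D\<bar>)"
    by (intro sum.cong refl) (rule abs_minus_commute)
  also have "\<dots> * nrm F \<le> (x * sqrt (divisor_variance D + 2 * recip_sum D * real (card D) / x)) * nrm F"
    using F D x by (intro mult_right_mono turan_kubilius_L1) auto
  finally show ?thesis using x inV unfolding eq by (simp add: nrm_scale field_simps)
qed

text \<open>At most \<open>x - y + 1\<close> new terms appear, and the change of the normalization
  from \<open>1 / y\<close> to \<open>1 / x\<close> costs another \<open>x - y\<close>, both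
  relative to \<open>x\<close>.\<close>

lemma avg_Lipschitz:
  assumes F: "F \<in> V" and xy: "0 < y" "y \<le> x"
  shows "nrm (avg x F - avg y F) \<le> nrm F * ((2 * (x - y) + 1) / x)"
proof -
  let ?A = "nats_le x - nats_le y" and ?B = "nats_le y"
  have sub: "?B \<subseteq> nats_le x" using xy by (intro nats_le_mono)
  have V1: "(\<Sum>n\<in>nats_le z. U n F) \<in> V" "(\<Sum>n\<in>?A. U n F) \<in> V" for z
    using F by (auto intro!: V_sum U_in_V simp: mem_nats_le)
  have nrm1: "nrm (\<Sum>n\<in>A. U n F) \<le> real (card A) * nrm F" if "finite A" "\<And>n. n \<in> A \<Longrightarrow> n > 0" for A
    using nrm_sum_U_le[OF F that, of "\<lambda>_. 1"] by simp
  have "(\<Sum>n\<in>nats_le x. U n F) = (\<Sum>n\<in>?A. U n F) + (\<Sum>n\<in>?B. U n F)"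
    using sub by (simp add: sum.subset_diff)
  then have "avg x F - avg y F = (1 / x) *\<^sub>R (\<Sum>n\<in>?A. U n F) - (1 / y - 1 / x) *\<^sub>R (\<Sum>n\<in>?B. U n F)"
    by (simp add: avg_def algebra_simps)
  then have "nrm (avg x F - avg y F) \<le> nrm ((1 / x) *\<^sub>R (\<Sum>n\<in>?A. U n F)) + nrm ((1 / y - 1 / x) *\<^sub>R (\<Sum>n\<in>?B. U n F))"
    using V1 by (simp only:) (intro nrm_diff_le V_scale; simp)
  also have "\<dots> \<le> (1 / x) * (real (card ?A) * nrm F) + (1 / y - 1 / x) * (real (card ?B) * nrm F)"
  proof (rule add_mono)
    show "nrm ((1 / x) *\<^sub>R (\<Sum>n\<in>?A. U n F)) \<le> (1 / x) * (real (card ?A) * nrm F)"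
      using nrm1[of ?A] V1 xy by (simp add: nrm_scale mem_nats_le divide_right_mono)
    have "0 \<le> 1 / y - 1 / x" using xy by (simp add: field_simps)
    then show "nrm ((1 / y - 1 / x) *\<^sub>R (\<Sum>n\<in>?B. U n F)) \<le> (1 / y - 1 / x) * (real (card ?B) * nrm F)"
      using nrm1[of ?B] V1 unfolding nrm_scale[OF V1(1)] by (simp add: mem_nats_le mult_left_mono)
  qed
  also have "\<dots> \<le> (1 / x) * ((x - y + 1) * nrm F) + (1 / y - 1 / x) * (y * nrm F)"
  proof (intro add_mono mult_left_mono mult_right_mono)
    have "card ?A = card (nats_le x) - card ?B" using sub by (simp add: card_Diff_subset)
    moreover have "card ?B \<le> card (nats_le x)" using sub by (simp add: card_mono)
    ultimately have "real (card ?A) = real (card (nats_le x)) - real (card ?B)" by simp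
    then show "real (card ?A) \<le> x - y + 1"
      using card_nats_le_bounds[of x] card_nats_le_bounds[of y] xy by simp
    show "real (card ?B) \<le> y" using card_nats_le_bounds[of y] xy by simp
  qed (use F xy in \<open>auto simp: field_simps\<close>)
  also have "\<dots> = nrm F * ((2 * (x - y) + 1) / x)" using xy by (simp add: field_simps)
  finally show ?thesis .
qed

end

text \<open>From \<open>i\<close>, pass to the last index of the same colour, at cost
  \<open>a\<close>, and then to its successor, at cost \<open>b\<close>. That colour never returns,
  so at most \<open>card W\<close> such moves reach \<open>n\<close>, however long the chain
  is.\<close>

lemma chain_of_colors:
  fixes d :: "nat \<Rightarrow> nat \<Rightarrow> real" and col :: "nat \<Rightarrow> 'c"
  assumes W: "finite W" "\<And>i. i \<le> n \<Longrightarrow> col i \<in> W"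
    and tri: "\<And>i j k. i \<le> n \<Longrightarrow> j \<le> n \<Longrightarrow> k \<le> n \<Longrightarrow> d i k \<le> d i j + d j k"
    and same: "\<And>i j. i \<le> n \<Longrightarrow> j \<le> n \<Longrightarrow> col i = col j \<Longrightarrow> d i j \<le> a"
    and adj: "\<And>i. i < n \<Longrightarrow> d i (Suc i) \<le> b"
    and b: "0 \<le> b" and i: "i \<le> n"
  shows "d i n \<le> real (card W) * (a + b)"
proof -
  have "i \<le> n \<Longrightarrow> col ` {i..n} \<subseteq> W \<Longrightarrow> d i n \<le> real (card W) * (a + b)" for i
    using W(1)
  proof (induction "card W" arbitrary: W i rule: less_induct)
    case less
    have a: "0 \<le> a"
      using tri[of i i i] same[of i i] less.prems by simp
    have iW: "col i \<in> W" using less.prems by auto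
    define j where "j = Max {k\<in>{i..n}. col k = col i}"
    have j: "j \<in> {k\<in>{i..n}. col k = col i}"
      unfolding j_def using less.prems by (intro Max_in) auto
    have after_j: "col k \<noteq> col i" if "j < k" "k \<le> n" for k
    proof
      assume "col k = col i"
      then have "k \<le> j" unfolding j_def using that j by (intro Max_ge) auto
      with that show False by simp
    qed
    have cW: "card W \<ge> 1" using iW less.prems by (simp add: Suc_le_eq card_gt_0_iff) blast
    show ?case
    proof (cases "j = n")
      case True
      then have "d i n \<le> a" using same[of i n] j less.prems by auto
      also have "\<dots> \<le> 1 * (a + b)" using b by simp
      also have "\<dots> \<le> real (card W) * (a + b)" using cW a b by (intro mult_right_mono) auto
      finally show ?thesis .
    next
      case False
      then have jn: "j < n" using j by auto
      have "d (Suc j) n \<le> real (card (W - {col i})) * (a + b)"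
      proof (rule less.hyps)
        show "card (W - {col i}) < card W" using iW less.prems by (intro card_Diff1_less)
        show "Suc j \<le> n" using jn by simp
        show "col ` {Suc j..n} \<subseteq> W - {col i}" using less.prems after_j j by auto
      qed (use less.prems in auto)
      also have "real (card (W - {col i})) = real (card W) - 1"
        using iW less.prems cW by (simp add: card_Diff_singleton of_nat_diff)
      finally have "d (Suc j) n \<le> (real (card W) - 1) * (a + b)" .
      moreover have "d i n \<le> d i j + d j n" "d j n \<le> d j (Suc j) + d (Suc j) n"
        using j jn less.prems by (auto intro!: tri)
      moreover have "d i j \<le> a" using j jn less.prems by (intro same) auto
      moreover have "d j (Suc j) \<le> b" using jn by (rule adj)
      ultimately show ?thesis by (simp add: algebra_simps)
    qed
  qed
  moreover have "col ` {i..n} \<subseteq> W" using W(2) by auto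
  ultimately show ?thesis using i by blast
qed

text \<open>\<open>m\<close> is the limit superior, found as the infimum of the eventual upper
  bounds.\<close>

lemma exists_limsup_if_not_tendsto_0:
  fixes a :: "real \<Rightarrow> real"
  assumes bnd: "\<And>x. x > 0 \<Longrightarrow> 0 \<le> a x \<and> a x \<le> B" and "\<not> (a \<longlongrightarrow> 0) at_top"
  obtains m where "m > 0" "\<And>\<delta>. \<delta> > 0 \<Longrightarrow> eventually (\<lambda>x. a x \<le> m + \<delta>) at_top"
    "\<And>\<delta>. \<delta> > 0 \<Longrightarrow> frequently (\<lambda>x. a x \<ge> m - \<delta>) at_top"
proof -
  define S where "S = {c. eventually (\<lambda>x. a x \<le> c) at_top}"
  have pos: "eventually (\<lambda>x. 0 \<le> a x \<and> a x \<le> B) at_top"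
    using eventually_gt_at_top[of 0] by eventually_elim (rule bnd)
  then have BS: "B \<in> S" by (auto simp: S_def elim: eventually_mono)
  have S0: "0 \<le> c" if "c \<in> S" for c
  proof -
    have "eventually (\<lambda>x::real. 0 \<le> c) at_top"
      using pos that unfolding S_def mem_Collect_eq by eventually_elim auto
    then show ?thesis by simp
  qed
  have bdd: "bdd_below S" using S0 unfolding bdd_below_def by blast
  define m where "m = Inf S"
  have up: "eventually (\<lambda>x. a x \<le> m + \<delta>) at_top" if "\<delta> > 0" for \<delta>
  proof -
    have "Inf S < m + \<delta>" using that by (simp add: m_def)
    then obtain c where "c \<in> S" "c < m + \<delta>" using cInf_lessD BS by blast
    then show ?thesis by (auto simp: S_def elim: eventually_mono)
  qed
  have lo: "frequently (\<lambda>x. a x \<ge> m - \<delta>) at_top" if "\<delta> > 0" for \<delta>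
  proof (rule ccontr)
    assume "\<not> frequently (\<lambda>x. a x \<ge> m - \<delta>) at_top"
    then have "eventually (\<lambda>x. a x < m - \<delta>) at_top" by (simp add: frequently_def not_le)
    then have "m - \<delta> \<in> S" by (auto simp: S_def elim: eventually_mono)
    then have "m \<le> m - \<delta>" unfolding m_def using bdd by (intro cInf_lower)
    with that show False by simp
  qed
  have "m > 0"
  proof (rule ccontr)
    assume "\<not> m > 0"
    then have m0: "m \<le> 0" by simp
    have "(a \<longlongrightarrow> 0) at_top"
    proof (rule tendstoI)
      fix e :: real assume "e > 0"
      then have "eventually (\<lambda>x. a x \<le> m + e / 2) at_top" by (intro up) auto
      with pos show "eventually (\<lambda>x. dist (a x) 0 < e) at_top"
        by eventually_elim (use m0 \<open>e > 0\<close> in auto)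
    qed
    with assms(2) show False by simp
  qed
  with up lo show ?thesis using that by blast
qed

section \<open>Vanishing of the averages of coboundaries\<close>

context multiplicative_operators
begin

text \<open>
  The averages \<open>U d (avg (x / d) F)\<close> almost average to \<open>avg x F\<close>. If \<open>x\<close> almost maximizes the norm,
  they are almost not longer than \<open>avg x F\<close>, so most of them are close to it by convexity.
\<close>

lemma few_deviating_divisors:
  assumes F: "F \<in> V" and D: "finite D" "\<And>d. d \<in> D \<Longrightarrow> d > 0" "\<And>d. d \<in> D \<Longrightarrow> coprime d q"
    and x: "x > 0" and \<epsilon>: "0 \<le> \<epsilon>" and M: "0 \<le> M0" "M0 \<le> nrm (avg x F)"
    and dev: "\<And>d. d \<in> D \<Longrightarrow> \<epsilon> \<le> nrm (U d (avg (x / real d) F) - avg x F)"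
    and up: "\<And>d. d \<in> D \<Longrightarrow> nrm (avg (x / real d) F) \<le> M1"
  shows "recip_sum D * \<epsilon>\<^sup>2 \<le> recip_sum D * (M1\<^sup>2 - M0\<^sup>2) +
    2 * (nrm F)\<^sup>2 * sqrt (divisor_variance D + 2 * recip_sum D * real (card D) / x)"
proof -
  define L where "L = recip_sum D"
  define E where "E = nrm F * sqrt (divisor_variance D + 2 * recip_sum D * real (card D) / x)"
  define w where "w = (\<lambda>d. U d (avg (x / real d) F))"
  define s where "s = (\<Sum>d\<in>D. (1 / real d) *\<^sub>R w d)"
  let ?a = "avg x F"
  have L0: "L \<ge> 0" by (simp add: L_def recip_sum_nonneg)
  have wV: "w d \<in> V" if "d \<in> D" for d using that F D by (auto simp: w_def intro: U_in_V)
  have aV: "?a \<in> V" using F by auto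
  have sV: "s \<in> V" using wV by (auto simp: s_def)
  have TK: "nrm (L *\<^sub>R ?a - s) \<le> E"
    unfolding L_def s_def w_def E_def by (rule avg_turan_kubilius[OF F D(1,2) x])
  \<comment> \<open>The Turan--Kubilius inequality is paired with \<open>avg x F\<close>, as it has
    to control only the cross term of the squares expanded below.\<close>
  have "L * (nrm ?a)\<^sup>2 - ip s ?a = ip (L *\<^sub>R ?a - s) ?a"
    using aV sV by (simp add: ip_diff_left ip_scale_left nrm_sq)
  also have "\<dots> \<le> nrm (L *\<^sub>R ?a - s) * nrm ?a"
    using Cauchy_Schwarz[of "L *\<^sub>R ?a - s" ?a] aV sV by simp
  also have "\<dots> \<le> E * nrm F"
    using TK aV F x sV by (intro mult_mono nrm_avg_le) (auto intro: order_trans[OF nrm_nonneg TK])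
  finally have ip_s: "ip s ?a \<ge> L * (nrm ?a)\<^sup>2 - E * nrm F" by simp
  have "L * \<epsilon>\<^sup>2 = (\<Sum>d\<in>D. 1 / real d * \<epsilon>\<^sup>2)" by (simp add: L_def recip_sum_def sum_distrib_right)
  also have "\<dots> \<le> (\<Sum>d\<in>D. 1 / real d * (nrm (w d - ?a))\<^sup>2)"
    using dev \<epsilon> by (intro sum_mono mult_left_mono power_mono) (auto simp: w_def)
  also have "\<dots> = (\<Sum>d\<in>D. 1 / real d * (nrm (w d))\<^sup>2 - 2 * ip ((1 / real d) *\<^sub>R w d) ?a + 1 / real d * (nrm ?a)\<^sup>2)"
    using wV aV by (intro sum.cong refl) (simp add: nrm_sq_diff ip_scale_left algebra_simps)
  also have "\<dots> = (\<Sum>d\<in>D. 1 / real d * (nrm (w d))\<^sup>2) - 2 * ip s ?a + L * (nrm ?a)\<^sup>2"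
    using D(1) wV aV
    by (simp add: sum.distrib sum_subtractf s_def ip_sum_left L_def recip_sum_def sum_distrib_left sum_distrib_right)
  also have "(\<Sum>d\<in>D. 1 / real d * (nrm (w d))\<^sup>2) \<le> (\<Sum>d\<in>D. 1 / real d * M1\<^sup>2)"
  proof (intro sum_mono mult_left_mono power_mono)
    fix d assume d: "d \<in> D"
    show "nrm (w d) \<le> M1" using up[OF d] D d F by (auto simp: w_def nrm_U)
    show "0 \<le> nrm (w d)" using wV[OF d] by simp
  qed auto
  also have "(\<Sum>d\<in>D. 1 / real d * M1\<^sup>2) = L * M1\<^sup>2" by (simp add: L_def recip_sum_def sum_distrib_right)
  finally have "L * \<epsilon>\<^sup>2 \<le> L * M1\<^sup>2 - L * (nrm ?a)\<^sup>2 + 2 * (E * nrm F)" using ip_s by simp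
  moreover have "L * M0\<^sup>2 \<le> L * (nrm ?a)\<^sup>2" using M L0 by (intro mult_left_mono power_mono) auto
  ultimately show ?thesis by (simp add: L_def E_def algebra_simps power2_eq_square)
qed

theorem avg_coboundary_tendsto_0:
  assumes G: "G \<in> V" and p0: "prime p0" "coprime p0 q"
    and div: "\<not> (\<lambda>p. 1 / real p) summable_on {p. prime p \<and> U p = U p0}"
  shows "((\<lambda>x. nrm (avg x (U p0 G - G))) \<longlongrightarrow> 0) at_top"
proof (rule ccontr)
  define T where "T = U p0"
  define F where "F = T G - G"
  define B where "B = nrm F"
  define BG where "BG = nrm G"
  have p00: "p0 > 0" using p0 by (simp add: prime_gt_0_nat)
  have FV: "F \<in> V" using G p00 by (auto simp: F_def T_def U_in_V)
  have B0: "B \<ge> 0" "BG \<ge> 0" using FV G by (auto simp: B_def BG_def)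
  assume "\<not> ?thesis"
  then have nt: "\<not> ((\<lambda>x. nrm (avg x F)) \<longlongrightarrow> 0) at_top" by (simp add: F_def T_def)
  obtain m where m: "m > 0" "\<And>\<delta>. \<delta> > 0 \<Longrightarrow> eventually (\<lambda>x. nrm (avg x F) \<le> m + \<delta>) at_top"
    "\<And>\<delta>. \<delta> > 0 \<Longrightarrow> frequently (\<lambda>x. nrm (avg x F) \<ge> m - \<delta>) at_top"
    by (rule exists_limsup_if_not_tendsto_0[OF _ nt, of B]) (use FV in \<open>auto simp: B_def nrm_avg_le\<close>)

  \<comment> \<open>The operators of all primes and of all products of two primes: these are the
    finitely many colours for \<open>chain_of_colors\<close>.\<close>
  define W where "W = {U p | p. prime p} \<union> (\<lambda>(u, v). u \<circ> v) ` ({U p | p. prime p} \<times> {U p | p. prime p})"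
  have finW: "finite W" using finite_U by (simp add: W_def)
  define K where "K = real (card W)"
  have "W \<noteq> {}" using p0 by (auto simp: W_def)
  then have K1: "K \<ge> 1" using finW by (simp add: K_def Suc_le_eq card_gt_0_iff)
  \<comment> \<open>The bound \<open>m / 8\<close> keeps \<open>nrm (y 0) \<ge> m / 2\<close> in
    \<open>lower\<close>; the other one makes \<open>(nrm (y 0))\<^sup>2\<close> at most
    \<open>m\<^sup>2 / 8\<close> by \<open>upper\<close>, which is the final contradiction.\<close>
  define \<epsilon> where "\<epsilon> = min (m / 8) (m\<^sup>2 / (56 * K * (BG + 1)))"
  have \<epsilon>: "\<epsilon> > 0" "\<epsilon> \<le> m / 8" "\<epsilon> \<le> m\<^sup>2 / (56 * K * (BG + 1))" using m(1) K1 B0 by (auto simp: \<epsilon>_def)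
  define h where "h = min 1 (\<epsilon> / (3 * (B + 1)))"
  have h: "0 < h" "h \<le> 1" "h \<le> \<epsilon> / (3 * (B + 1))" using \<epsilon> B0 by (auto simp: h_def)
  have Bh: "B * (3 * h) \<le> \<epsilon>"
  proof -
    have "h * (3 * (B + 1)) \<le> \<epsilon>" using h(3) B0 by (simp add: pos_le_divide_eq)
    moreover have "0 \<le> 3 * h" using h by simp
    ultimately show ?thesis by (simp add: algebra_simps)
  qed
  \<comment> \<open>The squared norms vary by at most \<open>(m + \<delta>)\<^sup>2 - (m -
    \<delta>)\<^sup>2 = 4 * m * \<delta>\<close>, which has to stay below
    \<open>\<epsilon>\<^sup>2 / 2\<close>.\<close>
  define \<delta> where "\<delta> = min (m / 4) (\<epsilon>\<^sup>2 / (8 * m))"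
  have \<delta>: "\<delta> > 0" "\<delta> \<le> m / 4" "\<delta> \<le> \<epsilon>\<^sup>2 / (8 * m)" using m(1) \<epsilon> by (auto simp: \<delta>_def)

  define P where "P = {p. prime p \<and> U p = U p0}"
  \<comment> \<open>Divergence of the reciprocal sum brings the Turan--Kubilius error
    \<open>B * sqrt (2 * L')\<close> below \<open>\<epsilon> * L'\<close>, where \<open>L'\<close>
    is the main term.\<close>
  obtain D' where D': "finite D'" "D' \<subseteq> P" "recip_sum D' > 2 * B\<^sup>2 / \<epsilon>\<^sup>2 + 1"
  proof -
    have "\<not> bdd_above (sum (\<lambda>p. 1 / real p) ` {D. D \<subseteq> P \<and> finite D})"
      using div nonneg_bdd_above_summable_on[of P "\<lambda>p. 1 / real p"] by (auto simp: P_def)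
    then obtain D where "D \<subseteq> P" "finite D" "\<not> sum (\<lambda>p. 1 / real p) D \<le> 2 * B\<^sup>2 / \<epsilon>\<^sup>2 + 1"
      unfolding bdd_above_def by blast
    then show ?thesis using that[of D] by (simp add: recip_sum_def)
  qed
  define L' where "L' = recip_sum D'"
  have L': "L' > 1" "L' \<ge> 2 * B\<^sup>2 / \<epsilon>\<^sup>2" 
  proof -
    have "0 \<le> 2 * B\<^sup>2 / \<epsilon>\<^sup>2" by simp
    then show "L' > 1" "L' \<ge> 2 * B\<^sup>2 / \<epsilon>\<^sup>2" using D'(3) unfolding L'_def by linarith+
  qed
  \<comment> \<open>A convenient upper bound for all \<open>ln p\<close> with \<open>p\<close> in
    \<open>D'\<close>: a window of this length contains the shifts from \<open>x'\<close> to every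
    \<open>x' / p\<close>.\<close>
  define R where "R = (\<Sum>p\<in>D'. ln (real p))"
  have D'p: "prime p \<and> 0 < p \<and> 1 \<le> p \<and> U p = T" if "p \<in> D'" for p
    using that D'(2) prime_ge_1_nat[of p] prime_gt_0_nat[of p] by (auto simp: P_def T_def)
  have R: "R \<ge> 0" "\<And>p. p \<in> D' \<Longrightarrow> ln (real p) \<le> R"
    using D'(1) D'p by (auto simp: R_def intro!: sum_nonneg member_le_sum)

  obtain \<eta> C where \<eta>C: "\<eta> > 0" "C \<ge> 0" and window: 
    "\<And>S. \<exists>N Y. finite N \<and> Y \<ge> 1 \<and>
       (\<forall>n\<in>N. real n \<le> Y \<and> n \<in> almost_primes_above (ln (real q))) \<and>
       (\<forall>D\<subseteq>N. divisor_variance D \<le> C * real S \<and>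
         (recip_sum D < \<eta> * real S \<longrightarrow> has_dense_window h R Y (N - D)))"
    by (rule exists_window_of_almost_primes[OF h(1,2) R(1), of "ln (real q)"]) (rule that)
  \<comment> \<open>If the deviating set \<open>D\<close> below had reciprocal sum at least
    \<open>\<eta> * S\<close>, then \<open>S\<close> would be at most \<open>z * sqrt S\<close>.
    Taking \<open>S\<close> beyond \<open>z\<^sup>2\<close> leaves too few deviating divisors to
    spoil every window.\<close>
  define z where "z = 4 * B\<^sup>2 * sqrt (C + 1) / (\<eta> * \<epsilon>\<^sup>2)"
  obtain S :: nat where S: "z\<^sup>2 + 1 < real S" using reals_Archimedean2 by blast
  have S1: "real S \<ge> 1" using S zero_le_power2[of z] by linarith
  from window[of S] obtain N Y where N: "finite N" "Y \<ge> 1"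
    and N_Y: "\<forall>n\<in>N. real n \<le> Y \<and> n \<in> almost_primes_above (ln (real q))"
    and N_D: "\<forall>D\<subseteq>N. divisor_variance D \<le> C * real S \<and>
         (recip_sum D < \<eta> * real S \<longrightarrow> has_dense_window h R Y (N - D))"
    by (elim exE conjE) (rule that)
  have Nn: "0 < n \<and> real n \<le> Y" if "n \<in> N" for n
    using N_Y that by (auto simp: almost_primes_above_def prime_gt_0_nat)
  have N_U: "coprime n q \<and> U n \<in> W" if n: "n \<in> N" for n
  proof -
    have cop: "coprime p q" if p: "prime p" "ln (real q) < ln (real p)" for p
    proof -
      have "q < p" using p q_pos prime_gt_0_nat[of p] by simp
      then have "\<not> p dvd q" using q_pos by (auto dest: dvd_imp_le)
      then show ?thesis using p by (simp add: prime_imp_coprime)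
    qed
    have "n \<in> almost_primes_above (ln (real q))" using N_Y n by blast
    then consider "prime n" "ln (real q) < ln (real n)"
      | p p' where "prime p" "ln (real q) < ln (real p)" "prime p'" "ln (real q) < ln (real p')" "n = p * p'"
      by (auto simp: almost_primes_above_def)
    then show ?thesis
    proof cases
      case 1
      then show ?thesis using cop by (auto simp: W_def)
    next
      case 2
      have "U n = U p \<circ> U p'" using 2 by (auto simp: fun_eq_iff U_mult prime_gt_0_nat)
      then have "U n \<in> W" using 2 by (auto simp: W_def)
      then show ?thesis using 2 cop by simp
    qed
  qed

  obtain X1 where X1: "\<And>x. x \<ge> X1 \<Longrightarrow> nrm (avg x F) \<le> m + \<delta>"
    using m(2)[OF \<delta>(1)] by (auto simp: eventually_at_top_linorder)
  \<comment> \<open>Beyond \<open>X\<close> the norm is at most \<open>m + \<delta>\<close>, the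
    rounding term in \<open>avg_Lipschitz\<close> is at most \<open>h\<close>, and the cardinality
    term of Turan--Kubilius for \<open>D'\<close> is at most 1.\<close>
  define X where "X = Max {1, X1, 1 / h, 2 * L' * real (card D')}"
  have X: "X \<ge> 1" "X \<ge> X1" "X \<ge> 1 / h" "X \<ge> 2 * L' * real (card D')" by (auto simp: X_def)
  have "eventually (\<lambda>x. x \<ge> max (X * Y) (2 * (real (card N))\<^sup>2)) at_top" by (rule eventually_ge_at_top)
  then obtain x where x: "nrm (avg x F) \<ge> m - \<delta>" "x \<ge> X * Y" "x \<ge> 2 * (real (card N))\<^sup>2"
    using frequently_eventually_conj[OF m(3)[OF \<delta>(1)]] by (force dest: frequently_ex)
  have x1: "x \<ge> 1" using x(2) X(1) N(2) mult_mono[of 1 X 1 Y] by simp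
  have x_div: "x / t \<ge> X" if "0 < t" "t \<le> Y" for t
  proof -
    have "X * t \<le> X * Y" using that X by (intro mult_left_mono) auto
    then show ?thesis using x(2) that by (simp add: pos_le_divide_eq)
  qed

  define D where "D = {n\<in>N. \<epsilon> < nrm (U n (avg (x / real n) F) - avg x F)}"
  have finD: "finite D" "D \<subseteq> N" using N by (auto simp: D_def)
  have "recip_sum D < \<eta> * real S"
  proof (rule ccontr)
    assume "\<not> ?thesis"
    then have LD: "recip_sum D \<ge> \<eta> * real S" by simp
    have "recip_sum D * \<epsilon>\<^sup>2 \<le> recip_sum D * ((m + \<delta>)\<^sup>2 - (m - \<delta>)\<^sup>2) +
      2 * (nrm F)\<^sup>2 * sqrt (divisor_variance D + 2 * recip_sum D * real (card D) / x)"
    proof (rule few_deviating_divisors[OF FV finD(1)])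
      fix d assume d: "d \<in> D"
      then have dN: "d \<in> N" by (simp add: D_def)
      show "d > 0" "coprime d q" using Nn[OF dN] N_U[OF dN] by auto
      show "\<epsilon> \<le> nrm (U d (avg (x / real d) F) - avg x F)" using d by (simp add: D_def)
      show "nrm (avg (x / real d) F) \<le> m + \<delta>"
        using X1[of "x / real d"] x_div[of "real d"] Nn[OF dN] X by simp
    qed (use x1 x \<epsilon> \<delta> m in auto)
    also have "(m + \<delta>)\<^sup>2 - (m - \<delta>)\<^sup>2 = 4 * m * \<delta>" by (simp add: power2_eq_square algebra_simps)
    also have "recip_sum D * (4 * m * \<delta>) \<le> recip_sum D * (\<epsilon>\<^sup>2 / 2)"
    proof (intro mult_left_mono recip_sum_nonneg)
      have "\<delta> * (8 * m) \<le> \<epsilon>\<^sup>2" using \<delta>(3) m(1) by (simp add: pos_le_divide_eq)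
      then show "4 * m * \<delta> \<le> \<epsilon>\<^sup>2 / 2" by (simp add: mult_ac)
    qed
    also have "divisor_variance D + 2 * recip_sum D * real (card D) / x \<le> (C + 1) * real S"
    proof -
      have "recip_sum D \<le> real (card D) * 1"
        unfolding recip_sum_def
      proof (rule sum_bounded_above)
        fix d assume "d \<in> D"
        then have "d > 0" using finD Nn by blast
        then show "1 / real d \<le> 1" by simp
      qed
      moreover have "real (card D) \<le> real (card N)" using finD N by (simp add: card_mono)
      ultimately have "recip_sum D * real (card D) \<le> real (card N) * real (card N)"
        by (intro mult_mono) auto
      then have "2 * recip_sum D * real (card D) \<le> x" using x(3) by (simp add: power2_eq_square)
      then have "2 * recip_sum D * real (card D) / x \<le> 1" using x1 by simp
      moreover have "divisor_variance D \<le> C * real S" using N_D finD(2) by blast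
      ultimately show ?thesis using S1 by (simp add: algebra_simps)
    qed
    finally have "recip_sum D * (\<epsilon>\<^sup>2 / 2) \<le> 2 * B\<^sup>2 * sqrt ((C + 1) * real S)"
      by (simp add: B_def mult_left_mono)
    moreover have "\<eta> * real S * (\<epsilon>\<^sup>2 / 2) \<le> recip_sum D * (\<epsilon>\<^sup>2 / 2)"
      using LD by (intro mult_right_mono) auto
    ultimately have "\<eta> * real S * \<epsilon>\<^sup>2 \<le> 4 * B\<^sup>2 * sqrt (C + 1) * sqrt (real S)"
      by (simp add: real_sqrt_mult)
    also have "\<dots> = \<eta> * \<epsilon>\<^sup>2 * (z * sqrt (real S))" using \<eta>C \<epsilon> by (simp add: z_def)
    finally have "(\<eta> * \<epsilon>\<^sup>2) * real S \<le> (\<eta> * \<epsilon>\<^sup>2) * (z * sqrt (real S))" by (simp add: mult_ac)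
    then have "sqrt (real S) * sqrt (real S) \<le> z * sqrt (real S)" using \<eta>C \<epsilon> by simp
    then have "sqrt (real S) \<le> z" by (rule mult_right_le_imp_le) (use S1 in simp)
    then have "real S \<le> z\<^sup>2" using real_le_lsqrt power_mono[of "sqrt (real S)" z 2] by simp
    then show False using S by simp
  qed
  then have "has_dense_window h R Y (N - D)" using N_D finD(2) by blast
  then obtain v where v: "v \<ge> 0" "exp (v + R + 1) \<le> Y"
    and good: "\<And>i. real i * h \<le> R \<Longrightarrow> \<exists>n\<in>N - D. v + real i * h < ln (real n) \<and> ln (real n) \<le> v + real i * h + h"
    unfolding has_dense_window_def by blast
  \<comment> \<open>Logarithmic time along the window; \<open>y i\<close> is the average at the
    start of its \<open>i\<close>th cell.\<close>
  define pt where "pt = (\<lambda>t. x / exp (v + t))"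
  define y where "y = (\<lambda>i::nat. avg (pt (real i * h)) F)"
  have yV: "y i \<in> V" for i using FV by (simp add: y_def)
  have pt_ge: "pt t \<ge> X" if "t \<le> R + 1" for t
  proof -
    have "exp (v + t) \<le> exp (v + R + 1)" using that by simp
    with v(2) have "exp (v + t) \<le> Y" by linarith
    then show ?thesis unfolding pt_def by (intro x_div) auto
  qed
  have Lip: "nrm (avg (pt s) F - avg (pt t) F) \<le> \<epsilon>" if "s \<le> t" "t \<le> s + h" "t \<le> R + 1" for s t
  proof -
    have pos: "pt s > 0" "pt t > 0" using x1 by (auto simp: pt_def)
    have le: "pt t \<le> pt s" unfolding pt_def using that x1 by (intro divide_left_mono) auto
    have "pt t = pt s * exp (- (t - s))" by (simp add: pt_def exp_diff exp_minus exp_add field_simps)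
    moreover have "exp (- (t - s)) \<ge> 1 - h" using exp_ge_add_one_self[of "- (t - s)"] that by linarith
    ultimately have "pt t \<ge> pt s * (1 - h)" using pos by (simp add: mult_left_mono)
    then have d: "pt s - pt t \<le> pt s * h" by (simp add: algebra_simps)
    have "1 / h \<le> pt s" using pt_ge[of s] that X(3) by linarith
    then have one: "1 \<le> pt s * h" using h by (simp add: pos_divide_le_eq)
    have "nrm (avg (pt s) F - avg (pt t) F) \<le> B * ((2 * (pt s - pt t) + 1) / pt s)"
      unfolding B_def by (rule avg_Lipschitz[OF FV pos(2) le])
    also have "\<dots> \<le> B * (3 * h)"
      using d one pos B0 by (intro mult_left_mono) (auto simp: pos_divide_le_eq mult_ac)
    finally show ?thesis using Bh by linarith
  qed
  define nn where "nn = (\<lambda>i. SOME n. n \<in> N - D \<and> v + real i * h < ln (real n) \<and> ln (real n) \<le> v + real i * h + h)"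
  have nn: "nn i \<in> N" "nn i > 0" "nn i \<notin> D" "v + real i * h < ln (real (nn i))" "ln (real (nn i)) \<le> v + real i * h + h"
    if "real i * h \<le> R" for i
  proof -
    have "nn i \<in> N - D \<and> v + real i * h < ln (real (nn i)) \<and> ln (real (nn i)) \<le> v + real i * h + h"
      unfolding nn_def using good[OF that] by (intro someI_ex[where P = "\<lambda>n. n \<in> N - D \<and> v + real i * h < ln (real n) \<and> ln (real n) \<le> v + real i * h + h"]) blast
    then show "nn i \<in> N" "nn i > 0" "nn i \<notin> D" "v + real i * h < ln (real (nn i))" "ln (real (nn i)) \<le> v + real i * h + h"
      using Nn by auto
  qed
  \<comment> \<open>The cell contains \<open>nn i\<close> outside \<open>D\<close>, whose operator
    takes the average at \<open>x / nn i\<close> to within \<open>\<epsilon>\<close> of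
    \<open>avg x F\<close>. Slow variation moves that point to the start of the cell.\<close>
  have near: "nrm (U (nn i) (y i) - avg x F) \<le> 2 * \<epsilon>" if i: "real i * h \<le> R" for i
  proof -
    let ?n = "nn i"
    note n = nn[OF i]
    have pn: "x / real ?n = pt (ln (real ?n) - v)" using n(2) by (simp add: pt_def)
    have "nrm (U ?n (y i) - U ?n (avg (x / real ?n) F)) = nrm (y i - avg (x / real ?n) F)"
      using n N_U[OF n(1)] yV FV U_diff[of ?n] nrm_U[of ?n "y i - avg (x / real ?n) F"] by auto
    also have "\<dots> \<le> \<epsilon>" unfolding pn y_def using n i h by (intro Lip) auto
    finally have 1: "nrm (U ?n (y i) - U ?n (avg (x / real ?n) F)) \<le> \<epsilon>" .
    have "nrm (U ?n (avg (x / real ?n) F) - avg x F) \<le> \<epsilon>" using n by (simp add: D_def)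
    with 1 show ?thesis
      using nrm_triangle_sub[of "U ?n (y i)" "U ?n (avg (x / real ?n) F)" "avg x F"] n yV FV by (auto simp: U_in_V)
  qed
  have chain: "nrm (y 0 - y i) \<le> K * (5 * \<epsilon>)" if i: "real i * h \<le> R" for i
  proof -
    have le_R: "real j * h \<le> R" if "j \<le> i" for j
    proof -
      have "real j * h \<le> real i * h" using that h by (intro mult_right_mono) auto
      with i show ?thesis by simp
    qed
    have "nrm (y 0 - y i) \<le> real (card W) * (4 * \<epsilon> + \<epsilon>)"
    proof (rule chain_of_colors[where col = "\<lambda>j. U (nn j)" and d = "\<lambda>j k. nrm (y j - y k)" and n = i])
      show "U (nn j) \<in> W" if "j \<le> i" for j using N_U nn(1)[OF le_R[OF that]] by blast
      show "nrm (y j - y l) \<le> nrm (y j - y k) + nrm (y k - y l)" for j k l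
        using yV by (intro nrm_triangle_sub)
      show "nrm (y j - y (Suc j)) \<le> \<epsilon>" if "j < i" for j
        unfolding y_def using le_R[of "Suc j"] that h by (intro Lip) (auto simp: algebra_simps)
      \<comment> \<open>Equal colours: one and the same isometry takes both points near
        \<open>avg x F\<close>.\<close>
      show "nrm (y j - y k) \<le> 4 * \<epsilon>" if jk: "j \<le> i" "k \<le> i" "U (nn j) = U (nn k)" for j k
      proof -
        let ?n = "nn j"
        have n: "?n > 0" "coprime ?n q" using N_U nn[OF le_R[OF jk(1)]] by auto
        have "nrm (y j - y k) = nrm (U ?n (y j) - U ?n (y k))"
          using n yV U_diff[of ?n] nrm_U[of ?n "y j - y k"] by auto
        also have "\<dots> \<le> nrm (U ?n (y j) - avg x F) + nrm (avg x F - U ?n (y k))"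
          using n yV FV by (intro nrm_triangle_sub) (auto simp: U_in_V)
        also have "nrm (avg x F - U ?n (y k)) = nrm (U ?n (y k) - avg x F)"
          using n yV FV by (intro nrm_minus_commute) (auto simp: U_in_V)
        also have "nrm (U ?n (y k) - avg x F) \<le> 2 * \<epsilon>" using near[OF le_R[OF jk(2)]] jk(3) by simp
        also have "nrm (U ?n (y j) - avg x F) \<le> 2 * \<epsilon>" by (rule near[OF le_R[OF jk(1)]])
        finally show ?thesis by simp
      qed
    qed (use finW \<epsilon> in auto)
    then show ?thesis by (simp add: K_def)
  qed
  have near_y0: "nrm (y 0 - avg (pt t) F) \<le> 6 * K * \<epsilon>" if t: "0 \<le> t" "t \<le> R" for t
  proof -
    define i where "i = nat \<lfloor>t / h\<rfloor>"
    have "real i \<le> t / h" "t / h < real i + 1" using t h by (auto simp: i_def)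
    then have i: "real i * h \<le> t" "t \<le> real i * h + h" using h by (auto simp: field_simps)
    have "nrm (y 0 - avg (pt t) F) \<le> nrm (y 0 - y i) + nrm (y i - avg (pt t) F)"
      using yV FV by (intro nrm_triangle_sub) auto
    also have "nrm (y 0 - y i) \<le> K * (5 * \<epsilon>)" using i t by (intro chain) auto
    also have "nrm (y i - avg (pt t) F) \<le> \<epsilon>" unfolding y_def using i t by (intro Lip) auto
    also have "K * (5 * \<epsilon>) + \<epsilon> \<le> 6 * K * \<epsilon>" using mult_right_mono[OF K1, of \<epsilon>] \<epsilon> by simp
    finally show ?thesis by simp
  qed

  \<comment> \<open>Turan--Kubilius is now applied at this point with the primes of
    \<open>D'\<close>: all \<open>x' / p\<close> lie in the window, where the averages hardly differ
    from \<open>y 0\<close>, and every \<open>U p\<close> is \<open>T\<close>.\<close>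
  define x' where "x' = pt 0"
  have x': "x' \<ge> X" "x' > 0" using pt_ge[of 0] R X unfolding x'_def by auto
  have y0: "y 0 = avg x' F" by (simp add: y_def x'_def)
  have TV: "T u \<in> V" if "u \<in> V" for u using that p00 by (simp add: T_def U_in_V)
  have nrm_T: "nrm (T u) = nrm u" if "u \<in> V" for u using that p00 p0 by (simp add: T_def nrm_U)
  have T_diff: "T (u - w) = T u - T w" for u w using p00 by (simp add: T_def U_diff)
  have Ty0: "nrm (y 0 - T (y 0)) \<le> 7 * K * \<epsilon>"
  proof -
    define s where "s = (\<Sum>p\<in>D'. (1 / real p) *\<^sub>R U p (avg (x' / real p) F))"
    have sV: "s \<in> V" unfolding s_def using D'p FV by (auto intro!: U_in_V)
    have "nrm (L' *\<^sub>R y 0 - s) \<le> B * sqrt (divisor_variance D' + 2 * recip_sum D' * real (card D') / x')"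
      unfolding L'_def y0 s_def B_def using D'p by (intro avg_turan_kubilius FV D' x') auto
    also have "\<dots> \<le> \<epsilon> * L'"
    proof -
      have "divisor_variance D' \<le> L'" unfolding L'_def using D'p by (intro divisor_variance_primes D') auto
      moreover have "2 * recip_sum D' * real (card D') / x' \<le> 1"
        using X(4) x' by (simp add: L'_def)
      ultimately have "divisor_variance D' + 2 * recip_sum D' * real (card D') / x' \<le> 2 * L'" using L' by simp
      then have "sqrt (divisor_variance D' + 2 * recip_sum D' * real (card D') / x') \<le> sqrt (2 * L')" by simp
      then have "B * sqrt (divisor_variance D' + 2 * recip_sum D' * real (card D') / x') \<le> B * sqrt (2 * L')"
        using B0 by (intro mult_left_mono)
      also have "\<dots> \<le> \<epsilon> * L'"
      proof (rule power2_le_imp_le)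
        have "2 * B\<^sup>2 \<le> L' * \<epsilon>\<^sup>2" using L'(2) \<epsilon> by (simp add: pos_divide_le_eq)
        then have "2 * B\<^sup>2 * L' \<le> L' * \<epsilon>\<^sup>2 * L'" using L'(1) by (intro mult_right_mono) auto
        then show "(B * sqrt (2 * L'))\<^sup>2 \<le> (\<epsilon> * L')\<^sup>2"
          using L'(1) by (simp add: power_mult_distrib power2_eq_square mult_ac)
      qed (use \<epsilon> L' in auto)
      finally show ?thesis .
    qed
    finally have 1: "nrm (L' *\<^sub>R y 0 - s) \<le> \<epsilon> * L'" .
    have "L' *\<^sub>R T (y 0) = (\<Sum>p\<in>D'. (1 / real p) *\<^sub>R T (y 0))"
      by (simp add: L'_def recip_sum_def scaleR_sum_left)
    then have "s - L' *\<^sub>R T (y 0) = (\<Sum>p\<in>D'. (1 / real p) *\<^sub>R (U p (avg (x' / real p) F) - T (y 0)))"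
      by (simp add: s_def sum_subtractf scaleR_diff_right)
    also have "nrm \<dots> \<le> (\<Sum>p\<in>D'. nrm ((1 / real p) *\<^sub>R (U p (avg (x' / real p) F) - T (y 0))))"
      using D' D'p FV yV TV by (intro nrm_sum_le) (auto simp: U_in_V)
    also have "\<dots> \<le> (\<Sum>p\<in>D'. 1 / real p * (6 * K * \<epsilon>))"
    proof (rule sum_mono)
      fix p assume p: "p \<in> D'"
      have "x' / real p = pt (ln (real p))" using D'p[OF p] by (simp add: x'_def pt_def exp_add)
      then have "nrm (U p (avg (x' / real p) F) - T (y 0)) = nrm (y 0 - avg (pt (ln (real p))) F)"
        using D'p[OF p] FV yV nrm_T[of "avg (x' / real p) F - y 0"] nrm_minus_commute[of "y 0"] by (auto simp: T_diff)
      also have "\<dots> \<le> 6 * K * \<epsilon>" using R(2)[OF p] D'p[OF p] by (intro near_y0) auto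
      finally show "nrm ((1 / real p) *\<^sub>R (U p (avg (x' / real p) F) - T (y 0))) \<le> 1 / real p * (6 * K * \<epsilon>)"
        using D'p[OF p] FV yV TV by (simp add: nrm_scale U_in_V divide_right_mono)
    qed
    also have "\<dots> = L' * (6 * K * \<epsilon>)" by (simp only: L'_def recip_sum_def sum_distrib_right)
    finally have 2: "nrm (s - L' *\<^sub>R T (y 0)) \<le> L' * (6 * K * \<epsilon>)" .
    have "L' * nrm (y 0 - T (y 0)) = nrm (L' *\<^sub>R y 0 - L' *\<^sub>R T (y 0))"
      using yV TV L' nrm_scale[of "y 0 - T (y 0)" L'] by (simp add: scaleR_diff_right)
    also have "\<dots> \<le> \<epsilon> * L' + L' * (6 * K * \<epsilon>)"
      using nrm_triangle_sub[of "L' *\<^sub>R y 0" s "L' *\<^sub>R T (y 0)"] yV TV sV 1 2 by simp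
    also have "\<dots> = L' * (\<epsilon> + 6 * K * \<epsilon>)" by (simp add: algebra_simps)
    finally have "nrm (y 0 - T (y 0)) \<le> \<epsilon> + 6 * K * \<epsilon>" using L' by simp
    also have "\<dots> \<le> 7 * K * \<epsilon>" using mult_right_mono[OF K1, of \<epsilon>] \<epsilon> by simp
    finally show ?thesis .
  qed
  have lower: "nrm (y 0) \<ge> m / 2"
  proof -
    have R0: "real 0 * h \<le> R" using R by simp
    have "nrm (U (nn 0) (y 0)) = nrm (y 0)" using nn[OF R0] N_U yV by (intro nrm_U) auto
    then have "nrm (avg x F) \<le> nrm (y 0) + nrm (avg x F - U (nn 0) (y 0))"
      using nrm_le_add_diff[of "avg x F" "U (nn 0) (y 0)"] FV yV nn[OF R0] by (simp add: U_in_V)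
    also have "nrm (avg x F - U (nn 0) (y 0)) = nrm (U (nn 0) (y 0) - avg x F)"
      using FV yV nn[OF R0] by (intro nrm_minus_commute) (auto simp: U_in_V)
    also have "\<dots> \<le> 2 * \<epsilon>" by (rule near[OF R0])
    finally show ?thesis using x(1) \<epsilon>(2) \<delta>(2) by linarith
  qed
  \<comment> \<open>Pairing the coboundary \<open>T g - g\<close> with \<open>y 0\<close> is the
    same as pairing \<open>T g\<close> with \<open>y 0 - T (y 0)\<close>, since \<open>T\<close> is
    an isometry; and the latter vector is short by \<open>Ty0\<close>.\<close>
  have upper: "(nrm (y 0))\<^sup>2 \<le> BG * (7 * K * \<epsilon>)"
  proof -
    define g where "g = avg x' G"
    have gV: "g \<in> V" using G by (simp add: g_def)
    have y0g: "y 0 = T g - g" using p00 by (simp add: y0 g_def F_def avg_diff T_def avg_U)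
    have "(nrm (y 0))\<^sup>2 = ip (T g - g) (y 0)" using yV[of 0] by (simp add: nrm_sq y0g)
    also have "\<dots> = ip (T g) (y 0) - ip g (y 0)" using gV TV yV by (simp add: ip_diff_left)
    also have "ip g (y 0) = ip (T g) (T (y 0))" using gV yV p00 p0 by (simp add: T_def U_isometry)
    also have "ip (T g) (y 0) - ip (T g) (T (y 0)) = ip (T g) (y 0 - T (y 0))"
      using gV TV yV by (simp add: ip_diff_right)
    also have "\<dots> \<le> nrm (T g) * nrm (y 0 - T (y 0))"
      using Cauchy_Schwarz[of "T g" "y 0 - T (y 0)"] gV TV yV by simp
    also have "\<dots> \<le> BG * (7 * K * \<epsilon>)"
      using Ty0 gV yV TV B0 nrm_T[OF gV] nrm_avg_le[OF G x'(2)] unfolding BG_def g_def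
      by (intro mult_mono) auto
    finally show ?thesis .
  qed
  have "(m / 2)\<^sup>2 \<le> (nrm (y 0))\<^sup>2" using lower m by (intro power_mono) auto
  also note upper
  also have "BG * (7 * K * \<epsilon>) \<le> (BG + 1) * (7 * K * \<epsilon>)" using K1 \<epsilon> by (intro mult_right_mono) auto
  also have "\<dots> = (\<epsilon> * (56 * K * (BG + 1))) / 8" by simp
  also have "\<dots> \<le> m\<^sup>2 / 8"
  proof -
    have "0 < 56 * K * (BG + 1)" using K1 B0 by simp
    then have "\<epsilon> * (56 * K * (BG + 1)) \<le> m\<^sup>2" using \<epsilon>(3) by (simp add: pos_le_divide_eq)
    then show ?thesis by (intro divide_right_mono) auto
  qed
  finally show False using m(1) by (simp add: power_divide)
qed

end

section \<open>The space of square integrable functions\<close>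

context semi_inner
begin

text \<open>A sequence minimizing the distance is Cauchy by the parallelogram law. Limits exist only
  up to norm 0, and closedness in the same sense puts the limit into \<open>A\<close>.\<close>

lemma exists_orthogonal_projection:
  assumes complete: "\<And>s :: nat \<Rightarrow> 'v. (\<And>n. s n \<in> V) \<Longrightarrow>
      (\<And>e. e > 0 \<Longrightarrow> \<exists>N. \<forall>m\<ge>N. \<forall>n\<ge>N. nrm (s m - s n) < e) \<Longrightarrow>
      \<exists>y\<in>V. (\<lambda>n. nrm (s n - y)) \<longlonglongrightarrow> 0"
    and A: "A \<subseteq> V" "subspace A"
    and closed: "\<And>y. y \<in> V \<Longrightarrow> (\<And>e. e > 0 \<Longrightarrow> \<exists>a\<in>A. nrm (y - a) < e) \<Longrightarrow> y \<in> A"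
    and x: "x \<in> V"
  obtains p where "p \<in> A" "\<And>a. a \<in> A \<Longrightarrow> ip (x - p) a = 0"
proof -
  define D where "D = (\<lambda>a. (nrm (x - a))\<^sup>2) ` A"
  define d where "d = Inf D"
  have A0: "0 \<in> A" using A(2) by (rule subspace_0)
  have bdd: "bdd_below D" by (auto simp: D_def intro!: bdd_belowI[of _ 0])
  have d_le: "d \<le> (nrm (x - a))\<^sup>2" if "a \<in> A" for a
    unfolding d_def by (intro cInf_lower bdd) (use that in \<open>auto simp: D_def\<close>)
  have "\<exists>a\<in>A. (nrm (x - a))\<^sup>2 < d + 1 / (real n + 1)" for n :: nat
  proof -
    have "Inf D < d + 1 / (real n + 1)" by (simp add: d_def)
    then obtain c where "c \<in> D" "c < d + 1 / (real n + 1)"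
      using cInf_lessD[of D] A0 by (auto simp: D_def)
    then show ?thesis by (auto simp: D_def)
  qed
  then obtain s where s: "\<And>n. s n \<in> A" "\<And>n. (nrm (x - s n))\<^sup>2 < d + 1 / (real n + 1)" by metis
  have sV: "s n \<in> V" for n using s(1) A(1) by blast
  have par: "(nrm (s m - s n))\<^sup>2 \<le> 2 / (real m + 1) + 2 / (real n + 1)" for m n
  proof -
    define u w where "u = x - s m" and "w = x - s n"
    have uw: "u \<in> V" "w \<in> V" using sV x by (auto simp: u_def w_def)
    define mid where "mid = (1/2) *\<^sub>R (s m + s n)"
    have "mid \<in> A" unfolding mid_def using A(2) s(1) by (intro subspace_scale subspace_add)
    have "x - mid = (1/2) *\<^sub>R (u + w)" 
      by (simp add: mid_def u_def w_def scaleR_add_right scaleR_diff_right algebra_simps)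
         (metis scaleR_half_double scaleR_add_right)
    then have "(nrm (x - mid))\<^sup>2 = (nrm (u + w))\<^sup>2 / 4" using uw by (simp add: nrm_scale power_divide)
    with d_le[OF \<open>mid \<in> A\<close>] have "4 * d \<le> (nrm (u + w))\<^sup>2" by simp
    moreover have "(nrm (u - w))\<^sup>2 + (nrm (u + w))\<^sup>2 = 2 * (nrm u)\<^sup>2 + 2 * (nrm w)\<^sup>2"
      using uw by (simp add: nrm_sq ip_add_left ip_add_right ip_diff_left ip_diff_right)
    moreover have "nrm (s m - s n) = nrm (u - w)"
      using sV nrm_minus_commute[of "s m" "s n"] by (simp add: u_def w_def)
    ultimately show ?thesis using s(2)[of m] s(2)[of n] by (simp add: u_def w_def)
  qed
  have "\<exists>N. \<forall>m\<ge>N. \<forall>n\<ge>N. nrm (s m - s n) < e" if e: "e > 0" for e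
  proof -
    obtain N where N: "4 / e\<^sup>2 < real N" using reals_Archimedean2 by blast
    have "nrm (s m - s n) < e" if "m \<ge> N" "n \<ge> N" for m n
    proof -
      have "0 < e\<^sup>2" using e by simp
      then have "4 < e\<^sup>2 * (real k + 1)" if "k \<ge> N" for k
      proof -
        have "4 < e\<^sup>2 * real N" using N \<open>0 < e\<^sup>2\<close> by (simp add: pos_divide_less_eq mult.commute)
        also have "\<dots> \<le> e\<^sup>2 * (real k + 1)" using that by (intro mult_left_mono) auto
        finally show ?thesis .
      qed
      then have "2 / (real k + 1) < e\<^sup>2 / 2" if "k \<ge> N" for k
        using that by (simp add: field_simps)
      from this[OF that(1)] this[OF that(2)] have "(nrm (s m - s n))\<^sup>2 < e\<^sup>2" using par[of m n] by simp
      then show ?thesis using e by (auto intro: power2_less_imp_less)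
    qed
    then show ?thesis by blast
  qed
  from complete[OF sV this] obtain p where p: "p \<in> V" "(\<lambda>n. nrm (s n - p)) \<longlonglongrightarrow> 0" by blast
  have pA: "p \<in> A"
  proof (rule closed[OF p(1)])
    fix e :: real assume "e > 0"
    with p(2) have "eventually (\<lambda>n. nrm (s n - p) < e) sequentially" by (rule order_tendstoD)
    then obtain n where "nrm (s n - p) < e" by (auto simp: eventually_sequentially)
    then show "\<exists>a\<in>A. nrm (p - a) < e" using s(1) nrm_minus_commute[OF p(1) sV] by metis
  qed
  have "(nrm (x - p))\<^sup>2 \<le> d"
  proof (rule LIMSEQ_le)
    show "(\<lambda>n. (nrm (x - p))\<^sup>2) \<longlonglongrightarrow> (nrm (x - p))\<^sup>2" by simp
    have "(\<lambda>n. (sqrt (d + 1 / (real n + 1)) + nrm (s n - p))\<^sup>2) \<longlonglongrightarrow> (sqrt (d + 0) + 0)\<^sup>2"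
      using p(2) LIMSEQ_inverse_real_of_nat
      by (intro tendsto_intros) (simp_all add: inverse_eq_divide add.commute)
    moreover have "d \<ge> 0"
      unfolding d_def by (intro cInf_greatest) (use A0 in \<open>auto simp: D_def\<close>)
    ultimately show "(\<lambda>n. (sqrt (d + 1 / (real n + 1)) + nrm (s n - p))\<^sup>2) \<longlonglongrightarrow> d" by simp
    have "(nrm (x - p))\<^sup>2 \<le> (sqrt (d + 1 / (real n + 1)) + nrm (s n - p))\<^sup>2" for n
    proof (rule power_mono)
      have "nrm (x - p) \<le> nrm (x - s n) + nrm (s n - p)" using x p sV by (intro nrm_triangle_sub)
      moreover have "nrm (x - s n) \<le> sqrt (d + 1 / (real n + 1))" using s(2)[of n] by (intro real_le_rsqrt) simp
      ultimately show "nrm (x - p) \<le> sqrt (d + 1 / (real n + 1)) + nrm (s n - p)" by simp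
    qed (use x p in simp)
    then show "\<exists>N. \<forall>n\<ge>N. (nrm (x - p))\<^sup>2 \<le> (sqrt (d + 1 / (real n + 1)) + nrm (s n - p))\<^sup>2" by blast
  qed
  have "ip (x - p) a = 0" if a: "a \<in> A" for a
  proof (rule ccontr)
    define c where "c = ip (x - p) a"
    \<comment> \<open>Moving \<open>p\<close> by \<open>c / M\<close> times \<open>a\<close> would
      shorten the distance; the added 1 keeps the divisor positive also for
      \<open>nrm a = 0\<close>.\<close>
    define M where "M = (nrm a)\<^sup>2 + 1"
    assume "ip (x - p) a \<noteq> 0"
    then have c: "c \<noteq> 0" by (simp add: c_def)
    have M: "M \<ge> 1" by (simp add: M_def)
    have aV: "a \<in> V" using a A by blast
    have "p + (c / M) *\<^sub>R a \<in> A" using A(2) pA a by (intro subspace_add subspace_scale)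
    from d_le[OF this] have "(nrm (x - p))\<^sup>2 \<le> (nrm (x - p - (c / M) *\<^sub>R a))\<^sup>2"
      using \<open>(nrm (x - p))\<^sup>2 \<le> d\<close> by (simp add: diff_diff_add)
    also have "\<dots> = (nrm (x - p))\<^sup>2 - 2 * (c / M * c) + (c / M)\<^sup>2 * (nrm a)\<^sup>2"
      using x p aV by (simp add: nrm_sq_diff ip_scale_right nrm_scale power_mult_distrib power_divide c_def)
    finally have "2 * (c / M * c) \<le> (c / M)\<^sup>2 * (nrm a)\<^sup>2" by simp
    also have "\<dots> \<le> (c / M)\<^sup>2 * M" by (intro mult_left_mono) (auto simp: M_def)
    also have "\<dots> = c / M * c" using M by (simp add: power2_eq_square)
    finally have "c / M * c \<le> 0" by simp
    moreover have "c / M * c > 0" using c M by (simp add: zero_less_mult_iff zero_less_divide_iff divide_less_0_iff) linarith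
    ultimately show False by simp
  qed
  with pA show ?thesis using that by blast
qed

end

text \<open>Pointwise real scalars let functions serve as the vectors of \<open>semi_inner\<close>;
  on complex functions they agree with \<open>cscale\<close>.\<close>

instantiation "fun" :: (type, real_vector) real_vector
begin

definition scaleR_fun_def: "r *\<^sub>R f = (\<lambda>x. r *\<^sub>R f x)"

instance
  by standard (auto simp: scaleR_fun_def fun_eq_iff scaleR_add_right scaleR_add_left)

end

lemma scaleR_eq_cscale: "r *\<^sub>R F = cscale (of_real r) F"
  by (simp add: scaleR_fun_def cscale_def scaleR_conv_of_real)

section \<open>\<open>L2\<close> as a semi-inner product space\<close>

lemma L2_D:
  assumes "F \<in> L2 M"
  shows "F \<in> borel_measurable M" "integrable M (\<lambda>x. (cmod (F x))\<^sup>2)"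
  using assms by (auto simp: L2_def)

lemma integrable_product_L2:
  assumes "F \<in> L2 M" "G \<in> L2 M"
  shows "integrable M (\<lambda>x. F x * cnj (G x))"
proof (rule Bochner_Integration.integrable_bound)
  note [measurable] = L2_D(1)[OF assms(1)] L2_D(1)[OF assms(2)]
  show "integrable M (\<lambda>x. (cmod (F x))\<^sup>2 + (cmod (G x))\<^sup>2)" using assms by (auto dest: L2_D)
  have [measurable]: "cnj \<in> borel_measurable borel"
    by (intro borel_measurable_continuous_onI continuous_intros)
  show "(\<lambda>x. F x * cnj (G x)) \<in> borel_measurable M" by measurable
  have "a * b \<le> a\<^sup>2 + b\<^sup>2" for a b :: real
    using sum_squares_bound[of a b] zero_le_power2[of a] zero_le_power2[of b] by linarith
  then show "AE x in M. norm (F x * cnj (G x)) \<le> norm ((cmod (F x))\<^sup>2 + (cmod (G x))\<^sup>2)"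
    by (simp add: norm_mult)
qed

lemma L2_add:
  assumes "F \<in> L2 M" "G \<in> L2 M"
  shows "F + G \<in> L2 M"
proof -
  note [measurable] = L2_D(1)[OF assms(1)] L2_D(1)[OF assms(2)]
  have "integrable M (\<lambda>x. (cmod (F x + G x))\<^sup>2)"
  proof (rule Bochner_Integration.integrable_bound)
    show "integrable M (\<lambda>x. 2 * (cmod (F x))\<^sup>2 + 2 * (cmod (G x))\<^sup>2)"
      using L2_D(2)[OF assms(1)] L2_D(2)[OF assms(2)] by simp
    show "AE x in M. norm ((cmod (F x + G x))\<^sup>2) \<le> norm (2 * (cmod (F x))\<^sup>2 + 2 * (cmod (G x))\<^sup>2)"
    proof (intro AE_I2)
      fix x
      have "(cmod (F x + G x))\<^sup>2 \<le> (cmod (F x) + cmod (G x))\<^sup>2" by (intro power_mono norm_triangle_ineq) auto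
      also have "\<dots> \<le> 2 * (cmod (F x))\<^sup>2 + 2 * (cmod (G x))\<^sup>2"
        using sum_squares_bound[of "cmod (F x)" "cmod (G x)"] by (simp add: power2_sum)
      finally show "norm ((cmod (F x + G x))\<^sup>2) \<le> norm (2 * (cmod (F x))\<^sup>2 + 2 * (cmod (G x))\<^sup>2)" by simp
    qed
  qed measurable
  then show ?thesis by (auto simp: L2_def plus_fun_def)
qed

lemma L2_cscale:
  assumes "F \<in> L2 M"
  shows "cscale c F \<in> L2 M"
  using assms by (auto simp: L2_def cscale_def norm_mult power_mult_distrib)

lemma L2_0: "0 \<in> L2 M"
  by (simp add: L2_def zero_fun_def)

lemma csubspace_L2: "cfun.subspace (L2 M)"
  by (rule cfun.subspaceI) (auto intro: L2_0 L2_add L2_cscale)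

lemma L2_inner_add_left:
  "F \<in> L2 M \<Longrightarrow> G \<in> L2 M \<Longrightarrow> H \<in> L2 M \<Longrightarrow> L2_inner M (F + G) H = L2_inner M F H + L2_inner M G H"
  using integrable_product_L2[of F M H] integrable_product_L2[of G M H]
  by (simp add: L2_inner_def plus_fun_def algebra_simps)

lemma L2_inner_cscale_left: "L2_inner M (cscale c F) G = c * L2_inner M F G"
  by (simp add: L2_inner_def cscale_def mult.assoc)

lemma L2_inner_cscale_right: "L2_inner M F (cscale c G) = cnj c * L2_inner M F G"
  by (simp add: L2_inner_def cscale_def mult.left_commute)

lemma L2_inner_commute: "L2_inner M F G = cnj (L2_inner M G F)"
  unfolding L2_inner_def by (subst Bochner_Integration.integral_cnj[symmetric]) (simp add: mult.commute)

lemma L2_inner_self: "L2_inner M F F = of_real (LINT x|M. (cmod (F x))\<^sup>2)"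
  unfolding L2_inner_def complex_norm_square[symmetric] by (rule integral_complex_of_real)

lemma L2_norm_cscale: "L2_norm M (cscale c F) = cmod c * L2_norm M F"
  by (simp add: L2_norm_def cscale_def norm_mult power_mult_distrib real_sqrt_mult)

global_interpretation L2: semi_inner "L2 M" "\<lambda>F G. Re (L2_inner M F G)" for M
proof
  show "subspace (L2 M)"
    using csubspace_L2[of M] by (auto simp: subspace_def cfun.subspace_def scaleR_eq_cscale)
  show "Re (L2_inner M F G) = Re (L2_inner M G F)" for F G
    by (subst L2_inner_commute) simp
qed (auto simp: L2_inner_add_left scaleR_eq_cscale L2_inner_cscale_left L2_inner_self)

lemma L2_nrm_eq: "L2.nrm M F = L2_norm M F"
  by (simp add: L2.nrm_def L2_norm_def L2_inner_self)

context prob_space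
begin

lemma integral_cmod_le_L2_norm:
  assumes F: "F \<in> L2 M"
  shows "integrable M F" "(LINT x|M. cmod (F x)) \<le> L2_norm M F"
proof -
  note [measurable] = L2_D(1)[OF F]
  have one: "(\<lambda>_. 1) \<in> L2 M" by (simp add: L2_def)
  have A: "(\<lambda>x. of_real (cmod (F x))) \<in> L2 M" using F by (auto simp: L2_def)
  show "integrable M F" using integrable_product_L2[OF F one] by simp
  have "\<bar>Re (L2_inner M (\<lambda>x. of_real (cmod (F x))) (\<lambda>_. 1))\<bar> \<le> L2_norm M (\<lambda>x. of_real (cmod (F x))) * L2_norm M (\<lambda>_. 1)"
    using L2.Cauchy_Schwarz[OF A one] by (simp add: L2_nrm_eq)
  moreover have "Re (L2_inner M (\<lambda>x. of_real (cmod (F x))) (\<lambda>_. 1)) = (LINT x|M. cmod (F x))"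
    by (simp add: L2_inner_def)
  moreover have "L2_norm M (\<lambda>x. of_real (cmod (F x))) = L2_norm M F" "L2_norm M (\<lambda>_. 1) = 1"
    by (simp_all add: L2_norm_def prob_space)
  ultimately show "(LINT x|M. cmod (F x)) \<le> L2_norm M F" by simp
qed

text \<open>On a probability space the sequence is also Cauchy in mean, so a subsequence converges
  almost everywhere. Fatou's lemma bounds the \<open>L2\<close> distance to that limit.\<close>

lemma L2_complete:
  fixes s :: "nat \<Rightarrow> 'a \<Rightarrow> complex"
  assumes s: "\<And>n. s n \<in> L2 M"
    and cauchy: "\<And>e. e > 0 \<Longrightarrow> \<exists>N. \<forall>m\<ge>N. \<forall>n\<ge>N. L2_norm M (s m - s n) < e"
  shows "\<exists>G\<in>L2 M. (\<lambda>n. L2_norm M (s n - G)) \<longlonglongrightarrow> 0"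
proof -
  note [measurable] = L2_D(1)[OF s]
  have "\<exists>N. \<forall>i\<ge>N. \<forall>j\<ge>N. LINT x|M. norm (s i x - s j x) < e" if e: "e > 0" for e
  proof -
    obtain N where N: "\<forall>m\<ge>N. \<forall>n\<ge>N. L2_norm M (s m - s n) < e" using cauchy[OF e] by blast
    have "(LINT x|M. norm (s i x - s j x)) \<le> L2_norm M (s i - s j)" for i j
      using integral_cmod_le_L2_norm(2)[of "s i - s j"] s by (simp add: L2.V_diff)
    with N show ?thesis by (meson order.strict_trans1)
  qed
  then obtain r where r: "strict_mono r" "AE x in M. Cauchy (\<lambda>i. s (r i) x)"
    using cauchy_L1_AE_cauchy_subseq[of M s] integral_cmod_le_L2_norm(1)[OF s] by blast
  define G where "G = (\<lambda>x. lim (\<lambda>i. s (r i) x))"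
  have G_meas [measurable]: "G \<in> borel_measurable M" unfolding G_def by measurable
  have lim: "AE x in M. (\<lambda>i. s (r i) x) \<longlonglongrightarrow> G x"
    using r(2) by eventually_elim (auto simp: G_def Cauchy_convergent_iff convergent_LIMSEQ_iff)
  have key: "s n - G \<in> L2 M \<and> L2_norm M (s n - G) \<le> e"
    if e: "e > 0" and n: "\<forall>m\<ge>N. L2_norm M (s n - s m) < e" for n N e
  proof -
    have "(\<integral>\<^sup>+x. ennreal ((cmod (s n x - G x))\<^sup>2) \<partial>M)
      \<le> (\<integral>\<^sup>+x. liminf (\<lambda>i. ennreal ((cmod (s n x - s (r i) x))\<^sup>2)) \<partial>M)"
    proof (rule nn_integral_mono_AE)
      show "AE x in M. ennreal ((cmod (s n x - G x))\<^sup>2) \<le> liminf (\<lambda>i. ennreal ((cmod (s n x - s (r i) x))\<^sup>2))"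
        using lim
      proof eventually_elim
        case (elim x)
        then have "(\<lambda>i. ennreal ((cmod (s n x - s (r i) x))\<^sup>2)) \<longlonglongrightarrow> ennreal ((cmod (s n x - G x))\<^sup>2)"
          by (intro tendsto_ennrealI tendsto_intros)
        from lim_imp_Liminf[OF trivial_limit_sequentially this] show ?case by (intro eq_refl) simp
      qed
    qed
    also have "\<dots> \<le> liminf (\<lambda>i. \<integral>\<^sup>+x. ennreal ((cmod (s n x - s (r i) x))\<^sup>2) \<partial>M)"
      by (rule nn_integral_liminf) measurable
    also have "\<dots> \<le> liminf (\<lambda>i::nat. ennreal (e\<^sup>2))"
    proof (rule Liminf_mono, rule eventually_sequentiallyI)
      fix i assume "i \<ge> N"
      then have "r i \<ge> N" using r(1) seq_suble[of r i] by simp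
      have d: "s n - s (r i) \<in> L2 M" using s by (simp add: L2.V_diff)
      have "(\<integral>\<^sup>+x. ennreal ((cmod (s n x - s (r i) x))\<^sup>2) \<partial>M) = ennreal (LINT x|M. (cmod (s n x - s (r i) x))\<^sup>2)"
        using L2_D(2)[OF d] by (intro nn_integral_eq_integral) auto
      also have "(LINT x|M. (cmod (s n x - s (r i) x))\<^sup>2) = (L2_norm M (s n - s (r i)))\<^sup>2"
        by (simp add: L2_norm_def)
      also have "ennreal \<dots> \<le> ennreal (e\<^sup>2)"
        using n \<open>r i \<ge> N\<close> by (intro ennreal_leI power_mono) (auto simp: L2_norm_def intro: less_imp_le)
      finally show "(\<integral>\<^sup>+x. ennreal ((cmod (s n x - s (r i) x))\<^sup>2) \<partial>M) \<le> ennreal (e\<^sup>2)" .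
    qed
    also have "\<dots> = ennreal (e\<^sup>2)" by (simp add: Liminf_const)
    finally have le: "(\<integral>\<^sup>+x. ennreal ((cmod (s n x - G x))\<^sup>2) \<partial>M) \<le> ennreal (e\<^sup>2)" .
    then have int: "integrable M (\<lambda>x. (cmod (s n x - G x))\<^sup>2)"
      by (intro integrableI_bounded) (auto intro: le_less_trans)
    then have "s n - G \<in> L2 M" by (auto simp: L2_def fun_diff_def)
    moreover have "(LINT x|M. (cmod (s n x - G x))\<^sup>2) \<le> e\<^sup>2"
      using le int by (subst (asm) nn_integral_eq_integral) (auto simp: ennreal_le_iff)
    then have "L2_norm M (s n - G) \<le> e" using e by (simp add: L2_norm_def real_le_lsqrt)
    ultimately show ?thesis by blast
  qed
  have G: "G \<in> L2 M"
  proof -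
    obtain N where "\<forall>m\<ge>N. \<forall>n\<ge>N. L2_norm M (s m - s n) < 1" using cauchy[of 1] by auto
    then have "s N - G \<in> L2 M" using key[of 1 N N] by auto
    from L2.V_diff[OF s this] have "s N - (s N - G) \<in> L2 M" .
    moreover have "s N - (s N - G) = G" by (simp add: fun_eq_iff)
    ultimately show ?thesis by (simp only:)
  qed
  moreover have "(\<lambda>n. L2_norm M (s n - G)) \<longlonglongrightarrow> 0"
  proof (rule LIMSEQ_I)
    fix e :: real assume e: "e > 0"
    then obtain N where N: "\<forall>m\<ge>N. \<forall>n\<ge>N. L2_norm M (s m - s n) < e / 2" using cauchy[of "e / 2"] by auto
    have "norm (L2_norm M (s n - G) - 0) < e" if "n \<ge> N" for n
      using key[of "e / 2" N n] N that e by (auto simp: L2_norm_def)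
    then show "\<exists>N. \<forall>n\<ge>N. norm (L2_norm M (s n - G) - 0) < e" by blast
  qed
  ultimately show ?thesis by blast
qed

text \<open>The real projection is also the complex one: testing with \<open>cscale \<i> G\<close>,
  which lies in \<open>A\<close> too, removes the imaginary part.\<close>

lemma L2_orthogonal_decomposition:
  assumes A: "closed_L2_subspace M A" and F: "F \<in> L2 M"
  obtains P where "P \<in> A" "\<And>G. G \<in> A \<Longrightarrow> L2_inner M (F - P) G = 0"
proof -
  have A1: "A \<subseteq> L2 M" "cfun.subspace A" "L2_closure M A = A" using A by (auto simp: closed_L2_subspace_def)
  have sub: "subspace A"
    using A1(2) by (auto simp: subspace_def cfun.subspace_def scaleR_eq_cscale)
  obtain P where P: "P \<in> A" "\<And>G. G \<in> A \<Longrightarrow> Re (L2_inner M (F - P) G) = 0"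
  proof (rule L2.exists_orthogonal_projection[OF _ A1(1) sub _ F])
    fix s :: "nat \<Rightarrow> 'a \<Rightarrow> complex"
    assume "\<And>n. s n \<in> L2 M" "\<And>e. e > 0 \<Longrightarrow> \<exists>N. \<forall>m\<ge>N. \<forall>n\<ge>N. L2.nrm M (s m - s n) < e"
    then show "\<exists>y\<in>L2 M. (\<lambda>n. L2.nrm M (s n - y)) \<longlonglongrightarrow> 0"
      unfolding L2_nrm_eq by (rule L2_complete)
  next
    fix y assume "y \<in> L2 M" "\<And>e. e > 0 \<Longrightarrow> \<exists>a\<in>A. L2.nrm M (y - a) < e"
    then have "y \<in> L2_closure M A" by (auto simp: L2_closure_def L2_nrm_eq)
    then show "y \<in> A" using A1(3) by simp
  qed (use that in blast)
  have "L2_inner M (F - P) G = 0" if G: "G \<in> A" for G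
  proof -
    have "cscale \<i> G \<in> A" using A1(2) G by (rule cfun.subspace_scale)
    then have "Re (L2_inner M (F - P) (cscale \<i> G)) = 0" by (rule P(2))
    then have "Im (L2_inner M (F - P) G) = 0" by (simp add: L2_inner_cscale_right)
    with P(2)[OF G] show ?thesis by (simp add: complex_eq_iff)
  qed
  with P(1) show ?thesis using that by blast
qed

end

section \<open>Dirichlet characters\<close>

lemma periodic_cong:
  fixes f :: "nat \<Rightarrow> 'b"
  assumes "\<And>n. f (n + q) = f n" "[m = n] (mod q)"
  shows "f m = f n"
proof -
  have "f (n + k * q) = f n" for k n
    by (induction k) (simp, metis add.assoc add.commute assms(1) mult_Suc)
  then have "f n = f (n mod q)" for n by (metis mod_mult_div_eq mult.commute add.commute)
  with assms(2) show ?thesis unfolding cong_def by metis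
qed

lemma dirichlet_character_1:
  assumes "dirichlet_character q chi"
  shows "chi 1 = 1"
proof -
  have "chi (1 * 1) = chi 1 * chi 1" "chi 1 \<noteq> 0"
    using assms unfolding dirichlet_character_def by (blast, metis coprime_1_left)
  then show ?thesis by simp
qed

lemma dirichlet_character_cong:
  "dirichlet_character q chi \<Longrightarrow> [m = n] (mod q) \<Longrightarrow> chi m = chi n"
  by (rule periodic_cong) (auto simp: dirichlet_character_def)

lemma dirichlet_character_power:
  assumes "dirichlet_character q chi"
  shows "chi (n ^ k) = chi n ^ k"
  using assms dirichlet_character_1[OF assms] by (induction k) (auto simp: dirichlet_character_def)

text \<open>By Euler's theorem \<open>chi n\<close> is a root of unity.\<close>

lemma norm_dirichlet_character:
  assumes "dirichlet_character q chi" "coprime n q"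
  shows "cmod (chi n) = 1"
proof -
  have q: "q \<ge> 1" using assms by (simp add: dirichlet_character_def)
  have "chi n ^ totient q = chi (n ^ totient q)" by (simp add: dirichlet_character_power[OF assms(1)])
  also have "\<dots> = 1"
    using dirichlet_character_cong[OF assms(1) euler_theorem[of n q]] assms(2) dirichlet_character_1[OF assms(1)]
    by (simp add: coprime_commute)
  finally have "cmod (chi n) ^ totient q = 1" by (metis norm_one norm_power)
  moreover have "totient q > 0" using q by simp
  ultimately show ?thesis using power_eq_iff_eq_base[of "totient q" "cmod (chi n)" 1] by simp
qed

lemma dirichlet_character_eq_0: "dirichlet_character q chi \<Longrightarrow> \<not> coprime n q \<Longrightarrow> chi n = 0"
  by (auto simp: dirichlet_character_def)

lemma dirichlet_character_cnj:
  "dirichlet_character q chi \<Longrightarrow> dirichlet_character q (\<lambda>n. cnj (chi n))"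
  by (auto simp: dirichlet_character_def)

lemma finite_range_dirichlet_character:
  assumes "dirichlet_character q chi"
  shows "finite (range chi)"
proof (rule finite_subset)
  have "q \<ge> 1" using assms by (simp add: dirichlet_character_def)
  then have "chi n = chi (n mod q)" "n mod q < q" for n
    using dirichlet_character_cong[OF assms, of n "n mod q"] by (auto simp: cong_def)
  then show "range chi \<subseteq> chi ` {..<q}" by auto
qed simp

definition periodic_on_units :: "nat \<Rightarrow> (nat \<Rightarrow> complex) set" where
  "periodic_on_units q = {f. (\<forall>n. f (n + q) = f n) \<and> (\<forall>n. \<not> coprime n q \<longrightarrow> f n = 0)}"

text \<open>If \<open>A\<close> consists of all residues coprime to \<open>q\<close>, these are the
  scalar multiples of the Dirichlet characters modulo \<open>q\<close>.\<close>

definition translation_eigenfunctions :: "nat \<Rightarrow> nat set \<Rightarrow> (nat \<Rightarrow> complex) set" where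
  "translation_eigenfunctions q A = {f \<in> periodic_on_units q. \<forall>a\<in>A. \<exists>\<omega>. \<forall>n. f (a * n) = \<omega> * f n}"

text \<open>
  The translation \<open>g \<mapsto> (\<lambda>n. g (a * n))\<close> has finite order \<open>k\<close>, so \<open>g\<close> is the sum of its projections to the
  eigenspaces of the \<open>k\<close>-th roots of unity, and these commute with all other translations.
\<close>

lemma translation_eigenfunctions_insert:
  assumes q: "q \<ge> 1" and a: "coprime a q" and g: "g \<in> translation_eigenfunctions q A"
  shows "g \<in> cfun.span (translation_eigenfunctions q (insert a A))"
proof -
  define k where "k = totient q"
  have k: "k \<ge> 1" using q by (simp add: k_def Suc_le_eq)
  define E where "E = (\<lambda>m::nat. exp (2 * of_real pi * \<i> * of_nat m / of_nat k) :: complex)"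
  have E_0: "E 0 = 1" by (simp add: E_def)
  have E_add: "E (m + n) = E m * E n" for m n
    by (simp add: E_def exp_add[symmetric] add_divide_distrib algebra_simps)
  have E_mult: "E (j * i) = E i ^ j" for i j
    by (simp add: E_def exp_of_nat_mult[symmetric] mult_ac)
  have E_k: "E (j * k) = 1" for j
    using complex_root_unity_eq_1[of k "j * k"] k by (simp add: E_def)
  have E_sum: "(\<Sum>j<k. E (j * i)) = (if i = 0 then of_nat k else 0)" if "i < k" for i
  proof (cases "i = 0")
    case True
    then show ?thesis by (simp add: E_def)
  next
    case False
    then have "\<not> k dvd i" using that by (auto dest: dvd_imp_le)
    then have "E i \<noteq> 1" using complex_root_unity_eq_1[of k i] k by (simp add: E_def)
    moreover have "E i ^ k = 1" using E_k[of i] E_mult[of k i] by (simp add: mult.commute)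
    ultimately show ?thesis using False by (simp add: E_mult geometric_sum)
  qed
  have gper: "\<And>n. g (n + q) = g n" and gsupp: "\<And>n. \<not> coprime n q \<Longrightarrow> g n = 0"
    using g by (auto simp: translation_eigenfunctions_def periodic_on_units_def)
  have gk: "g (a ^ k * n) = g n" for n
  proof (rule periodic_cong[of g q, OF gper])
    have "[a ^ k = 1] (mod q)" unfolding k_def using a by (intro euler_theorem)
    then show "[a ^ k * n = n] (mod q)" using cong_scalar_right[of "a ^ k" 1 q n] by simp
  qed
  \<comment> \<open>The projection to the eigenvalue \<open>inverse (E j)\<close>, as a weighted
    mean over the powers of the translation.\<close>
  define gj where "gj = (\<lambda>j n. (1 / of_nat k) * (\<Sum>i<k. E (j * i) * g (a ^ i * n)))"
  have mem: "gj j \<in> translation_eigenfunctions q (insert a A)" for j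
    unfolding translation_eigenfunctions_def periodic_on_units_def
  proof (intro CollectI conjI allI impI ballI)
    fix n
    show "gj j (n + q) = gj j n"
      unfolding gj_def
    proof (intro arg_cong[where f = "\<lambda>z. 1 / of_nat k * z"] sum.cong refl)
      fix i
      have "[a ^ i * (n + q) = a ^ i * n] (mod q)" by (simp add: cong_def distrib_left)
      then show "E (j * i) * g (a ^ i * (n + q)) = E (j * i) * g (a ^ i * n)"
        using periodic_cong[of g q, OF gper] by metis
    qed
  next
    fix n assume "\<not> coprime n q"
    then have "\<not> coprime (a ^ i * n) q" for i by simp
    then show "gj j n = 0" using gsupp by (simp add: gj_def)
  next
    fix b assume b: "b \<in> insert a A"
    show "\<exists>\<omega>. \<forall>n. gj j (b * n) = \<omega> * gj j n"
    proof (cases "b = a")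
      case True
      have "E j * gj j (a * n) = gj j n" for n
      proof -
        define F where "F = (\<lambda>i. E (j * i) * g (a ^ i * n))"
        have "E j * gj j (a * n) = (1 / of_nat k) * (\<Sum>i<k. F (Suc i))"
          by (simp add: gj_def F_def sum_distrib_left E_add mult_ac)
        also have "(\<Sum>i<k. F (Suc i)) = (\<Sum>i<k. F i)"
        proof -
          have "F 0 + (\<Sum>i<k. F (Suc i)) = (\<Sum>i<k. F i) + F k"
            using sum.lessThan_Suc_shift[of F k] by simp
          moreover have "F k = F 0" by (simp add: F_def E_k gk E_0)
          ultimately show ?thesis by simp
        qed
        finally show ?thesis by (simp add: gj_def F_def)
      qed
      moreover have "E j \<noteq> 0" by (simp add: E_def)
      ultimately have "gj j (a * n) = inverse (E j) * gj j n" for n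
        by (metis left_inverse mult.assoc mult_1)
      then show ?thesis using True by blast
    next
      case False
      then obtain \<omega> where \<omega>: "\<And>n. g (b * n) = \<omega> * g n"
        using b g by (auto simp: translation_eigenfunctions_def)
      have "g (a ^ i * (b * n)) = \<omega> * g (a ^ i * n)" for i n
        using \<omega>[of "a ^ i * n"] by (simp add: mult_ac)
      then have eq: "gj j (b * n) = (1 / of_nat k) * (\<Sum>i<k. E (j * i) * (\<omega> * g (a ^ i * n)))" for n
        by (simp only: gj_def)
      have "gj j (b * n) = \<omega> * gj j n" for n
        unfolding eq by (simp add: gj_def sum_distrib_left mult_ac)
      then show ?thesis by blast
    qed
  qed
  \<comment> \<open>Summing the roots of unity over \<open>j\<close> leaves only the term with
    \<open>i = 0\<close>.\<close>
  have "g = (\<Sum>j<k. gj j)"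
  proof
    fix n
    have "(\<Sum>j<k. gj j) n = (\<Sum>j<k. gj j n)" by (induction k) auto
    also have "\<dots> = (1 / of_nat k) * (\<Sum>j<k. \<Sum>i<k. E (j * i) * g (a ^ i * n))"
      by (simp add: gj_def sum_distrib_left)
    also have "(\<Sum>j<k. \<Sum>i<k. E (j * i) * g (a ^ i * n)) = (\<Sum>i<k. \<Sum>j<k. E (j * i) * g (a ^ i * n))"
      by (rule sum.swap)
    also have "\<dots> = (\<Sum>i<k. (\<Sum>j<k. E (j * i)) * g (a ^ i * n))"
      by (simp add: sum_distrib_right)
    also have "\<dots> = (\<Sum>i<k. if i = 0 then of_nat k * g n else 0)"
      by (intro sum.cong refl) (auto simp: E_sum)
    also have "\<dots> = of_nat k * g n" using k by simp
    finally show "g n = (\<Sum>j<k. gj j) n" using k by simp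
  qed
  also have "\<dots> \<in> cfun.span (translation_eigenfunctions q (insert a A))"
    using mem by (intro cfun.span_sum cfun.span_base)
  finally show ?thesis .
qed

text \<open>Adjoining the coprime residues one at a time splits \<open>f\<close> into common
  eigenfunctions. Such a \<open>g\<close> is determined by its value at 1: if that is 0 then
  \<open>g\<close> vanishes, otherwise \<open>g / g 1\<close> is multiplicative.\<close>

lemma periodic_on_units_in_span_dirichlet_characters:
  assumes q: "q \<ge> 1" and f: "f \<in> periodic_on_units q"
  shows "f \<in> cfun.span {chi. dirichlet_character q chi}"
proof -
  have step: "f \<in> cfun.span (translation_eigenfunctions q A)" if "finite A" "\<forall>a\<in>A. coprime a q" for A
    using that
  proof (induction A rule: finite_induct)
    case empty
    then show ?case using f by (intro cfun.span_base) (simp add: translation_eigenfunctions_def)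
  next
    case (insert a A)
    have "translation_eigenfunctions q A \<subseteq> cfun.span (translation_eigenfunctions q (insert a A))"
      using translation_eigenfunctions_insert[OF q] insert.prems by auto
    then have "cfun.span (translation_eigenfunctions q A) \<subseteq> cfun.span (translation_eigenfunctions q (insert a A))"
      by (rule cfun.span_minimal) (rule cfun.subspace_span)
    then show ?case using insert by auto
  qed
  define A where "A = {a. a < q \<and> coprime a q}"
  have "translation_eigenfunctions q A \<subseteq> cfun.span {chi. dirichlet_character q chi}"
  proof
    fix g assume g: "g \<in> translation_eigenfunctions q A"
    have gper: "\<And>n. g (n + q) = g n" and gsupp: "\<And>n. \<not> coprime n q \<Longrightarrow> g n = 0"
      using g by (auto simp: translation_eigenfunctions_def periodic_on_units_def)
    have eig: "\<exists>\<omega>. \<forall>n. g (a * n) = \<omega> * g n" if "coprime a q" for a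
    proof -
      have "a mod q \<in> A" using that q by (simp add: A_def)
      then obtain \<omega> where "\<And>n. g (a mod q * n) = \<omega> * g n"
        using g by (auto simp: translation_eigenfunctions_def)
      moreover have "g (a mod q * n) = g (a * n)" for n
        by (rule periodic_cong[of g q, OF gper]) (simp add: cong_def mod_mult_left_eq)
      ultimately show ?thesis by auto
    qed
    show "g \<in> cfun.span {chi. dirichlet_character q chi}"
    proof (cases "g 1 = 0")
      case True
      have "g n = 0" for n
      proof (cases "coprime n q")
        case True
        with eig[OF True] \<open>g 1 = 0\<close> show ?thesis by (metis mult.right_neutral mult_zero_right)
      qed (use gsupp in auto)
      then have "g = 0" by (simp add: fun_eq_iff)
      then show ?thesis by (simp add: cfun.span_zero)
    next
      case False
      define chi where "chi = (\<lambda>n. g n / g 1)"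
      have mult: "chi (m * n) = chi m * chi n" for m n
      proof (cases "coprime m q")
        case True
        obtain \<omega> where \<omega>: "\<And>n. g (m * n) = \<omega> * g n" using eig[OF True] by blast
        show ?thesis using \<omega>[of n] \<omega>[of 1] False by (simp add: chi_def)
      qed (use gsupp in \<open>simp add: chi_def\<close>)
      have nz: "chi n \<noteq> 0" if n: "coprime n q" for n
      proof -
        obtain m where "[n * m = 1] (mod q)" using cong_solve_coprime_nat[OF n] by auto
        then have "chi (n * m) = chi 1" using periodic_cong[of g q, OF gper] by (simp add: chi_def)
        then have "chi n * chi m = 1" using False by (simp add: mult[symmetric]) (simp add: chi_def)
        then show ?thesis by auto
      qed
      have "dirichlet_character q chi"
        unfolding dirichlet_character_def using q mult nz gsupp gper by (auto simp: chi_def)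
      moreover have "g = cscale (g 1) chi" using False by (simp add: cscale_def chi_def fun_eq_iff)
      ultimately show ?thesis by (metis cfun.span_base cfun.span_scale mem_Collect_eq)
    qed
  qed
  then have "cfun.span (translation_eigenfunctions q A) \<subseteq> cfun.span {chi. dirichlet_character q chi}"
    by (rule cfun.span_minimal) (rule cfun.subspace_span)
  moreover have "f \<in> cfun.span (translation_eigenfunctions q A)" by (rule step) (auto simp: A_def)
  ultimately show ?thesis by auto
qed

section \<open>The decomposition\<close>

lemma L2_norm_nonneg [simp]: "0 \<le> L2_norm M F"
  by (simp add: L2_norm_def)

lemma L2_norm_cong: "(\<And>x. x \<in> space M \<Longrightarrow> F x = G x) \<Longrightarrow> L2_norm M F = L2_norm M G"
  unfolding L2_norm_def by (intro arg_cong[where f = sqrt] Bochner_Integration.integral_cong) auto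

lemma L2_cong:
  assumes "\<And>x. x \<in> space M \<Longrightarrow> F x = G x"
  shows "F \<in> L2 M \<longleftrightarrow> G \<in> L2 M"
proof -
  have "F \<in> borel_measurable M \<longleftrightarrow> G \<in> borel_measurable M" by (rule measurable_cong) (rule assms)
  moreover have "integrable M (\<lambda>x. (cmod (F x))\<^sup>2) \<longleftrightarrow> integrable M (\<lambda>x. (cmod (G x))\<^sup>2)"
    by (rule Bochner_Integration.integrable_cong) (auto simp: assms)
  ultimately show ?thesis by (simp add: L2_def)
qed

lemma L2_inner_cong:
  "(\<And>x. x \<in> space M \<Longrightarrow> F x = F' x) \<Longrightarrow> (\<And>x. x \<in> space M \<Longrightarrow> G x = G' x) \<Longrightarrow>
    L2_inner M F G = L2_inner M F' G'"
  unfolding L2_inner_def by (intro Bochner_Integration.integral_cong) auto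

lemma L2_inner_diff_left:
  "F \<in> L2 M \<Longrightarrow> G \<in> L2 M \<Longrightarrow> H \<in> L2 M \<Longrightarrow> L2_inner M (F - G) H = L2_inner M F H - L2_inner M G H"
  using L2_inner_add_left[of "F - G" M G H] L2.V_diff[of F M G] by simp

lemma L2_inner_add_right:
  "F \<in> L2 M \<Longrightarrow> G \<in> L2 M \<Longrightarrow> H \<in> L2 M \<Longrightarrow> L2_inner M H (F + G) = L2_inner M H F + L2_inner M H G"
  using L2_inner_add_left[of F M G H] by (metis L2_inner_commute complex_cnj_add)

lemma L2_inner_diff_right:
  "F \<in> L2 M \<Longrightarrow> G \<in> L2 M \<Longrightarrow> H \<in> L2 M \<Longrightarrow> L2_inner M H (F - G) = L2_inner M H F - L2_inner M H G"
  using L2_inner_diff_left[of F M G H] by (metis L2_inner_commute complex_cnj_diff)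

lemmas L2_sum = L2.V_sum
lemmas L2_norm_triangle = L2.nrm_triangle[unfolded L2_nrm_eq]
lemmas L2_norm_triangle_sub = L2.nrm_triangle_sub[unfolded L2_nrm_eq]
lemmas L2_norm_minus_commute = L2.nrm_minus_commute[unfolded L2_nrm_eq]
lemmas L2_norm_sum_le = L2.nrm_sum_le[unfolded L2_nrm_eq]

lemma L2_inner_sum_right:
  assumes "finite I" "\<And>i. i \<in> I \<Longrightarrow> f i \<in> L2 M" "H \<in> L2 M"
  shows "L2_inner M H (\<Sum>i\<in>I. f i) = (\<Sum>i\<in>I. L2_inner M H (f i))"
  using assms
proof (induction I rule: finite_induct)
  case empty
  then show ?case by (simp add: L2_inner_def zero_fun_def)
next
  case (insert i I)
  have "L2_inner M H (f i + (\<Sum>i\<in>I. f i)) = L2_inner M H (f i) + L2_inner M H (\<Sum>i\<in>I. f i)"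
    by (rule L2_inner_add_right) (use insert in \<open>auto intro: L2_sum\<close>)
  moreover have "L2_inner M H (\<Sum>i\<in>I. f i) = (\<Sum>i\<in>I. L2_inner M H (f i))"
    by (rule insert.IH) (use insert.prems in auto)
  ultimately show ?case by (simp only: sum.insert[OF insert.hyps(1,2)])
qed

text \<open>A unimodular factor makes the inner product real and nonnegative, which reduces the
  claim to the real case.\<close>

lemma L2_Cauchy_Schwarz:
  assumes "F \<in> L2 M" "G \<in> L2 M"
  shows "cmod (L2_inner M F G) \<le> L2_norm M F * L2_norm M G"
proof -
  define z where "z = L2_inner M F G"
  show ?thesis
  proof (cases "z = 0")
    case False
    define u where "u = cnj z / of_real (cmod z)"
    have u: "cmod u = 1" using False by (simp add: u_def norm_divide)
    have "u * z = of_real (cmod z)"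
      using False by (simp add: u_def mult.commute complex_norm_square[symmetric] power2_eq_square)
    then have "cmod z = Re (L2_inner M (cscale u F) G)" by (simp add: L2_inner_cscale_left z_def)
    also have "\<dots> \<le> L2_norm M (cscale u F) * L2_norm M G"
      using L2.Cauchy_Schwarz[of "cscale u F" M G] L2_cscale[OF assms(1)] assms(2) by (simp add: L2_nrm_eq)
    finally show ?thesis using u by (simp add: L2_norm_cscale z_def)
  qed (simp add: z_def)
qed

lemma L2_norm_0 [simp]: "L2_norm M 0 = 0"
  by (simp add: L2_norm_def)

lemma L2_closureD:
  assumes "F \<in> L2_closure M A" "e > 0"
  obtains G where "G \<in> A" "L2_norm M (F - G) < e"
  using assms unfolding L2_closure_def by blast

lemma subset_L2_closure:
  assumes "A \<subseteq> L2 M"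
  shows "A \<subseteq> L2_closure M A"
proof
  fix F assume "F \<in> A"
  then show "F \<in> L2_closure M A" using assms by (auto simp: L2_closure_def intro!: bexI[of _ F])
qed

lemma closed_L2_subspace_closure:
  assumes A: "A \<subseteq> L2 M" "cfun.subspace A"
  shows "closed_L2_subspace M (L2_closure M A)"
proof -
  have sub: "L2_closure M A \<subseteq> L2 M" by (auto simp: L2_closure_def)
  have "cfun.subspace (L2_closure M A)"
  proof (rule cfun.subspaceI)
    show "0 \<in> L2_closure M A"
      using cfun.subspace_0[OF A(2)] by (auto simp: L2_closure_def L2_0 intro!: bexI[of _ 0])
    fix F G assume FG: "F \<in> L2_closure M A" "G \<in> L2_closure M A"
    show "F + G \<in> L2_closure M A"
      unfolding L2_closure_def
    proof (intro CollectI conjI allI impI)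
      fix e :: real assume "e > 0"
      then have e2: "e / 2 > 0" by simp
      obtain F' where F': "F' \<in> A" "L2_norm M (F - F') < e / 2" using FG(1) e2 by (rule L2_closureD)
      obtain G' where G': "G' \<in> A" "L2_norm M (G - G') < e / 2" using FG(2) e2 by (rule L2_closureD)
      note FG' = F'(1) G'(1) F'(2) G'(2)
      have "L2_norm M ((F - F') + (G - G')) \<le> L2_norm M (F - F') + L2_norm M (G - G')"
        using FG FG' A sub by (intro L2_norm_triangle L2.V_diff) auto
      then have "L2_norm M (F + G - (F' + G')) < e" using FG' by (simp add: algebra_simps)
      then show "\<exists>G'\<in>A. L2_norm M (F + G - G') < e" using FG' cfun.subspace_add[OF A(2)] by blast
    qed (use FG sub in \<open>auto intro: L2_add\<close>)
  next
    fix c F assume F: "F \<in> L2_closure M A"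
    show "cscale c F \<in> L2_closure M A"
      unfolding L2_closure_def
    proof (intro CollectI conjI allI impI)
      fix e :: real assume e: "e > 0"
      then have "e / (cmod c + 1) > 0" by (simp add: add_nonneg_pos)
      with F obtain F' where F': "F' \<in> A" "L2_norm M (F - F') < e / (cmod c + 1)"
        by (rule L2_closureD)
      have "L2_norm M (cscale c F - cscale c F') = cmod c * L2_norm M (F - F')"
        by (simp add: L2_norm_cscale[symmetric] cfun.scale_right_diff_distrib)
      also have "\<dots> \<le> (cmod c + 1) * L2_norm M (F - F')" by (intro mult_right_mono) auto
      also have "\<dots> < (cmod c + 1) * (e / (cmod c + 1))"
        using F'(2) by (intro mult_strict_left_mono) (auto intro: add_nonneg_pos)
      also have "\<dots> = e" using norm_ge_zero[of c] by (simp add: add_nonneg_eq_0_iff)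
      finally show "\<exists>G\<in>A. L2_norm M (cscale c F - G) < e" using F' cfun.subspace_scale[OF A(2)] by blast
    qed (use F sub in \<open>auto intro: L2_cscale\<close>)
  qed
  moreover have "L2_closure M (L2_closure M A) = L2_closure M A"
  proof
    show "L2_closure M (L2_closure M A) \<subseteq> L2_closure M A"
    proof
      fix F assume F: "F \<in> L2_closure M (L2_closure M A)"
      show "F \<in> L2_closure M A"
        unfolding L2_closure_def
      proof (intro CollectI conjI allI impI)
        show FL: "F \<in> L2 M" using F by (simp add: L2_closure_def)
        fix e :: real assume "e > 0"
        then have e2: "e / 2 > 0" by simp
        obtain F1 where F1: "F1 \<in> L2_closure M A" "L2_norm M (F - F1) < e / 2" using F e2 by (rule L2_closureD)
        obtain F2 where F2: "F2 \<in> A" "L2_norm M (F1 - F2) < e / 2" using F1(1) e2 by (rule L2_closureD)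
        have "L2_norm M (F - F2) \<le> L2_norm M (F - F1) + L2_norm M (F1 - F2)"
          using FL F1 F2 A sub by (intro L2_norm_triangle_sub) auto
        then show "\<exists>G\<in>A. L2_norm M (F - G) < e" using F1 F2 by (intro bexI[of _ F2]) auto
      qed
    qed
    show "L2_closure M A \<subseteq> L2_closure M (L2_closure M A)"
      using sub by (rule subset_L2_closure)
  qed
  ultimately show ?thesis using sub by (simp add: closed_L2_subspace_def)
qed

lemma span_subset_L2: "A \<subseteq> L2 M \<Longrightarrow> cfun.span A \<subseteq> L2 M"
  by (rule cfun.span_minimal) (auto simp: csubspace_L2)

section \<open>The action on \<open>L2\<close> and its twists by weights\<close>

context multiplicative_system
begin

lemma S_in_space: "n \<ge> 1 \<Longrightarrow> x \<in> space M \<Longrightarrow> S n x \<in> space M"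
  using measurable_space[OF measurable] .

lemma integral_comp_S:
  fixes f :: "'a \<Rightarrow> 'b::{banach, second_countable_topology}"
  assumes "n \<ge> 1" "f \<in> borel_measurable M"
  shows "(LINT x|M. f (S n x)) = (LINT x|M. f x)"
  using integral_distr[OF measurable[OF assms(1)] assms(2)] measure_preserving[OF assms(1)] by simp

lemma comp_S_L2:
  assumes "n \<ge> 1" "F \<in> L2 M"
  shows "F \<circ> S n \<in> L2 M"
proof -
  note [measurable] = measurable[OF assms(1)] L2_D(1)[OF assms(2)]
  have "integrable (distr M M (S n)) (\<lambda>x. (cmod (F x))\<^sup>2)"
    using measure_preserving[OF assms(1)] L2_D(2)[OF assms(2)] by simp
  then have "integrable M (\<lambda>x. (cmod (F (S n x)))\<^sup>2)"
    by (rule integrable_distr[OF measurable[OF assms(1)]])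
  moreover have "F \<circ> S n \<in> borel_measurable M" by (rule measurable_comp[OF measurable[OF assms(1)] L2_D(1)[OF assms(2)]])
  ultimately show ?thesis by (simp add: L2_def)
qed

lemma L2_norm_comp_S:
  assumes "n \<ge> 1" "F \<in> L2 M"
  shows "L2_norm M (F \<circ> S n) = L2_norm M F"
proof -
  note [measurable] = L2_D(1)[OF assms(2)]
  show ?thesis
    using integral_comp_S[OF assms(1), of "\<lambda>x. (cmod (F x))\<^sup>2"] by (simp add: L2_norm_def)
qed

lemma L2_inner_comp_S:
  assumes "n \<ge> 1" "F \<in> L2 M" "G \<in> L2 M"
  shows "L2_inner M (F \<circ> S n) (G \<circ> S n) = L2_inner M F G"
  using integral_comp_S[OF assms(1), of "\<lambda>x. F x * cnj (G x)"]
    borel_measurable_integrable[OF integrable_product_L2[OF assms(2,3)]] by (simp add: L2_inner_def)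

text \<open>The value 0 off the carrier makes \<open>twist f n F\<close> depend only on
  \<open>S n\<close> restricted to the carrier. Multiplicativity and finite generation, which
  concern the carrier alone, thereby become statements about operators.\<close>

definition twist :: "(nat \<Rightarrow> complex) \<Rightarrow> nat \<Rightarrow> ('a \<Rightarrow> complex) \<Rightarrow> 'a \<Rightarrow> complex" where
  "twist f n F = (\<lambda>x. if x \<in> space M then f n * F (S n x) else 0)"

lemma twist_eq: "x \<in> space M \<Longrightarrow> twist f n F x = cscale (f n) (F \<circ> S n) x"
  by (simp add: twist_def cscale_def)

lemma twist_L2: "n \<ge> 1 \<Longrightarrow> F \<in> L2 M \<Longrightarrow> twist f n F \<in> L2 M"
  using L2_cong[of M "twist f n F" "cscale (f n) (F \<circ> S n)"] by (simp add: twist_eq L2_cscale comp_S_L2)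

lemma twist_cscale: "twist f n (cscale c F) = cscale c (twist f n F)"
  by (auto simp: twist_def cscale_def)

end

lemma sum_fun_apply: "(\<Sum>i\<in>I. f i) x = (\<Sum>i\<in>I. f i x)"
  by (induction I rule: infinite_finite_induct) auto

lemma summable_on_finite_UN:
  fixes f :: "'a \<Rightarrow> real"
  assumes "finite I" "\<And>i. i \<in> I \<Longrightarrow> f summable_on A i"
  shows "f summable_on (\<Union>i\<in>I. A i)"
  using assms by (induction I rule: finite_induct) (auto intro: summable_on_union)

definition (in multiplicative_system) twisted_mean :: "(nat \<Rightarrow> complex) \<Rightarrow> ('a \<Rightarrow> complex) \<Rightarrow> nat \<Rightarrow> real" where
  "twisted_mean f F N = L2_norm M (cscale (1 / of_nat N) (\<Sum>n=1..N. cscale (f n) (F \<circ> S n)))"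

context finitely_generated_multiplicative_system
begin

lemma multiplicative_operators_twist:
  assumes chi: "dirichlet_character q chi"
  shows "multiplicative_operators (L2 M) (\<lambda>F G. Re (L2_inner M F G)) (twist chi) q"
proof
  show "q > 0" using chi by (simp add: dirichlet_character_def)
  fix n :: nat assume n: "n > 0"
  show "twist chi n (F + G) = twist chi n F + twist chi n G" for F G
    by (auto simp: twist_def fun_eq_iff algebra_simps)
  show "twist chi n (r *\<^sub>R F) = r *\<^sub>R twist chi n F" for r F
    by (auto simp: twist_def scaleR_fun_def fun_eq_iff)
  show "twist chi n F \<in> L2 M" if "F \<in> L2 M" for F using twist_L2[of n F chi] n that by simp
  show "twist chi (m * n) F = twist chi m (twist chi n F)" if m: "m > 0" for m F
  proof
    fix x
    show "twist chi (m * n) F x = twist chi m (twist chi n F) x"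
    proof (cases "x \<in> space M")
      case True
      \<comment> \<open>Composing functions with the maps reverses their order, hence the appeal to
        commutativity.\<close>
      have "S (m * n) x = S n (S m x)"
        using multiplicative[of m n x] commute[of m n x] True m n by simp
      moreover have "chi (m * n) = chi m * chi n" using chi by (simp add: dirichlet_character_def)
      ultimately show ?thesis using True m S_in_space[of m x] by (simp add: twist_def)
    qed (simp add: twist_def)
  qed
  show "Re (L2_inner M (twist chi n F) (twist chi n G)) = Re (L2_inner M F G)"
    if "coprime n q" "F \<in> L2 M" "G \<in> L2 M" for F G
  proof -
    have "L2_inner M (twist chi n F) (twist chi n G) = L2_inner M (cscale (chi n) (F \<circ> S n)) (cscale (chi n) (G \<circ> S n))"
      by (rule L2_inner_cong) (auto simp: twist_eq)
    also have "\<dots> = chi n * cnj (chi n) * L2_inner M F G"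
      using n that by (simp add: L2_inner_cscale_left L2_inner_cscale_right L2_inner_comp_S)
    also have "chi n * cnj (chi n) = 1"
      using norm_dirichlet_character[OF chi that(1)] complex_norm_square[of "chi n"] by simp
    finally show ?thesis by simp
  qed
  show "twist chi n F = 0" if "\<not> coprime n q" for F
    using dirichlet_character_eq_0[OF chi that] by (simp add: twist_def fun_eq_iff)
next
  \<comment> \<open>The twisted operator is a function of the restricted map and of the character
    value, both of which take finitely many values at primes.\<close>
  define op where "op = (\<lambda>(s :: 'a \<Rightarrow> 'a, c) (F :: 'a \<Rightarrow> complex) x. if x \<in> space M then c * F (s x) else 0)"
  have "twist chi p = op (restrict (S p) (space M), chi p)" for p
    by (auto simp: op_def twist_def fun_eq_iff)
  then have "{twist chi p |p. prime p} \<subseteq> op ` ({restrict (S p) (space M) |p. prime p} \<times> range chi)"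
    by auto
  moreover have "finite ({restrict (S p) (space M) |p. prime p} \<times> range chi)"
    using finitely_generated finite_range_dirichlet_character[OF chi] by simp
  ultimately show "finite {twist chi p |p. prime p}" by (meson finite_imageI finite_subset)
qed

lemma twisted_mean_eq_avg:
  "twisted_mean chi F N = L2_norm M (multiplicative_operators.avg (twist chi) (real N) F)"
  if "dirichlet_character q chi"
proof -
  interpret U: multiplicative_operators "L2 M" "\<lambda>F G. Re (L2_inner M F G)" "twist chi" q
    using that by (rule multiplicative_operators_twist)
  have "nats_le (real N) = {1..N}" by (auto simp: mem_nats_le)
  then show ?thesis
    unfolding twisted_mean_def U.avg_def scaleR_eq_cscale
    by (intro L2_norm_cong) (simp add: cscale_def sum_fun_apply twist_def)
qed

text \<open>
  A vector that is orthogonal to all \<open>U p G - G\<close>, for the operators \<open>U p\<close> that are attained on a set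
  of primes with divergent reciprocal sum, is fixed by these operators and hence lies in
  \<open>H_char\<close>. So a vector orthogonal to \<open>H_char\<close> is a limit of sums of such \<open>U p G - G\<close>.
\<close>

lemma twisted_mean_tendsto_0:
  assumes chi: "dirichlet_character q chi" and F: "F \<in> L2 M"
    and orth: "\<And>G. G \<in> H_char M S (\<lambda>n. cnj (chi n)) \<Longrightarrow> L2_inner M F G = 0"
  shows "twisted_mean chi F \<longlonglongrightarrow> 0"
proof -
  interpret U: multiplicative_operators "L2 M" "\<lambda>F G. Re (L2_inner M F G)" "twist chi" q
    using chi by (rule multiplicative_operators_twist)
  define B where "B = {F \<in> L2 M. ((\<lambda>x. L2_norm M (U.avg x F)) \<longlongrightarrow> 0) at_top}"
  define I where "I = {p. prime p \<and> coprime p q \<and> \<not> (\<lambda>p'. 1 / real p') summable_on {p'. prime p' \<and> twist chi p' = twist chi p}}"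
  define R where "R = {twist chi p G - G | p G. p \<in> I \<and> G \<in> L2 M}"
  have RL: "R \<subseteq> L2 M" by (auto simp: R_def I_def prime_gt_0_nat intro!: L2.V_diff U.U_in_V)
  define A where "A = L2_closure M (cfun.span R)"
  have A: "closed_L2_subspace M A"
    unfolding A_def by (intro closed_L2_subspace_closure span_subset_L2 RL cfun.subspace_span)
  have AL: "A \<subseteq> L2 M" using A by (simp add: closed_L2_subspace_def)
  have avg_add: "U.avg x (F + G) = U.avg x F + U.avg x G" for x F G
  proof -
    have "twist chi n (F + G) = twist chi n F + twist chi n G" for n
      by (auto simp: twist_def fun_eq_iff algebra_simps)
    then show ?thesis by (simp only: U.avg_def sum.distrib scaleR_add_right)
  qed
  have avg_cscale: "U.avg x (cscale c F) = cscale c (U.avg x F)" for x c F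
    by (simp only: U.avg_def twist_cscale cfun.scale_sum_right[symmetric] scaleR_eq_cscale cfun.scale_left_commute)
  have "cfun.subspace B"
  proof (rule cfun.subspaceI)
    have "U.avg x 0 = 0" for x using avg_cscale[of x 0 0] by (simp only: cfun.scale_zero_left)
    then show "0 \<in> B" by (simp add: B_def L2_0)
  next
    fix F G assume "F \<in> B" "G \<in> B"
    then have FG: "F \<in> L2 M" "G \<in> L2 M" and lim: "((\<lambda>x. L2_norm M (U.avg x F) + L2_norm M (U.avg x G)) \<longlongrightarrow> 0) at_top"
      using tendsto_add[of "\<lambda>x. L2_norm M (U.avg x F)" 0 at_top "\<lambda>x. L2_norm M (U.avg x G)" 0] by (auto simp: B_def)
    have "((\<lambda>x. L2_norm M (U.avg x (F + G))) \<longlongrightarrow> 0) at_top"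
      by (rule tendsto_sandwich[OF _ _ tendsto_const lim])
         (use FG in \<open>auto simp: avg_add intro!: always_eventually L2_norm_triangle U.avg_in_V\<close>)
    then show "F + G \<in> B" using FG by (simp add: B_def L2_add)
  next
    fix c F assume "F \<in> B"
    then show "cscale c F \<in> B"
      using tendsto_mult_left[of "\<lambda>x. L2_norm M (U.avg x F)" 0 at_top "cmod c"]
      by (auto simp: B_def avg_cscale L2_norm_cscale L2_cscale)
  qed
  moreover have "R \<subseteq> B"
  proof
    fix H assume "H \<in> R"
    then obtain p G where H: "H = twist chi p G - G" "p \<in> I" "G \<in> L2 M" by (auto simp: R_def)
    then have "((\<lambda>x. L2.nrm M (U.avg x H)) \<longlongrightarrow> 0) at_top"
      unfolding H(1) by (intro U.avg_coboundary_tendsto_0) (auto simp: I_def)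
    then show "H \<in> B" using \<open>H \<in> R\<close> RL by (auto simp: B_def L2_nrm_eq)
  qed
  ultimately have spanB: "cfun.span R \<subseteq> B" by (intro cfun.span_minimal)
  \<comment> \<open>The averages are contractions uniformly in \<open>x\<close>, so \<open>B\<close>
    is closed.\<close>
  have closure: "H \<in> B" if H: "H \<in> L2 M" and appr: "\<And>e. e > 0 \<Longrightarrow> \<exists>H'\<in>B. L2_norm M (H - H') < e" for H
  proof -
    have "((\<lambda>x. L2_norm M (U.avg x H)) \<longlongrightarrow> 0) at_top"
    proof (rule tendstoI)
      fix e :: real assume e: "e > 0"
      then obtain H' where H': "H' \<in> B" "L2_norm M (H - H') < e / 2" using appr[of "e / 2"] by auto
      have "eventually (\<lambda>x. L2_norm M (U.avg x H') < e / 2) at_top"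
        using H'(1) e by (auto simp: B_def dest: order_tendstoD(2)[of _ 0 _ "e / 2"])
      with eventually_gt_at_top[of 0] show "eventually (\<lambda>x. dist (L2_norm M (U.avg x H)) 0 < e) at_top"
      proof eventually_elim
        case (elim x)
        have H'L: "H' \<in> L2 M" using H' by (simp add: B_def)
        have "L2_norm M (U.avg x (H - H')) \<le> L2_norm M (H - H')"
          using U.nrm_avg_le[of "H - H'" x] elim H H'L by (simp add: L2_nrm_eq L2.V_diff)
        moreover have "L2_norm M (U.avg x H) \<le> L2_norm M (U.avg x H') + L2_norm M (U.avg x H - U.avg x H')"
          using L2.nrm_le_add_diff[of "U.avg x H" M "U.avg x H'"] H H'L by (simp add: L2_nrm_eq U.avg_in_V)
        ultimately show ?case using elim H'(2) by (simp add: U.avg_diff)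
      qed
    qed
    then show ?thesis using H by (simp add: B_def)
  qed
  obtain P where P: "P \<in> A" "\<And>G. G \<in> A \<Longrightarrow> L2_inner M (F - P) G = 0"
    using L2_orthogonal_decomposition[OF A F] by blast
  define Q where "Q = F - P"
  have PL: "P \<in> L2 M" using P AL by blast
  then have QL: "Q \<in> L2 M" using F by (simp add: Q_def L2.V_diff)
  have fixed: "L2_norm M (twist chi p Q - Q) = 0" if p: "p \<in> I" for p
  proof -
    have p0: "p > 0" "coprime p q" using p by (auto simp: I_def prime_gt_0_nat)
    define T where "T = twist chi p Q"
    have TL: "T \<in> L2 M" using QL p0 by (simp add: T_def U.U_in_V)
    have "T - Q \<in> R" using p QL by (auto simp: R_def T_def)
    then have "T - Q \<in> A" unfolding A_def using subset_L2_closure[OF span_subset_L2[OF RL]] cfun.span_base by blast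
    then have "L2_inner M Q (T - Q) = 0" unfolding Q_def by (rule P(2))
    then have "L2_inner M Q T = L2_inner M Q Q" using QL TL by (simp add: L2_inner_diff_right)
    \<comment> \<open>Orthogonality of \<open>Q\<close> to \<open>T - Q\<close> turns the squared
      distance into a difference of squared norms, which are equal as \<open>twist chi p\<close> is
      an isometry.\<close>
    then have "(L2.nrm M (Q - T))\<^sup>2 = (L2.nrm M T)\<^sup>2 - (L2.nrm M Q)\<^sup>2"
      using QL TL L2.nrm_sq_diff[of Q M T] L2.nrm_sq[of Q M] by simp
    also have "L2.nrm M T = L2.nrm M Q" unfolding T_def using p0 QL by (intro U.nrm_U)
    finally have "(L2.nrm M (Q - T))\<^sup>2 = 0" by (simp only: diff_self)
    then have "L2_norm M (Q - T) = 0" by (simp only: power_eq_0_iff L2_nrm_eq)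
    then show ?thesis using L2_norm_minus_commute[OF QL TL] by (simp add: T_def)
  qed
  have "Q \<in> H_char M S (\<lambda>n. cnj (chi n))"
  proof -
    define f where "f = (\<lambda>p. (L2_norm M ((Q \<circ> S p) - cscale (cnj (chi p)) Q))\<^sup>2 / real p)"
    \<comment> \<open>Multiplying \<open>twist chi p Q - Q\<close> by the conjugate of
      \<open>chi p\<close> gives the defect in \<open>H_char\<close>; this is why
      \<open>orth\<close> speaks of the conjugate character.\<close>
    have f_eq: "f p = (L2_norm M (twist chi p Q - Q))\<^sup>2 * (1 / real p)" if p: "prime p" "coprime p q" for p
    proof -
      have c: "cmod (chi p) = 1" by (rule norm_dirichlet_character[OF chi p(2)])
      then have "cnj (chi p) * chi p = 1" using complex_norm_square[of "chi p"] by (simp add: mult.commute)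
      then have "L2_norm M ((Q \<circ> S p) - cscale (cnj (chi p)) Q) = L2_norm M (cscale (cnj (chi p)) (twist chi p Q - Q))"
        by (intro L2_norm_cong) (simp add: twist_def cscale_def right_diff_distrib mult.assoc[symmetric])
      then show ?thesis using c by (simp add: f_def L2_norm_cscale)
    qed
    \<comment> \<open>On primes with a common operator the defect is constant. Either it is 0 by
      \<open>fixed\<close> or the reciprocals are summable, and there are finitely many such
      classes.\<close>
    define PP where "PP = (\<lambda>T. {p. prime p \<and> coprime p q \<and> twist chi p = T})"
    have "f summable_on PP T" if T: "T \<in> {twist chi p | p. prime p}" for T
    proof (cases "\<exists>p\<in>I. twist chi p = T")
      case True
      then have "f p = 0" if "p \<in> PP T" for p using f_eq[of p] fixed that by (auto simp: PP_def)
      then show ?thesis by (simp cong: summable_on_cong)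
    next
      case False
      show ?thesis
      proof (cases "PP T = {}")
        case False
        then obtain p where p: "prime p" "coprime p q" "twist chi p = T" by (auto simp: PP_def)
        then have "(\<lambda>p'. 1 / real p') summable_on {p'. prime p' \<and> twist chi p' = T}"
          using \<open>\<not> (\<exists>p\<in>I. twist chi p = T)\<close> by (auto simp: I_def)
        then have "(\<lambda>p'. 1 / real p') summable_on PP T"
          by (rule summable_on_subset) (auto simp: PP_def)
        then have "(\<lambda>p'. (L2_norm M (T Q - Q))\<^sup>2 * (1 / real p')) summable_on PP T"
          by (rule summable_on_cmult_right)
        then show ?thesis
          by (rule summable_on_cong[THEN iffD1, rotated]) (auto simp: PP_def f_eq)
      qed auto
    qed
    then have "f summable_on (\<Union>T\<in>{twist chi p | p. prime p}. PP T)"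
      using U.finite_U by (intro summable_on_finite_UN)
    moreover have "f summable_on {p. prime p \<and> \<not> coprime p q}"
    proof (rule summable_on_finite, rule finite_subset)
      show "{p. prime p \<and> \<not> coprime p q} \<subseteq> {..q}"
        using U.q_pos by (auto dest: prime_imp_coprime dvd_imp_le)
    qed simp
    ultimately have "f summable_on ((\<Union>T\<in>{twist chi p | p. prime p}. PP T) \<union> {p. prime p \<and> \<not> coprime p q})"
      by (rule summable_on_union)
    also have "(\<Union>T\<in>{twist chi p | p. prime p}. PP T) \<union> {p. prime p \<and> \<not> coprime p q} = {p. prime p}"
      by (auto simp: PP_def)
    finally show ?thesis using QL by (simp add: H_char_def f_def)
  qed
  then have "L2_inner M F Q = 0" by (rule orth)
  moreover have "L2_inner M P Q = 0"
    using P(2)[OF P(1)] L2_inner_commute[of M P Q] by (simp add: Q_def)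
  ultimately have "L2_inner M Q Q = 0" using F PL QL by (simp add: L2_inner_diff_left Q_def)
  then have Q0: "L2_norm M Q = 0" by (simp add: L2_norm_def L2_inner_self)
  have "F \<in> B"
  proof (rule closure[OF F])
    fix e :: real assume "e > 0"
    have "P \<in> B"
    proof (rule closure[OF PL])
      fix e :: real assume "e > 0"
      with P(1) obtain G where "G \<in> cfun.span R" "L2_norm M (P - G) < e" unfolding A_def by (rule L2_closureD)
      then show "\<exists>H'\<in>B. L2_norm M (P - H') < e" using spanB by blast
    qed
    then show "\<exists>H'\<in>B. L2_norm M (F - H') < e" 
      using Q0 \<open>e > 0\<close> by (intro bexI[of _ P]) (simp_all add: Q_def)
  qed
  then have "((\<lambda>x. L2_norm M (U.avg x F)) \<longlongrightarrow> 0) at_top" by (simp add: B_def)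
  then have "((\<lambda>N. L2_norm M (U.avg (real N) F)) \<longlongrightarrow> 0) sequentially"
    by (rule filterlim_compose) (rule filterlim_real_sequentially)
  moreover have "twisted_mean chi F = (\<lambda>N. L2_norm M (U.avg (real N) F))"
    by (rule ext) (rule twisted_mean_eq_avg[OF chi])
  ultimately show ?thesis by (simp only:)
qed

end

section \<open>Reduction of arithmetic progressions to periodic weights\<close>

context multiplicative_system
begin

lemma twisted_sum_L2: "F \<in> L2 M \<Longrightarrow> (\<Sum>n=1..N. cscale (f n) (F \<circ> S n)) \<in> L2 M"
  by (intro L2_sum L2_cscale comp_S_L2) auto

lemma twisted_mean_span_tendsto_0:
  assumes F: "F \<in> L2 M" and A: "\<And>f. f \<in> A \<Longrightarrow> twisted_mean f F \<longlonglongrightarrow> 0" and f: "f \<in> cfun.span A"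
  shows "twisted_mean f F \<longlonglongrightarrow> 0"
proof -
  define W where "W = (\<lambda>f N. cscale (1 / of_nat N) (\<Sum>n=1..N. cscale (f n) (F \<circ> S n)))"
  have W_L2: "W f N \<in> L2 M" for f N unfolding W_def by (intro L2_cscale twisted_sum_L2 F)
  have W_add: "W (f + g) N = W f N + W g N" for f g N
  proof -
    have "cscale ((f + g) n) (F \<circ> S n) = cscale (f n) (F \<circ> S n) + cscale (g n) (F \<circ> S n)" for n
      by (simp add: cscale_def fun_eq_iff algebra_simps)
    then show ?thesis by (simp only: W_def sum.distrib cfun.scale_right_distrib)
  qed
  have W_scale: "W (cscale c f) N = cscale c (W f N)" for c f N
  proof -
    have "cscale (cscale c f n) (F \<circ> S n) = cscale c (cscale (f n) (F \<circ> S n))" for n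
      by (simp add: cscale_def fun_eq_iff)
    then show ?thesis by (simp only: W_def cfun.scale_sum_right[symmetric] cfun.scale_left_commute)
  qed
  have mean: "twisted_mean f F N = L2_norm M (W f N)" for f N by (simp add: twisted_mean_def W_def)
  define B where "B = {f. (\<lambda>N. L2_norm M (W f N)) \<longlonglongrightarrow> 0}"
  have B_iff: "f \<in> B \<longleftrightarrow> twisted_mean f F \<longlonglongrightarrow> 0" for f
    unfolding B_def mem_Collect_eq mean[symmetric] ..
  have "cfun.subspace B"
  proof (rule cfun.subspaceI)
    have "W 0 N = 0" for N using W_scale[of 0 0 N] by (simp only: cfun.scale_zero_left)
    then show "0 \<in> B" by (simp add: B_def)
  next
    fix f g assume "f \<in> B" "g \<in> B"
    then have lim: "(\<lambda>N. L2_norm M (W f N) + L2_norm M (W g N)) \<longlonglongrightarrow> 0"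
      using tendsto_add[of "\<lambda>N. L2_norm M (W f N)" 0 sequentially "\<lambda>N. L2_norm M (W g N)" 0] by (simp add: B_def)
    have "(\<lambda>N. L2_norm M (W (f + g) N)) \<longlonglongrightarrow> 0"
      unfolding W_add
      by (rule tendsto_sandwich[OF _ _ tendsto_const lim])
         (intro always_eventually allI L2_norm_nonneg L2_norm_triangle W_L2)+
    then show "f + g \<in> B" by (simp only: B_def mem_Collect_eq)
  next
    fix c f assume "f \<in> B"
    then show "cscale c f \<in> B"
      using tendsto_mult_left[of "\<lambda>N. L2_norm M (W f N)" 0 sequentially "cmod c"]
      by (simp add: B_def W_scale L2_norm_cscale)
  qed
  moreover have "A \<subseteq> B" using A by (simp add: B_iff subset_iff)
  ultimately have "cfun.span A \<subseteq> B" by (intro cfun.span_minimal)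
  with f show ?thesis using B_iff by blast
qed

text \<open>With \<open>d = gcd q r\<close>, the isometry given by \<open>S d\<close> can be split
  off, which leaves a progression with coprime \<open>q'\<close> and \<open>r'\<close>. The
  indicator of \<open>r'\<close> modulo \<open>q'\<close> is then supported on units, and its
  twisted mean up to \<open>q' * N + r'\<close> contains the progression and boundedly many further
  terms.\<close>

lemma H_aper_reduction:
  assumes F: "F \<in> L2 M"
    and per: "\<And>q f. q \<ge> 1 \<Longrightarrow> f \<in> periodic_on_units q \<Longrightarrow> twisted_mean f F \<longlonglongrightarrow> 0"
  shows "F \<in> H_aper M S"
  unfolding H_aper_def
proof (intro CollectI conjI allI impI)
  show "F \<in> L2 M" by (rule F)
  fix r q :: nat assume rq: "1 \<le> r" "1 \<le> q"
  define d where "d = gcd q r"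
  define q' where "q' = q div d"
  define r' where "r' = r div d"
  have d: "d \<ge> 1" using rq by (simp add: d_def Suc_le_eq)
  have q: "q = q' * d" and r: "r = r' * d" by (simp_all add: q'_def r'_def d_def)
  have q'1: "q' \<ge> 1" and r'1: "r' \<ge> 1" using q r rq by (auto simp: Suc_le_eq)
  have cop: "coprime r' q'" unfolding q'_def r'_def d_def using rq
    by (metis coprime_commute div_gcd_coprime not_one_le_zero)
  define f where "f = (\<lambda>m. if [m = r'] (mod q') then 1 else 0 :: complex)"
  have "f \<in> periodic_on_units q'"
    unfolding periodic_on_units_def
  proof (intro CollectI conjI allI impI)
    show "f (n + q') = f n" for n by (simp add: f_def cong_def)
    show "f n = 0" if "\<not> coprime n q'" for n
      using that cop cong_imp_coprime[OF cong_sym, of n r' q'] by (auto simp: f_def)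
  qed
  then have lim: "twisted_mean f F \<longlonglongrightarrow> 0" by (rule per[OF q'1])
  have bound: "L2_norm M (cscale (1 / of_nat N) (\<Sum>n=1..N. F \<circ> S (q * n + r)))
      \<le> real (q' + r') * twisted_mean f F (q' * N + r') + real r' * L2_norm M F / real N" if N: "N \<ge> 1" for N
  proof -
    define H where "H = (\<Sum>n=1..N. F \<circ> S (q' * n + r'))"
    \<comment> \<open>The terms with \<open>m \<le> r'\<close>, among them the member
      \<open>n = 0\<close> of the progression, which the sum from \<open>n = 1\<close>
      omits.\<close>
    define E where "E = (\<Sum>m\<in>{m\<in>{1..r'}. [m = r'] (mod q')}. F \<circ> S m)"
    define W where "W = (\<Sum>m=1..q' * N + r'. cscale (f m) (F \<circ> S m))"
    have HL: "H \<in> L2 M" unfolding H_def using F r'1 by (intro L2_sum comp_S_L2) auto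
    have EL: "E \<in> L2 M" unfolding E_def using F by (intro L2_sum comp_S_L2) auto
    have WL: "W \<in> L2 M" unfolding W_def by (rule twisted_sum_L2[OF F])
    have "(\<Sum>n=1..N. F \<circ> S (q * n + r)) x = (H \<circ> S d) x" if x: "x \<in> space M" for x
      unfolding H_def o_apply sum_fun_apply
    proof (intro sum.cong refl)
      fix n
      have "q * n + r = (q' * n + r') * d" by (simp add: q r algebra_simps)
      then show "F (S (q * n + r) x) = F (S (q' * n + r') (S d x))"
        using multiplicative[of "q' * n + r'" d x] d r'1 x by simp
    qed
    then have "L2_norm M (cscale (1 / of_nat N) (\<Sum>n=1..N. F \<circ> S (q * n + r))) = L2_norm M (cscale (1 / of_nat N) (H \<circ> S d))"
      by (intro L2_norm_cong) (simp add: cscale_def)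
    also have "\<dots> = L2_norm M H / real N"
      using L2_norm_comp_S[OF d HL] by (simp add: L2_norm_cscale norm_divide)
    finally have 1: "L2_norm M (cscale (1 / of_nat N) (\<Sum>n=1..N. F \<circ> S (q * n + r))) = L2_norm M H / real N" .
    have "W = (\<Sum>m\<in>{m\<in>{1..q' * N + r'}. [m = r'] (mod q')}. F \<circ> S m)"
    proof -
      have "cscale (f m) (F \<circ> S m) = (if [m = r'] (mod q') then F \<circ> S m else 0)" for m
        by (simp add: f_def)
      then show ?thesis unfolding W_def by (simp only: sum.inter_filter[OF finite_atLeastAtMost])
    qed
    also have "{m\<in>{1..q' * N + r'}. [m = r'] (mod q')} = {m\<in>{1..r'}. [m = r'] (mod q')} \<union> (\<lambda>n. q' * n + r') ` {1..N}"
    proof (intro equalityI subsetI)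
      fix m assume m: "m \<in> {m\<in>{1..q' * N + r'}. [m = r'] (mod q')}"
      show "m \<in> {m\<in>{1..r'}. [m = r'] (mod q')} \<union> (\<lambda>n. q' * n + r') ` {1..N}"
      proof (cases "m \<le> r'")
        case False
        then have "q' dvd m - r'" using m by (auto simp: cong_altdef_nat)
        then obtain n where n: "m - r' = q' * n" by (elim dvdE)
        then have mn: "m = q' * n + r'" using False by simp
        moreover have "n \<noteq> 0" using mn False by (intro notI) simp
        moreover have "n \<le> N" using m mn q'1 by simp
        ultimately show ?thesis by auto
      qed (use m in auto)
    next
      fix m assume "m \<in> {m\<in>{1..r'}. [m = r'] (mod q')} \<union> (\<lambda>n. q' * n + r') ` {1..N}"
      then show "m \<in> {m\<in>{1..q' * N + r'}. [m = r'] (mod q')}"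
        using r'1 by (auto simp: cong_def)
    qed
    also have "(\<Sum>m\<in>\<dots>. F \<circ> S m) = E + (\<Sum>m\<in>(\<lambda>n. q' * n + r') ` {1..N}. F \<circ> S m)"
      unfolding E_def using q'1 by (intro sum.union_disjoint) auto
    also have "(\<Sum>m\<in>(\<lambda>n. q' * n + r') ` {1..N}. F \<circ> S m) = H"
      unfolding H_def using q'1 by (subst sum.reindex) (auto simp: inj_on_def)
    finally have W: "W = E + H" .
    have "L2_norm M E \<le> (\<Sum>m\<in>{m\<in>{1..r'}. [m = r'] (mod q')}. L2_norm M (F \<circ> S m))"
      unfolding E_def using F by (intro L2_norm_sum_le comp_S_L2) auto
    also have "\<dots> = (\<Sum>m\<in>{m\<in>{1..r'}. [m = r'] (mod q')}. L2_norm M F)"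
      using F by (intro sum.cong refl L2_norm_comp_S) auto
    also have "\<dots> \<le> (\<Sum>m\<in>{1..r'}. L2_norm M F)" by (intro sum_mono2) auto
    finally have E: "L2_norm M E \<le> real r' * L2_norm M F" by simp
    have "L2_norm M H = L2_norm M (W - E)" by (simp add: W)
    also have "\<dots> \<le> L2_norm M W + L2_norm M E"
      using L2.nrm_diff_le[OF WL EL] by (simp only: L2_nrm_eq)
    finally have 2: "L2_norm M H \<le> L2_norm M W + real r' * L2_norm M F" using E by simp
    have "twisted_mean f F (q' * N + r') = L2_norm M W / real (q' * N + r')"
      unfolding twisted_mean_def W_def[symmetric] by (simp only: L2_norm_cscale) (simp add: norm_divide flip: of_nat_mult of_nat_add)
    moreover have "real (q' * N + r') \<noteq> 0" using r'1 by (simp only: of_nat_eq_0_iff)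
    ultimately have W_eq: "L2_norm M W = real (q' * N + r') * twisted_mean f F (q' * N + r')"
      by (simp del: of_nat_add of_nat_mult)
    have "real (q' * N + r') \<le> real (q' + r') * real N"
    proof -
      have "q' * N + r' \<le> (q' + r') * N" using N mult_le_mono2[of 1 N r'] by (simp add: algebra_simps)
      then show ?thesis by (metis of_nat_le_iff of_nat_mult)
    qed
    moreover have "twisted_mean f F (q' * N + r') \<ge> 0" by (simp add: twisted_mean_def)
    ultimately have "L2_norm M W \<le> real (q' + r') * real N * twisted_mean f F (q' * N + r')"
      unfolding W_eq by (rule mult_right_mono)
    with 2 have "L2_norm M H / real N \<le> (real (q' + r') * real N * twisted_mean f F (q' * N + r') + real r' * L2_norm M F) / real N"
      by (intro divide_right_mono) auto
    also have "\<dots> = real (q' + r') * twisted_mean f F (q' * N + r') + real r' * L2_norm M F / real N"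
      using N by (simp add: add_divide_distrib)
    finally show ?thesis unfolding 1 .
  qed
  have "filterlim (\<lambda>N. q' * N + r') sequentially sequentially"
    using q'1 by (intro filterlim_subseq) (auto simp: strict_mono_def)
  then have "(\<lambda>N. twisted_mean f F (q' * N + r')) \<longlonglongrightarrow> 0" by (rule filterlim_compose[OF lim])
  then have "(\<lambda>N. real (q' + r') * twisted_mean f F (q' * N + r') + real r' * L2_norm M F / real N) \<longlonglongrightarrow> real (q' + r') * 0 + 0"
    by (intro tendsto_add tendsto_mult tendsto_const lim_const_over_n)
  then have lim2: "(\<lambda>N. real (q' + r') * twisted_mean f F (q' * N + r') + real r' * L2_norm M F / real N) \<longlonglongrightarrow> 0" by simp
  show "(\<lambda>N. L2_norm M (cscale (1 / of_nat N) (\<Sum>n=1..N. F \<circ> S (q * n + r)))) \<longlonglongrightarrow> 0"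
    by (rule tendsto_sandwich[OF _ eventually_sequentiallyI[OF bound] tendsto_const lim2]) simp_all
qed

text \<open>The means are linear contractions of \<open>F\<close> for every \<open>N\<close>, so
  convergence to 0 passes to limits.\<close>

lemma closed_H_aper: "closed_L2_subspace M (H_aper M S)"
proof -
  define mean where "mean = (\<lambda>q r N F. cscale (1 / of_nat N) (\<Sum>n=1..N. F \<circ> S (q * n + r)))"
  have mem: "F \<in> H_aper M S \<longleftrightarrow> F \<in> L2 M \<and> (\<forall>r\<ge>1. \<forall>q\<ge>1. (\<lambda>N. L2_norm M (mean q r N F)) \<longlonglongrightarrow> 0)" for F
    by (simp add: H_aper_def mean_def)
  have mean_L2: "mean q r N F \<in> L2 M" if "r \<ge> 1" "F \<in> L2 M" for q r N F
    unfolding mean_def using that by (intro L2_cscale L2_sum comp_S_L2) auto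
  have mean_add: "mean q r N (F + G) = mean q r N F + mean q r N G" for q r N F G
  proof -
    have "(F + G) \<circ> S n = (F \<circ> S n) + (G \<circ> S n)" for n by (simp add: fun_eq_iff)
    then show ?thesis by (simp only: mean_def sum.distrib cfun.scale_right_distrib)
  qed
  have mean_scale: "mean q r N (cscale c F) = cscale c (mean q r N F)" for q r N c F
  proof -
    have "cscale c F \<circ> S n = cscale c (F \<circ> S n)" for n by (simp add: cscale_def fun_eq_iff)
    then show ?thesis by (simp only: mean_def cfun.scale_sum_right[symmetric] cfun.scale_left_commute)
  qed
  have mean_le: "L2_norm M (mean q r N F) \<le> L2_norm M F" if "r \<ge> 1" "F \<in> L2 M" for q r N F
  proof (cases "N = 0")
    case False
    have "L2_norm M (\<Sum>n=1..N. F \<circ> S (q * n + r)) \<le> (\<Sum>n=1..N. L2_norm M (F \<circ> S (q * n + r)))"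
      using that by (intro L2_norm_sum_le comp_S_L2) auto
    also have "\<dots> = (\<Sum>n=1..N. L2_norm M F)"
      using that by (intro sum.cong refl L2_norm_comp_S) auto
    finally show ?thesis using False
      by (simp add: mean_def L2_norm_cscale norm_divide field_simps)
  qed (simp add: mean_def)
  have sub: "H_aper M S \<subseteq> L2 M" by (auto simp: mem)
  have "cfun.subspace (H_aper M S)"
  proof (rule cfun.subspaceI)
    have "mean q r N 0 = 0" for q r N using mean_scale[of q r N 0 0] by (simp only: cfun.scale_zero_left)
    then show "0 \<in> H_aper M S" by (simp add: mem L2_0)
  next
    fix F G assume FG: "F \<in> H_aper M S" "G \<in> H_aper M S"
    have "(\<lambda>N. L2_norm M (mean q r N (F + G))) \<longlonglongrightarrow> 0" if qr: "r \<ge> 1" "q \<ge> 1" for q r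
    proof -
      have lim: "(\<lambda>N. L2_norm M (mean q r N F) + L2_norm M (mean q r N G)) \<longlonglongrightarrow> 0"
        using tendsto_add[of "\<lambda>N. L2_norm M (mean q r N F)" 0 sequentially "\<lambda>N. L2_norm M (mean q r N G)" 0] FG qr
        by (simp add: mem)
      have FG': "F \<in> L2 M" "G \<in> L2 M" using FG sub by auto
      show ?thesis
        unfolding mean_add
        by (rule tendsto_sandwich[OF _ _ tendsto_const lim])
           (intro always_eventually allI L2_norm_nonneg L2_norm_triangle mean_L2 qr FG')+
    qed
    then show "F + G \<in> H_aper M S" using FG sub unfolding mem by (blast intro: L2_add)
  next
    fix c F assume F: "F \<in> H_aper M S"
    have "(\<lambda>N. L2_norm M (mean q r N (cscale c F))) \<longlonglongrightarrow> 0" if qr: "r \<ge> 1" "q \<ge> 1" for q r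
      using tendsto_mult_left[of "\<lambda>N. L2_norm M (mean q r N F)" 0 sequentially "cmod c"] F qr
      by (simp add: mem mean_scale L2_norm_cscale)
    then show "cscale c F \<in> H_aper M S" using F sub unfolding mem by (blast intro: L2_cscale)
  qed
  moreover have "L2_closure M (H_aper M S) \<subseteq> H_aper M S"
  proof
    fix F assume F: "F \<in> L2_closure M (H_aper M S)"
    then have FL: "F \<in> L2 M" by (simp add: L2_closure_def)
    have "(\<lambda>N. L2_norm M (mean q r N F)) \<longlonglongrightarrow> 0" if qr: "r \<ge> 1" "q \<ge> 1" for q r
    proof (rule tendstoI)
      fix e :: real assume e: "e > 0"
      then have e2: "e / 2 > 0" by simp
      obtain G where G: "G \<in> H_aper M S" "L2_norm M (F - G) < e / 2" using F e2 by (rule L2_closureD)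
      have GL: "G \<in> L2 M" using G sub by blast
      have "(\<lambda>N. L2_norm M (mean q r N G)) \<longlonglongrightarrow> 0" using G(1) qr by (simp add: mem)
      then have "eventually (\<lambda>N. L2_norm M (mean q r N G) < e / 2) sequentially"
        using e2 by (rule order_tendstoD(2))
      then show "eventually (\<lambda>N. dist (L2_norm M (mean q r N F)) 0 < e) sequentially"
      proof eventually_elim
        case (elim N)
        have "mean q r N F = mean q r N (F - G) + mean q r N G" unfolding mean_add[symmetric] by simp
        then have "L2_norm M (mean q r N F) \<le> L2_norm M (mean q r N (F - G)) + L2_norm M (mean q r N G)"
          using L2_norm_triangle[of "mean q r N (F - G)" M "mean q r N G"] qr FL GL by (simp only: mean_L2 L2.V_diff)
        also have "L2_norm M (mean q r N (F - G)) \<le> L2_norm M (F - G)"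
          using qr FL GL by (intro mean_le L2.V_diff)
        finally show ?case using elim G(2) by simp
      qed
    qed
    then show "F \<in> H_aper M S" using FL by (simp add: mem)
  qed
  ultimately show ?thesis using sub subset_L2_closure[OF sub] unfolding closed_L2_subspace_def by blast
qed

end

section \<open>The orthogonal complement of \<open>H_pr_rat\<close>\<close>

lemma closed_H_pr_rat: "closed_L2_subspace M (H_pr_rat M S)"
  unfolding H_pr_rat_def
  by (intro closed_L2_subspace_closure span_subset_L2 cfun.subspace_span) (auto simp: H_char_def)

lemma H_char_subset_H_pr_rat:
  assumes "dirichlet_character q chi"
  shows "H_char M S chi \<subseteq> H_pr_rat M S"
proof -
  let ?U = "\<Union>chi\<in>{chi. \<exists>q. dirichlet_character q chi}. H_char M S chi"
  have "H_char M S chi \<subseteq> ?U" using assms by blast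
  also have "\<dots> \<subseteq> cfun.span ?U" by (rule cfun.span_superset)
  also have "\<dots> \<subseteq> H_pr_rat M S"
    unfolding H_pr_rat_def by (intro subset_L2_closure span_subset_L2) (auto simp: H_char_def)
  finally show ?thesis .
qed

text \<open>Conjugates of characters are characters, so orthogonality to \<open>H_pr_rat\<close>
  supplies the hypothesis of \<open>twisted_mean_tendsto_0\<close> for every
  \<open>chi\<close>.\<close>

lemma (in finitely_generated_multiplicative_system) orthogonal_to_H_pr_rat_imp_H_aper:
  assumes F: "F \<in> L2 M" and orth: "\<And>G. G \<in> H_pr_rat M S \<Longrightarrow> L2_inner M F G = 0"
  shows "F \<in> H_aper M S"
proof (rule H_aper_reduction[OF F])
  fix q f assume q: "q \<ge> (1::nat)" "f \<in> periodic_on_units q"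
  show "twisted_mean f F \<longlonglongrightarrow> 0"
  proof (rule twisted_mean_span_tendsto_0[OF F _ periodic_on_units_in_span_dirichlet_characters[OF q]])
    fix chi assume "chi \<in> {chi. dirichlet_character q chi}"
    then have chi: "dirichlet_character q chi" by simp
    show "twisted_mean chi F \<longlonglongrightarrow> 0"
    proof (rule twisted_mean_tendsto_0[OF chi F])
      fix G assume "G \<in> H_char M S (\<lambda>n. cnj (chi n))"
      then have "G \<in> H_pr_rat M S" using H_char_subset_H_pr_rat[OF dirichlet_character_cnj[OF chi]] by blast
      then show "L2_inner M F G = 0" by (rule orth)
    qed
  qed
qed

section \<open>Orthogonality of \<open>H_pr_rat\<close> and \<open>H_aper\<close>\<close>

lemma summable_on_small_tail:
  fixes f :: "'a \<Rightarrow> real"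
  assumes f: "f summable_on E" "\<And>x. x \<in> E \<Longrightarrow> 0 \<le> f x" and e: "e > 0"
  obtains E1 where "finite E1" "E1 \<subseteq> E" "\<And>X. finite X \<Longrightarrow> X \<subseteq> E - E1 \<Longrightarrow> sum f X \<le> e"
proof -
  obtain E1 where E1: "finite E1" "E1 \<subseteq> E" "dist (sum f E1) (infsum f E) \<le> e"
    using infsum_finite_approximation[OF f(1) e] by blast
  have "sum f X \<le> e" if X: "finite X" "X \<subseteq> E - E1" for X
  proof -
    have "sum f (E1 \<union> X) \<le> infsum f E"
      using E1 X f by (intro finite_sum_le_infsum) auto
    moreover have "sum f (E1 \<union> X) = sum f E1 + sum f X"
      using E1 X by (intro sum.union_disjoint) auto
    ultimately show ?thesis using E1(3) by (simp add: dist_real_def)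
  qed
  with E1 show ?thesis using that by blast
qed

text \<open>As \<open>Q\<close> is invertible modulo \<open>p\<close>, the condition fixes the
  residue of \<open>k\<close> modulo \<open>p\<close>, so \<open>k\<close> is determined by
  \<open>k div p\<close>.\<close>

lemma card_progression_multiples_le:
  assumes p: "prime p" "\<not> p dvd Q"
  shows "card {k\<in>{1..N}. p dvd Q * k + 1} \<le> N div p + 1"
proof -
  let ?T = "{k\<in>{1..N}. p dvd Q * k + 1}"
  have cop: "coprime Q p" using prime_imp_coprime[OF p] by (simp add: coprime_commute)
  have "inj_on (\<lambda>k. k div p) ?T"
  proof (rule inj_onI)
    fix k l assume kl: "k \<in> ?T" "l \<in> ?T" "k div p = l div p"
    then have "[Q * k + 1 = Q * l + 1] (mod p)" by (simp add: cong_def dvd_eq_mod_eq_0)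
    then have "[Q * k = Q * l] (mod p)" by (simp only: cong_add_rcancel_nat)
    then have "[k = l] (mod p)" using cop by (simp only: cong_mult_lcancel_nat)
    then show "k = l" using kl(3) by (metis cong_def div_mult_mod_eq)
  qed
  then have "card ?T = card ((\<lambda>k. k div p) ` ?T)" by (simp add: card_image)
  also have "\<dots> \<le> card {0..N div p}" by (intro card_mono) (auto intro: div_le_mono)
  finally show ?thesis by simp
qed

text \<open>A prime up to \<open>N\<close> excludes at most \<open>2 * N / p\<close> values of
  \<open>k\<close>. A prime between \<open>N\<close> and \<open>Q * N + 1\<close> excludes at most
  one, and \<open>1 \<le> (Q + 1) * N / p\<close>; for large \<open>N\<close> the tail of the
  reciprocals absorbs the factor \<open>Q + 1\<close>. The set \<open>E1\<close> is chosen before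
  \<open>Q\<close>, which will be built from it.\<close>

lemma few_progression_terms_with_exceptional_prime:
  assumes E: "(\<lambda>p. 1 / real p) summable_on E" "\<And>p. p \<in> E \<Longrightarrow> prime p" and e: "e > 0"
  obtains E1 where "finite E1" "E1 \<subseteq> E"
    "\<And>Q. (\<And>p. p \<in> E - E1 \<Longrightarrow> \<not> p dvd Q) \<Longrightarrow>
      \<exists>N0. \<forall>N\<ge>N0. real (card {k\<in>{1..N}. \<exists>p\<in>E - E1. p dvd Q * k + 1}) \<le> 3 * e * real N"
proof -
  obtain E1 where E1: "finite E1" "E1 \<subseteq> E" "\<And>X. finite X \<Longrightarrow> X \<subseteq> E - E1 \<Longrightarrow> (\<Sum>p\<in>X. 1 / real p) \<le> e"
    by (rule summable_on_small_tail[OF E(1) _ e]) auto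
  have "\<exists>N0. \<forall>N\<ge>N0. real (card {k\<in>{1..N}. \<exists>p\<in>E - E1. p dvd Q * k + 1}) \<le> 3 * e * real N"
    if Q: "\<And>p. p \<in> E - E1 \<Longrightarrow> \<not> p dvd Q" for Q
  proof -
    have "e / (real Q + 1) > 0" using e by simp
    from summable_on_small_tail[OF E(1) _ this]
    obtain E3 where E3: "finite E3" "E3 \<subseteq> E"
      "\<And>X. finite X \<Longrightarrow> X \<subseteq> E - E3 \<Longrightarrow> (\<Sum>p\<in>X. 1 / real p) \<le> e / (real Q + 1)"
      by auto
    have N0: "p \<le> Max E3" if "p \<in> E3" for p using E3(1) that by (rule Max_ge)
    define N0 where "N0 = Max E3"
    have "real (card {k\<in>{1..N}. \<exists>p\<in>E - E1. p dvd Q * k + 1}) \<le> 3 * e * real N" if N: "N \<ge> max N0 1" for N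
    proof -
      define T where "T = (\<lambda>p. {k\<in>{1..N}. p dvd Q * k + 1})"
      define X1 where "X1 = {p\<in>E - E1. p \<le> N}"
      define X2 where "X2 = {p\<in>E - E1. N < p \<and> p \<le> Q * N + 1}"
      have fin: "finite X1" "finite X2" by (auto simp: X1_def X2_def)
      have cT: "card (T p) \<le> N div p + 1" if "p \<in> E - E1" for p
        unfolding T_def using that E(2) Q by (intro card_progression_multiples_le) auto
      have "{k\<in>{1..N}. \<exists>p\<in>E - E1. p dvd Q * k + 1} \<subseteq> (\<Union>p\<in>X1 \<union> X2. T p)"
      proof
        fix k assume "k \<in> {k\<in>{1..N}. \<exists>p\<in>E - E1. p dvd Q * k + 1}"
        then obtain p where k: "k \<in> {1..N}" "p \<in> E - E1" "p dvd Q * k + 1" by blast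
        have "p \<le> Q * k + 1" using k(3) by (intro dvd_imp_le) auto
        also have "\<dots> \<le> Q * N + 1" using k(1) by simp
        finally have "p \<in> X1 \<union> X2" using k(2) by (auto simp: X1_def X2_def)
        then show "k \<in> (\<Union>p\<in>X1 \<union> X2. T p)" using k by (auto simp: T_def)
      qed
      then have "card {k\<in>{1..N}. \<exists>p\<in>E - E1. p dvd Q * k + 1} \<le> card (\<Union>p\<in>X1 \<union> X2. T p)"
        using fin by (intro card_mono) (auto simp: T_def)
      also have "\<dots> \<le> (\<Sum>p\<in>X1 \<union> X2. card (T p))" using fin by (intro card_UN_le) auto
      also have "\<dots> = (\<Sum>p\<in>X1. card (T p)) + (\<Sum>p\<in>X2. card (T p))"
        using fin by (intro sum.union_disjoint) (auto simp: X1_def X2_def)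
      finally have "real (card {k\<in>{1..N}. \<exists>p\<in>E - E1. p dvd Q * k + 1})
        \<le> real ((\<Sum>p\<in>X1. card (T p)) + (\<Sum>p\<in>X2. card (T p)))"
        by (simp only: of_nat_le_iff)
      also have "\<dots> = (\<Sum>p\<in>X1. real (card (T p))) + (\<Sum>p\<in>X2. real (card (T p)))" by simp
      also have "(\<Sum>p\<in>X1. real (card (T p))) \<le> (\<Sum>p\<in>X1. 2 * real N * (1 / real p))"
      proof (rule sum_mono)
        fix p assume p: "p \<in> X1"
        then have pp: "p > 0" "p \<le> N" "p \<in> E - E1" using E(2) prime_gt_0_nat by (auto simp: X1_def)
        have "real (card (T p)) \<le> real (N div p) + 1" using cT[OF pp(3)] by simp
        also have "\<dots> \<le> real N / real p + 1" by (simp add: of_nat_div_le_of_nat)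
        also have "\<dots> \<le> 2 * real N * (1 / real p)" using pp by (simp add: field_simps)
        finally show "real (card (T p)) \<le> 2 * real N * (1 / real p)" .
      qed
      also have "(\<Sum>p\<in>X2. real (card (T p))) \<le> (\<Sum>p\<in>X2. (real Q + 1) * real N * (1 / real p))"
      proof (rule sum_mono)
        fix p assume p: "p \<in> X2"
        then have pp: "N < p" "p \<le> Q * N + 1" "p \<in> E - E1" by (auto simp: X2_def)
        have "real (card (T p)) \<le> 1" using cT[OF pp(3)] pp(1) by simp
        also have "real p \<le> real (Q * N + 1)" using pp(2) by (simp only: of_nat_le_iff)
        then have "real p \<le> (real Q + 1) * real N" using N by (simp add: algebra_simps)
        then have "1 \<le> (real Q + 1) * real N * (1 / real p)" using pp(1) by (simp add: field_simps)
        finally show "real (card (T p)) \<le> (real Q + 1) * real N * (1 / real p)" by simp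
      qed
      also have "(\<Sum>p\<in>X1. 2 * real N * (1 / real p)) \<le> 2 * real N * e"
        unfolding sum_distrib_left[symmetric] using fin by (intro mult_left_mono E1) (auto simp: X1_def)
      also have "(\<Sum>p\<in>X2. (real Q + 1) * real N * (1 / real p)) \<le> (real Q + 1) * real N * (e / (real Q + 1))"
        unfolding sum_distrib_left[symmetric]
      proof (intro mult_left_mono E3 fin)
        show "X2 \<subseteq> E - E3" using N0 N by (fastforce simp: X2_def N0_def)
      qed auto
      also have "2 * real N * e + (real Q + 1) * real N * (e / (real Q + 1)) = 3 * e * real N"
        by (simp add: field_simps)
      finally show ?thesis by simp
    qed
    then show ?thesis by blast
  qed
  with E1(1,2) show ?thesis using that by blast
qed

text \<open>Primes are split off one at a time; composing a defect of norm 0 with the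
  measure-preserving \<open>S m\<close> keeps its norm 0.\<close>

lemma (in multiplicative_system) comp_S_close_to_character:
  assumes chi: "dirichlet_character q chi" and F: "F \<in> L2 M" and n: "n \<ge> 1"
    and fixed: "\<And>p. prime p \<Longrightarrow> p dvd n \<Longrightarrow> L2_norm M ((F \<circ> S p) - cscale (chi p) F) = 0"
  shows "L2_norm M ((F \<circ> S n) - cscale (chi n) F) = 0"
  using n fixed
proof (induction n rule: less_induct)
  case (less n)
  show ?case
  proof (cases "n = 1")
    case True
    \<comment> \<open>\<open>S 1\<close> is idempotent by multiplicativity and injective, hence the
      identity on the carrier.\<close>
    have "S 1 x = x" if x: "x \<in> space M" for x
    proof -
      have "S 1 (S 1 x) = S 1 x" using multiplicative[of 1 1 x] x by simp
      moreover have "inj_on (S 1) (space M)" using bij[of 1] by (auto simp: bij_betw_def)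
      ultimately show ?thesis using x S_in_space[of 1 x] by (simp add: inj_on_def)
    qed
    then have "L2_norm M ((F \<circ> S n) - cscale (chi n) F) = L2_norm M (0 :: 'a \<Rightarrow> complex)"
      using True dirichlet_character_1[OF chi] by (intro L2_norm_cong) (simp add: cscale_def)
    then show ?thesis by (simp only: L2_norm_0)
  next
    case False
    then obtain p where p: "prime p" "p dvd n" using prime_factor_nat by blast
    then obtain m where m: "n = p * m" by (elim dvdE)
    have p1: "p \<ge> 1" "p > 1" using p(1) prime_gt_1_nat[of p] by auto
    have m1: "m \<ge> 1" "m < n" using m less.prems(1) p1 by (auto simp: Suc_le_eq)
    have IH: "L2_norm M ((F \<circ> S m) - cscale (chi m) F) = 0"
    proof (rule less.IH[OF m1(2,1)])
      fix r assume "prime r" "r dvd m"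
      then show "L2_norm M ((F \<circ> S r) - cscale (chi r) F) = 0" using m by (intro less.prems(2)) auto
    qed
    have Fp: "F \<circ> S p \<in> L2 M" and Fm: "F \<circ> S m \<in> L2 M" using F p1 m1 by (auto intro: comp_S_L2)
    have d: "(F \<circ> S p) - cscale (chi p) F \<in> L2 M" using F Fp by (intro L2.V_diff L2_cscale)
    have 1: "L2_norm M ((F \<circ> S n) - cscale (chi p) (F \<circ> S m)) = 0"
    proof -
      have "L2_norm M ((F \<circ> S n) - cscale (chi p) (F \<circ> S m)) = L2_norm M (((F \<circ> S p) - cscale (chi p) F) \<circ> S m)"
        using multiplicative[of p m] p1 m1 by (intro L2_norm_cong) (simp add: m cscale_def)
      also have "\<dots> = L2_norm M ((F \<circ> S p) - cscale (chi p) F)" by (rule L2_norm_comp_S[OF m1(1) d])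
      also have "\<dots> = 0" using p by (rule less.prems(2))
      finally show ?thesis .
    qed
    have 2: "L2_norm M (cscale (chi p) (F \<circ> S m) - cscale (chi n) F) = 0"
    proof -
      have "chi n = chi p * chi m" using chi m by (simp add: dirichlet_character_def)
      then have "cscale (chi p) (F \<circ> S m) - cscale (chi n) F = cscale (chi p) ((F \<circ> S m) - cscale (chi m) F)"
        by (simp add: cscale_def fun_eq_iff algebra_simps)
      then show ?thesis using IH by (simp only: L2_norm_cscale mult_zero_right)
    qed
    have "L2_norm M ((F \<circ> S n) - cscale (chi n) F) \<le>
        L2_norm M ((F \<circ> S n) - cscale (chi p) (F \<circ> S m)) + L2_norm M (cscale (chi p) (F \<circ> S m) - cscale (chi n) F)"
      by (intro L2_norm_triangle_sub L2_cscale Fm F comp_S_L2[OF less.prems(1)])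
    with 1 2 show ?thesis using L2_norm_nonneg[of M "(F \<circ> S n) - cscale (chi n) F"] by linarith
  qed
qed

context finitely_generated_multiplicative_system
begin

text \<open>By finite generation, and since \<open>chi\<close> has finite range, the defects take
  finitely many values. The nonzero ones are bounded below, so the series in \<open>H_char\<close>
  dominates a multiple of the reciprocals.\<close>

lemma exceptional_primes_summable:
  assumes chi: "dirichlet_character q chi" and F: "F \<in> H_char M S chi"
  shows "(\<lambda>p. 1 / real p) summable_on {p. prime p \<and> L2_norm M ((F \<circ> S p) - cscale (chi p) F) \<noteq> 0}"
proof -
  define D where "D = (\<lambda>p. L2_norm M ((F \<circ> S p) - cscale (chi p) F))"
  define E where "E = {p. prime p \<and> D p \<noteq> 0}"
  define g where "g = (\<lambda>(s :: 'a \<Rightarrow> 'a, c). L2_norm M (\<lambda>x. F (s x) - c * F x))"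
  have "D p = g (restrict (S p) (space M), chi p)" for p
    unfolding D_def g_def by (simp, intro L2_norm_cong) (simp add: cscale_def)
  then have "D ` E \<subseteq> g ` ({restrict (S p) (space M) |p. prime p} \<times> range chi)" by (auto simp: E_def)
  then have fin: "finite (D ` E)"
    by (rule finite_subset) (use finitely_generated finite_range_dirichlet_character[OF chi] in simp)
  have "(\<lambda>p. 1 / real p) summable_on E"
  proof (cases "E = {}")
    case False
    define c where "c = Min (D ` E)"
    have "c \<in> D ` E" unfolding c_def using fin False by (intro Min_in) auto
    then have c: "c > 0" by (auto simp: E_def D_def less_le)
    have c_le: "c \<le> D p" if "p \<in> E" for p unfolding c_def using that fin by (intro Min_le) auto
    have "(\<lambda>p. (D p)\<^sup>2 / real p) summable_on {p. prime p}" using F by (simp add: H_char_def D_def)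
    then have "(\<lambda>p. (D p)\<^sup>2 / real p) summable_on E" by (rule summable_on_subset) (auto simp: E_def)
    then have "(\<lambda>p. inverse (c\<^sup>2) * ((D p)\<^sup>2 / real p)) summable_on E" by (rule summable_on_cmult_right)
    then show ?thesis
    proof (rule summable_on_comparison_test)
      fix p assume p: "p \<in> E"
      have "1 \<le> inverse (c\<^sup>2) * (D p)\<^sup>2"
        using power_mono[OF c_le[OF p], of 2] c by (simp add: field_simps)
      then show "1 / real p \<le> inverse (c\<^sup>2) * ((D p)\<^sup>2 / real p)"
        using divide_right_mono[of 1 "inverse (c\<^sup>2) * (D p)\<^sup>2" "real p"] by simp
    qed auto
  qed simp
  then show ?thesis by (simp add: E_def D_def)
qed

text \<open>
  Along the progression \<open>n = Q k + 1\<close>, where \<open>Q\<close> is divisible by \<open>q\<close> and by all small exceptional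
  primes, most \<open>n\<close> satisfy \<open>S n F = F\<close>, so that the inner product of \<open>F\<close> and \<open>S n G\<close> is constant.
\<close>

lemma H_char_orthogonal_H_aper:
  assumes chi: "dirichlet_character q chi" and F: "F \<in> H_char M S chi" and G: "G \<in> H_aper M S"
  shows "L2_inner M F G = 0"
proof (rule ccontr)
  define z where "z = L2_inner M F G"
  \<comment> \<open>The summand 1 stands for the mean along the progression. In the 6, a factor 3
    comes from the density of bad \<open>k\<close> and a factor 2 from the bound for
    \<open>z - w k\<close>. In the end \<open>\<epsilon> * K\<close> is half of
    \<open>cmod z\<close>.\<close>
  define K where "K = 1 + 6 * L2_norm M F * L2_norm M G"
  define \<epsilon> where "\<epsilon> = cmod z / (2 * K)"
  assume "L2_inner M F G \<noteq> 0"
  then have z: "cmod z > 0" by (simp add: z_def)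
  have K: "K \<ge> 1" by (simp add: K_def)
  have \<epsilon>: "\<epsilon> > 0" using z K by (simp add: \<epsilon>_def)
  have FL: "F \<in> L2 M" and GL: "G \<in> L2 M" using F G by (auto simp: H_char_def H_aper_def)
  have q: "q \<ge> 1" using chi by (simp add: dirichlet_character_def)
  \<comment> \<open>Primes dividing \<open>q\<close> cause no trouble: they never divide
    \<open>Q * k + 1\<close>, as \<open>q\<close> divides \<open>Q\<close>.\<close>
  define E where "E = {p. prime p \<and> L2_norm M ((F \<circ> S p) - cscale (chi p) F) \<noteq> 0 \<and> coprime p q}"
  have "(\<lambda>p. 1 / real p) summable_on E"
    by (rule summable_on_subset[OF exceptional_primes_summable[OF chi F]]) (auto simp: E_def)
  then obtain E1 where E1: "finite E1" "E1 \<subseteq> E" and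
    few: "\<And>Q. (\<And>p. p \<in> E - E1 \<Longrightarrow> \<not> p dvd Q) \<Longrightarrow>
      \<exists>N0. \<forall>N\<ge>N0. real (card {k\<in>{1..N}. \<exists>p\<in>E - E1. p dvd Q * k + 1}) \<le> 3 * \<epsilon> * real N"
    by (rule few_progression_terms_with_exceptional_prime[OF _ _ \<epsilon>]) (auto simp: E_def)
  have E_prime: "prime p" if "p \<in> E" for p using that by (simp add: E_def)
  define Q where "Q = q * \<Prod>E1"
  have "\<Prod>E1 > 0" using E1 E_prime prime_gt_0_nat by (intro prod_pos) blast
  then have Q1: "Q \<ge> 1" using q by (simp add: Q_def Suc_le_eq)
  have "\<not> p dvd Q" if p: "p \<in> E - E1" for p
  proof
    assume "p dvd Q"
    have pp: "prime p" "coprime p q" using p by (auto simp: E_def)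
    then have "\<not> p dvd q" using coprime_common_divisor_nat[of p q p] by auto
    with \<open>p dvd Q\<close> pp have "p dvd \<Prod>E1" by (simp add: Q_def prime_dvd_mult_iff)
    then obtain r where "r \<in> E1" "p dvd r" using pp E1(1) by (auto simp: prime_dvd_prod_iff)
    then have "p = r" using pp E1(2) E_prime by (intro primes_dvd_imp_eq) auto
    with \<open>r \<in> E1\<close> p show False by simp
  qed
  from few[OF this] obtain N0 where
    N0: "\<And>N. N \<ge> N0 \<Longrightarrow> real (card {k\<in>{1..N}. \<exists>p\<in>E - E1. p dvd Q * k + 1}) \<le> 3 * \<epsilon> * real N" by blast
  define a where "a = (\<lambda>N. L2_norm M (cscale (1 / of_nat N) (\<Sum>k=1..N. G \<circ> S (Q * k + 1))))"
  have "a \<longlonglongrightarrow> 0" using G Q1 unfolding a_def H_aper_def by blast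
  then have "(\<lambda>N. L2_norm M F * a N) \<longlonglongrightarrow> 0" using tendsto_mult_right_zero by blast
  then have "eventually (\<lambda>N. L2_norm M F * a N < \<epsilon>) sequentially" using \<epsilon> by (rule order_tendstoD(2))
  then obtain N1 where N1: "\<And>N. N \<ge> N1 \<Longrightarrow> L2_norm M F * a N < \<epsilon>" by (auto simp: eventually_sequentially)
  define N where "N = max 1 (max N0 N1)"
  have N: "N \<ge> 1" "N \<ge> N0" "N \<ge> N1" by (auto simp: N_def)
  define bad where "bad = {k\<in>{1..N}. \<exists>p\<in>E - E1. p dvd Q * k + 1}"
  define w where "w = (\<lambda>k. L2_inner M F (G \<circ> S (Q * k + 1)))"
  have GS: "G \<circ> S (Q * k + 1) \<in> L2 M" for k using GL by (intro comp_S_L2) auto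
  have w_good: "w k = z" if k: "k \<in> {1..N} - bad" for k
  proof -
    define n where "n = Q * k + 1"
    have n1: "n \<ge> 1" by (simp add: n_def)
    have "L2_norm M ((F \<circ> S n) - cscale (chi n) F) = 0"
    proof (rule comp_S_close_to_character[OF chi FL n1])
      fix p assume p: "prime p" "p dvd n"
      have pQ: "\<not> p dvd Q"
      proof
        assume "p dvd Q"
        then have "p dvd Q * k" by simp
        with p(2) have "p dvd 1" unfolding n_def using dvd_add_right_iff by blast
        with p(1) show False by auto
      qed
      have "\<not> p dvd q" using pQ by (auto simp: Q_def)
      then have "coprime p q" using p(1) by (simp add: prime_imp_coprime)
      moreover have "p \<notin> E1" using pQ E1(1) by (auto simp: Q_def intro: dvd_mult dvd_prodI)
      moreover have "p \<notin> E - E1" using k p(2) by (auto simp: bad_def n_def)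
      ultimately show "L2_norm M ((F \<circ> S p) - cscale (chi p) F) = 0" using p(1) by (auto simp: E_def)
    qed
    moreover have "chi n = 1"
    proof -
      have "n = 1 + q * (\<Prod>E1 * k)" by (simp add: n_def Q_def mult.assoc)
      then have "[n = 1] (mod q)" by (simp only: cong_def mod_mult_self2)
      then show ?thesis using dirichlet_character_cong[OF chi] dirichlet_character_1[OF chi] by metis
    qed
    ultimately have d0: "L2_norm M ((F \<circ> S n) - F) = 0" by simp
    have FS: "F \<circ> S n \<in> L2 M" "G \<circ> S n \<in> L2 M" using FL GL n1 by (auto intro: comp_S_L2)
    have "cmod (L2_inner M ((F \<circ> S n) - F) (G \<circ> S n)) \<le> L2_norm M ((F \<circ> S n) - F) * L2_norm M (G \<circ> S n)"
      using FS FL by (intro L2_Cauchy_Schwarz L2.V_diff)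
    then have "L2_inner M ((F \<circ> S n) - F) (G \<circ> S n) = 0" using d0 by simp
    \<comment> \<open>\<open>F\<close> is exchanged for \<open>F \<circ> S n\<close>, after which
      the common map \<open>S n\<close> drops out.\<close>
    then have "L2_inner M F (G \<circ> S n) = L2_inner M (F \<circ> S n) (G \<circ> S n)"
      using FS FL by (simp add: L2_inner_diff_left)
    also have "\<dots> = z" unfolding z_def by (rule L2_inner_comp_S[OF n1 FL GL])
    finally show ?thesis by (simp add: w_def n_def)
  qed
  have w_le: "cmod (w k) \<le> L2_norm M F * L2_norm M G" for k
    using L2_Cauchy_Schwarz[OF FL GS[of k]] L2_norm_comp_S[of "Q * k + 1" G] GL by (simp add: w_def)
  have z_le: "cmod z \<le> L2_norm M F * L2_norm M G" unfolding z_def by (rule L2_Cauchy_Schwarz[OF FL GL])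
  have sum_w: "cmod (\<Sum>k=1..N. w k) \<le> real N * \<epsilon>"
  proof -
    define H where "H = (\<Sum>k=1..N. G \<circ> S (Q * k + 1))"
    have HL: "H \<in> L2 M" unfolding H_def by (intro L2_sum GS)
    have "(\<Sum>k=1..N. w k) = L2_inner M F H"
      unfolding H_def w_def using GS FL by (intro L2_inner_sum_right[symmetric]) auto
    then have "cmod (\<Sum>k=1..N. w k) \<le> L2_norm M F * L2_norm M H" using L2_Cauchy_Schwarz[OF FL HL] by simp
    also have "L2_norm M H = real N * a N"
      using N(1) unfolding a_def H_def[symmetric] L2_norm_cscale by (simp add: norm_divide)
    also have "L2_norm M F * (real N * a N) \<le> real N * \<epsilon>"
      using mult_left_mono[OF less_imp_le[OF N1[OF N(3)]], of "real N"] by (simp add: mult_ac)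
    finally show ?thesis .
  qed
  have "of_nat N * z = (\<Sum>k=1..N. w k) + (\<Sum>k\<in>bad. z - w k)"
  proof -
    have "(\<Sum>k=1..N. z - w k) = (\<Sum>k\<in>bad. z - w k)"
      using w_good by (intro sum.mono_neutral_right) (auto simp: bad_def)
    moreover have "(\<Sum>k=1..N. z - w k) = of_nat N * z - (\<Sum>k=1..N. w k)" by (simp add: sum_subtractf)
    ultimately show ?thesis by (metis add.commute diff_add_cancel)
  qed
  then have "real N * cmod z \<le> cmod (\<Sum>k=1..N. w k) + cmod (\<Sum>k\<in>bad. z - w k)"
    by (metis norm_mult norm_of_nat norm_triangle_ineq)
  also have "cmod (\<Sum>k\<in>bad. z - w k) \<le> (\<Sum>k\<in>bad. 2 * (L2_norm M F * L2_norm M G))"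
  proof (rule order_trans[OF norm_sum], rule sum_mono)
    fix k
    show "cmod (z - w k) \<le> 2 * (L2_norm M F * L2_norm M G)"
      using norm_triangle_ineq4[of z "w k"] z_le w_le[of k] by linarith
  qed
  also have "\<dots> = real (card bad) * (2 * (L2_norm M F * L2_norm M G))" by simp
  also have "\<dots> \<le> 3 * \<epsilon> * real N * (2 * (L2_norm M F * L2_norm M G))"
    unfolding bad_def by (intro mult_right_mono N0 N) auto
  also note sum_w
  finally have "real N * cmod z \<le> real N * (\<epsilon> * K)" by (simp add: K_def algebra_simps)
  then have "cmod z \<le> \<epsilon> * K" using N(1) by simp
  also have "\<dots> = cmod z / 2" using K by (simp add: \<epsilon>_def)
  finally show False using z by simp
qed

text \<open>For fixed \<open>G\<close>, orthogonality passes to linear spans and, by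
  Cauchy--Schwarz, to closures.\<close>

lemma H_pr_rat_orthogonal_H_aper:
  assumes F: "F \<in> H_pr_rat M S" and G: "G \<in> H_aper M S"
  shows "L2_inner M F G = 0"
proof -
  have GL: "G \<in> L2 M" using G by (simp add: H_aper_def)
  let ?U = "\<Union>chi\<in>{chi. \<exists>q. dirichlet_character q chi}. H_char M S chi"
  define B where "B = {F \<in> L2 M. L2_inner M F G = 0}"
  have "cfun.subspace B"
  proof (rule cfun.subspaceI)
    show "0 \<in> B" by (simp add: B_def L2_0 L2_inner_def)
  qed (use GL in \<open>auto simp: B_def L2_add L2_cscale L2_inner_add_left L2_inner_cscale_left\<close>)
  moreover have "?U \<subseteq> B" using H_char_orthogonal_H_aper G by (auto simp: B_def H_char_def)
  ultimately have span: "cfun.span ?U \<subseteq> B" by (intro cfun.span_minimal)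
  have FL: "F \<in> L2 M" using F by (simp add: H_pr_rat_def L2_closure_def)
  have "cmod (L2_inner M F G) \<le> 0 + e" if e: "e > 0" for e
  proof -
    have "e / (L2_norm M G + 1) > 0" using e by (intro divide_pos_pos add_nonneg_pos) auto
    with F obtain F' where F': "F' \<in> cfun.span ?U" "L2_norm M (F - F') < e / (L2_norm M G + 1)"
      unfolding H_pr_rat_def by (rule L2_closureD)
    then have F'B: "F' \<in> L2 M" "L2_inner M F' G = 0" using span by (auto simp: B_def)
    have "cmod (L2_inner M F G) = cmod (L2_inner M (F - F') G)"
      using F'B FL GL by (simp add: L2_inner_diff_left)
    also have "\<dots> \<le> L2_norm M (F - F') * L2_norm M G"
      using F'B FL GL by (intro L2_Cauchy_Schwarz L2.V_diff)
    also have "\<dots> \<le> e / (L2_norm M G + 1) * (L2_norm M G + 1)"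
      using F'(2) e by (intro mult_mono) (auto intro: add_nonneg_nonneg)
    also have "\<dots> = e"
    proof -
      have "L2_norm M G + 1 > 0" by (simp add: add_nonneg_pos)
      then show ?thesis by simp
    qed
    finally show ?thesis by simp
  qed
  then have "cmod (L2_inner M F G) \<le> 0" by (rule field_le_epsilon)
  then show ?thesis by simp
qed

end

theorem theorem1p28:
  fixes M :: "'a::metric_space measure" and S :: "nat \<Rightarrow> 'a \<Rightarrow> 'a"
  assumes "finitely_generated_multiplicative_system M S"
  shows "L2_orthogonal_direct_sum M (H_pr_rat M S) (H_aper M S)"
proof -
  interpret finitely_generated_multiplicative_system M S by (rule assms)
  have sub: "H_pr_rat M S \<subseteq> L2 M" "H_aper M S \<subseteq> L2 M" by (auto simp: H_pr_rat_def L2_closure_def H_aper_def)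
  have "\<exists>P Q. F = P + Q \<and> P \<in> H_pr_rat M S \<and> Q \<in> H_aper M S" if F: "F \<in> L2 M" for F
  proof -
    obtain P where P: "P \<in> H_pr_rat M S" "\<And>G. G \<in> H_pr_rat M S \<Longrightarrow> L2_inner M (F - P) G = 0"
      using L2_orthogonal_decomposition[OF closed_H_pr_rat F] by blast
    have "F - P \<in> H_aper M S"
      using P F sub by (intro orthogonal_to_H_pr_rat_imp_H_aper L2.V_diff) auto
    moreover have "F = P + (F - P)" by simp
    ultimately show ?thesis using P(1) by blast
  qed
  then have "L2 M = {F + G | F G. F \<in> H_pr_rat M S \<and> G \<in> H_aper M S}"
    using sub L2_add by blast
  then show ?thesis
    unfolding L2_orthogonal_direct_sum_def
    using closed_H_pr_rat closed_H_aper H_pr_rat_orthogonal_H_aper by blast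
qed

end
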